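(* For every constant $\varepsilon>0$ there exists a catalytic algorithm that, given a prime $p=\mathsf{poly}(n)$, the graph $\mathsf{Grid}_{n,n}$ with edge weights $\mu:E(\mathsf{Grid}_{n,n})\to\mathbb{N}$ given by an oracle $\mathcal{D}$ that returns the weights modulo $p$, and two vertices $u,v\in V(\mathsf{Grid}_{n,n})$ (described by their layers and their indices within the layer) such that the distance between $u$ and $v$ is a power of two, computes $$\mathcal{W}_{u,v}=\sum_{P\ u,v\text{-path}}\mu(P)\bmod p.$$ The algorithm runs in time $\mathcal{O}(n^{3+\varepsilon})$, uses free space $\mathcal{O}(\log n)$, catalytic space $\frac{n}{2^{\Omega(\sqrt{\log n})}}$, and $\mathcal{O}\!\left(\frac{n^{3+\varepsilon}}{2^{3\sqrt{\log n}}}\right)$ weight-oracle queries.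
   Context: $\mathsf{Grid}_{n,n}$ is the directed graph with vertex set $\{(i,j):0\le i,j\le n\}$ and edges $(i,j)\to(i+1,j)$ for $0\le i\le n-1$, $0\le j\le n$; $(i,j)\to(i+1,j+1)$ for $0\le i,j\le n-1$; and $(i,j)\to(i+1,j-1)$ for $0\le i\le n-1$, $1\le j\le n$. The layer of $(i,j)$ is $i$; the index within the layer is $j$. The weight $\mu(P)$ of a path $P$ is the product of the weights of its edges. Catalytic model: the algorithm has a free (work) tape and a catalytic tape whose arbitrary initial contents must be restored exactly at the end of the computation. *)

theory Defs
  imports
    "HOL-Library.Log_Nat"
    "HOL-Library.Landau_Symbols"
    "HOL-Computational_Algebra.Computational_Algebra"
    "Graph_Theory.Graph_Theory"
begin

section \<open>The grid graph\<close>

text \<open>A vertex \<open>(i, j)\<close> has layer \<open>i\<close> and index \<open>j\<close> within its layer; an arc is the pair of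
  its end points.\<close>

definition grid_arcs :: "nat \<Rightarrow> ((nat \<times> nat) \<times> (nat \<times> nat)) set" where
  "grid_arcs n =
     {((i, j), (i + 1, j)) | i j. i < n \<and> j \<le> n} \<union>
     {((i, j), (i + 1, j + 1)) | i j. i < n \<and> j < n} \<union>
     {((i, j), (i + 1, j - 1)) | i j. i < n \<and> 1 \<le> j \<and> j \<le> n}"

definition Grid :: "nat \<Rightarrow> (nat \<times> nat, (nat \<times> nat) \<times> (nat \<times> nat)) pre_digraph" where
  "Grid n = \<lparr>verts = {(i, j). i \<le> n \<and> j \<le> n}, arcs = grid_arcs n, tail = fst, head = snd\<rparr>"

text \<open>The distance is \<open>\<infinity>\<close> if the second vertex is not reachable from the first.\<close>

definition graph_dist :: "('a, 'b) pre_digraph \<Rightarrow> 'a \<Rightarrow> 'a \<Rightarrow> ereal" where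
  "graph_dist G u v = wf_digraph.\<mu> G (\<lambda>_. 1) u v"

definition path_weight :: "('b \<Rightarrow> nat) \<Rightarrow> 'b list \<Rightarrow> nat" where
  "path_weight \<mu> P = prod_list (map \<mu> P)"

definition path_sum :: "('a, 'b) pre_digraph \<Rightarrow> ('b \<Rightarrow> nat) \<Rightarrow> 'a \<Rightarrow> 'a \<Rightarrow> nat" where
  "path_sum G \<mu> u v = (\<Sum>P\<in>{P. pre_digraph.apath G u P v}. path_weight \<mu> P)"

section \<open>Catalytic algorithms\<close>

text \<open>
  A catalytic algorithm is a finite random access program with two memories:

  \<^item> a free tape of cells holding natural numbers, measured by the total number of bits it holds
    (so a free space bound of \<open>O(log n)\<close> also limits every machine word to \<open>O(log n)\<close> bits);
  \<^item> a catalytic tape of bits, of fixed length.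

  Instructions take unit time. Operands are addresses of free cells. An oracle query is a list of
  numbers read from free cells, and the answer is stored in a free cell.
\<close>

datatype arith = Add | Sub | Mul | Div | Mod

datatype instr =
    Const nat nat
  | Arith arith nat nat nat
  | Load nat nat
  | Store nat nat
  | CatLoad nat nat
  | CatStore nat nat
  | Query nat "nat list"
  | JumpZero nat nat

type_synonym program = "instr list"

record config =
  pc :: nat
  free :: "nat \<Rightarrow> nat"
  cat :: "bool list"

fun arith_val :: "arith \<Rightarrow> nat \<Rightarrow> nat \<Rightarrow> nat" where
  "arith_val Add a b = a + b"
| "arith_val Sub a b = a - b"
| "arith_val Mul a b = a * b"
| "arith_val Div a b = a div b"
| "arith_val Mod a b = a mod b"

definition set_free :: "nat \<Rightarrow> nat \<Rightarrow> config \<Rightarrow> config" where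
  "set_free x a s = s\<lparr>free := (free s)(x := a), pc := Suc (pc s)\<rparr>"

text \<open>\<open>None\<close> means that the computation is stuck: the catalytic tape was accessed outside of its
  cells.\<close>

fun exec :: "(nat list \<Rightarrow> nat) \<Rightarrow> instr \<Rightarrow> config \<Rightarrow> config option" where
  "exec D (Const x a) s = Some (set_free x a s)"
| "exec D (Arith f x y z) s = Some (set_free x (arith_val f (free s y) (free s z)) s)"
| "exec D (Load x y) s = Some (set_free x (free s (free s y)) s)"
| "exec D (Store x y) s = Some (set_free (free s x) (free s y) s)"
| "exec D (CatLoad x y) s =
     (if free s y < length (cat s)
      then Some (set_free x (of_bool (cat s ! free s y)) s) else None)"
| "exec D (CatStore x y) s =
     (if free s x < length (cat s)
      then Some (s\<lparr>cat := (cat s)[free s x := (free s y \<noteq> 0)], pc := Suc (pc s)\<rparr>) else None)"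
| "exec D (Query x ys) s = Some (set_free x (D (map (free s) ys)) s)"
| "exec D (JumpZero x l) s = Some (s\<lparr>pc := (if free s x = 0 then l else Suc (pc s))\<rparr>)"

definition halted :: "program \<Rightarrow> config \<Rightarrow> bool" where
  "halted A s \<longleftrightarrow> length A \<le> pc s"

definition step :: "program \<Rightarrow> (nat list \<Rightarrow> nat) \<Rightarrow> config \<Rightarrow> config option" where
  "step A D s = (if halted A s then None else exec D (A ! pc s) s)"

definition querying :: "program \<Rightarrow> config \<Rightarrow> bool" where
  "querying A s \<longleftrightarrow> \<not> halted A s \<and> (\<exists>x ys. A ! pc s = Query x ys)"

definition initial :: "nat list \<Rightarrow> bool list \<Rightarrow> config" where
  "initial xs \<tau> = \<lparr>pc = 0, free = (\<lambda>i. if i < length xs then xs ! i else 0), cat = \<tau>\<rparr>"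

text \<open>\<open>floorlog 2 a\<close> is the number of binary digits of \<open>a\<close> for \<open>a > 0\<close>. Every cell below the last
  nonzero cell is charged at least one bit, so that positions of cells cannot hide information.\<close>

definition fits_free_space :: "nat \<Rightarrow> (nat \<Rightarrow> nat) \<Rightarrow> bool" where
  "fits_free_space S f \<longleftrightarrow>
     (\<exists>m. (\<forall>i\<ge>m. f i = 0) \<and> (\<Sum>i<m. max 1 (floorlog 2 (f i))) \<le> S)"

text \<open>Algorithm \<open>A\<close> with oracle \<open>D\<close>, input \<open>xs\<close> and initial catalytic tape \<open>\<tau>\<close> halts with output
  \<open>y\<close> in cell 0 and with the catalytic tape restored, within time \<open>T\<close>, free space \<open>S\<close> and using at
  most \<open>Q\<close> queries. The list \<open>cs\<close> is the sequence of all configurations of the run. The catalytic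
  space is \<open>length \<tau>\<close>.\<close>

definition catalytic_computes ::
  "program \<Rightarrow> (nat list \<Rightarrow> nat) \<Rightarrow> nat list \<Rightarrow> bool list \<Rightarrow> nat \<Rightarrow> nat \<Rightarrow> nat \<Rightarrow> nat \<Rightarrow> bool" where
  "catalytic_computes A D xs \<tau> y T S Q \<longleftrightarrow>
     (\<exists>cs. cs \<noteq> [] \<and> hd cs = initial xs \<tau> \<and>
        successively (\<lambda>s s'. step A D s = Some s') cs \<and>
        halted A (last cs) \<and> free (last cs) 0 = y \<and> cat (last cs) = \<tau> \<and>
        length cs - 1 \<le> T \<and>
        (\<forall>s\<in>set cs. fits_free_space S (free s)) \<and>
        length (filter (querying A) cs) \<le> Q)"

text \<open>The query \<open>[i, j, i', j']\<close> asks for the weight of the arc from \<open>(i, j)\<close> to \<open>(i', j')\<close>. Nothing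
  is assumed about the answers to queries that are not arcs of the grid.\<close>

definition weight_oracle ::
  "nat \<Rightarrow> nat \<Rightarrow> ((nat \<times> nat) \<times> (nat \<times> nat) \<Rightarrow> nat) \<Rightarrow> (nat list \<Rightarrow> nat) \<Rightarrow> bool" where
  "weight_oracle n p \<mu> D \<longleftrightarrow>
     (\<forall>i j i' j'. ((i, j), (i', j')) \<in> arcs (Grid n) \<longrightarrow>
        D [i, j, i', j'] = \<mu> ((i, j), (i', j')) mod p)"

end

theory Submission
  imports Defs "HOL-Library.Discrete_Functions" "HOL-Real_Asymp.Real_Asymp"
begin

text \<open>
  Vectors over \<open>\<int>\<^sub>p\<close> are kept in catalytic registers. If \<open>A\<^sub>1\<close> and \<open>A\<^sub>2\<close> are the weight matrices of two
  consecutive slabs of the grid, then \<open>V += A\<^sub>1 X; Y += A\<^sub>2 V; V -= A\<^sub>1 X; Y -= A\<^sub>2 V\<close> adds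
  \<open>A\<^sub>2 A\<^sub>1 X\<close> to \<open>Y\<close> and restores \<open>V\<close>, whatever \<open>V\<close> contains. Halving the distance \<open>2\<^sup>k\<close> recursively costs
  \<open>4\<^sup>k\<close> matrix updates and three vector registers.

  Registers of full width are too large. The layers are therefore cut into about \<open>2\<^sup>g\<close> blocks of width
  \<open>w\<close>, with \<open>g\<close> about \<open>sqrt (log n / d)\<close>. For walks longer than \<open>w\<close>, which occur on at most \<open>g\<close>
  levels of the recursion, one sums over the block of the midpoint; this costs a factor of at most
  \<open>2\<^sup>g\<close> per level, hence \<open>2\<^bsup>g * g\<^esup> = O(n\<^bsup>1 / d\<^esup>)\<close> altogether. Walks of length at most \<open>w\<close> that start
  in a block stay within a window of width \<open>3 * w\<close>.

  The recursion is unrolled into a single loop over its leaves, each of which is decoded from its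
  number, so that the free space is a constant number of words. As \<open>\<epsilon>\<close> is arbitrary, the bound
  on the running time also serves as the bound on the number of queries.
\<close>

section \<open>A structured language and its compiler\<close>

text \<open>The midpoint of a short walk need not lie in the block where the walk starts, so
  registers of one block are not closed under halving; windows of three blocks are. Indexing cells
  by the position modulo \<open>3 * w\<close> lets every window fill the same \<open>3 * w\<close>
  cells, so no data move between blocks. The price is aliasing, which the flags \<open>fs\<close>
  and \<open>fe\<close> resolve by naming the block of an end point.

  Since registers start with arbitrary contents, values are read only as differences: the target
  cell is compared before and after a transparent product, once with and once without 1 added to the
  source cell. This isolates one matrix entry. Moreover \<open>2 ^ b\<close> need not be a multiple
  of \<open>p\<close>, and contents above the last complete run of \<open>p\<close> values cannot be
  changed reversibly modulo \<open>p\<close>; an offset common to all registers avoids them.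

  The exponent 3 arises as the block width times \<open>4 ^ k \<le> n ^ 2\<close>. The algorithm
  knows \<open>p\<close> but not the polynomial that bounds it; that polynomial enters only the
  resource bounds.\<close>

datatype exp = Lit nat | Var nat | Bin arith exp exp

abbreviation exp_add (infixl "[+]" 65) where "a [+] b \<equiv> Bin Add a b"
abbreviation exp_sub (infixl "[-]" 65) where "a [-] b \<equiv> Bin Sub a b"
abbreviation exp_mul (infixl "[*]" 70) where "a [*] b \<equiv> Bin Mul a b"
abbreviation exp_div (infixl "[div]" 70) where "a [div] b \<equiv> Bin Div a b"
abbreviation exp_mod (infixl "[mod]" 70) where "a [mod] b \<equiv> Bin Mod a b"
text \<open>Subtraction truncates, so the value is nonzero exactly if the comparison holds.\<close>

abbreviation exp_le (infix "[\<le>]" 50) where "a [\<le>] b \<equiv> b [+] Lit 1 [-] a"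

datatype com =
    Assign nat exp
  | Read nat exp
  | Write exp exp
  | Ask nat "nat list"
  | Seq com com
  | Cond exp com com
  | While exp com

fun seqs :: "com list \<Rightarrow> com" where
  "seqs [] = Assign 0 (Var 0)"
| "seqs [c] = c"
| "seqs (c # cs) = Seq c (seqs cs)"

fun ev :: "exp \<Rightarrow> (nat \<Rightarrow> nat) \<Rightarrow> nat" where
  "ev (Lit a) f = a"
| "ev (Var x) f = f x"
| "ev (Bin g a b) f = arith_val g (ev a f) (ev b f)"

text \<open>The number of leaves. It serves twice: as the exponent of \<open>Z\<close> in the bound
  on values and as a bound on the scratch cells of an evaluation.\<close>

fun esize :: "exp \<Rightarrow> nat" where
  "esize (Bin g a b) = esize a + esize b"
| "esize _ = 1"

fun ecost :: "exp \<Rightarrow> nat" where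
  "ecost (Lit a) = 1"
| "ecost (Var x) = 2"
| "ecost (Bin g a b) = ecost a + ecost b + 1"

fun wf_exp :: "nat \<Rightarrow> nat \<Rightarrow> exp \<Rightarrow> bool" where
  "wf_exp K c (Lit a) \<longleftrightarrow> a \<le> c"
| "wf_exp K c (Var x) \<longleftrightarrow> x < K"
| "wf_exp K c (Bin g a b) \<longleftrightarrow> wf_exp K c a \<and> wf_exp K c b"

text \<open>\<open>K\<close> bounds the addresses of variables, \<open>c\<close> the literals and
  \<open>d\<close> the scratch cells of a single instruction.\<close>

fun wf_com :: "nat \<Rightarrow> nat \<Rightarrow> nat \<Rightarrow> com \<Rightarrow> bool" where
  "wf_com K c d (Assign x e) \<longleftrightarrow> x < K \<and> wf_exp K c e \<and> esize e \<le> d"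
| "wf_com K c d (Read x e) \<longleftrightarrow> x < K \<and> wf_exp K c e \<and> esize e \<le> d"
| "wf_com K c d (Write e e') \<longleftrightarrow> wf_exp K c e \<and> wf_exp K c e' \<and> esize e + esize e' \<le> d"
| "wf_com K c d (Ask x ys) \<longleftrightarrow> x < K \<and> (\<forall>y\<in>set ys. y < K)"
| "wf_com K c d (Seq c1 c2) \<longleftrightarrow> wf_com K c d c1 \<and> wf_com K c d c2"
| "wf_com K c d (Cond e c1 c2) \<longleftrightarrow> wf_exp K c e \<and> esize e \<le> d \<and> wf_com K c d c1 \<and> wf_com K c d c2"
| "wf_com K c d (While e c1) \<longleftrightarrow> wf_exp K c e \<and> esize e \<le> d \<and> wf_com K c d c1"

type_synonym state = "(nat \<Rightarrow> nat) \<times> bool list"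

text \<open>\<open>Z\<close> bounds every number that is ever assigned; a computation that would exceed it has no
  derivation. This is how derivations carry the free space bound.\<close>

inductive big :: "nat \<Rightarrow> (nat list \<Rightarrow> nat) \<Rightarrow> com \<Rightarrow> state \<Rightarrow> nat \<Rightarrow> state \<Rightarrow> bool" for Z D where
  Assign: "ev e f \<le> Z \<Longrightarrow> big Z D (Assign x e) (f, \<tau>) (ecost e + 2) (f(x := ev e f), \<tau>)"
| Read: "ev e f < length \<tau> \<Longrightarrow>
    big Z D (Read x e) (f, \<tau>) (ecost e + 1) (f(x := of_bool (\<tau> ! ev e f)), \<tau>)"
| Write: "ev e f < length \<tau> \<Longrightarrow>
    big Z D (Write e e') (f, \<tau>) (ecost e + ecost e' + 1) (f, \<tau>[ev e f := (ev e' f \<noteq> 0)])"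
| Ask: "D (map f ys) \<le> Z \<Longrightarrow> big Z D (Ask x ys) (f, \<tau>) 1 (f(x := D (map f ys)), \<tau>)"
| Seq: "big Z D c1 st1 t1 st2 \<Longrightarrow> big Z D c2 st2 t2 st3 \<Longrightarrow> big Z D (Seq c1 c2) st1 (t1 + t2) st3"
| CondT: "ev e (fst st) \<noteq> 0 \<Longrightarrow> big Z D c1 st t st' \<Longrightarrow> big Z D (Cond e c1 c2) st (ecost e + 3 + t) st'"
| CondF: "ev e (fst st) = 0 \<Longrightarrow> big Z D c2 st t st' \<Longrightarrow> big Z D (Cond e c1 c2) st (ecost e + 1 + t) st'"
| WhileF: "ev e (fst st) = 0 \<Longrightarrow> big Z D (While e c) st (ecost e + 1) st"
| WhileT: "ev e (fst st) \<noteq> 0 \<Longrightarrow> big Z D c st t st' \<Longrightarrow> big Z D (While e c) st' t' st'' \<Longrightarrow>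
    big Z D (While e c) st (ecost e + 3 + t + t') st''"

text \<open>The machine has neither a copy instruction nor an unconditional jump.
  \<open>Const\<close> with value 0, followed by \<open>Add\<close> or by \<open>JumpZero\<close>,
  replaces them here and in \<open>compile\<close>.\<close>

fun cexp :: "nat \<Rightarrow> exp \<Rightarrow> instr list" where
  "cexp h (Lit a) = [Const h a]"
| "cexp h (Var x) = [Const h 0, Arith Add h h x]"
| "cexp h (Bin g a b) = cexp h a @ cexp (Suc h) b @ [Arith g h h (Suc h)]"

lemma length_cexp [simp]: "length (cexp h e) = ecost e"
  by (induction h e rule: cexp.induct) auto

fun csize :: "com \<Rightarrow> nat" where
  "csize (Assign x e) = ecost e + 2"
| "csize (Read x e) = ecost e + 1"
| "csize (Write e e') = ecost e + ecost e' + 1"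
| "csize (Ask x ys) = 1"
| "csize (Seq c1 c2) = csize c1 + csize c2"
| "csize (Cond e c1 c2) = ecost e + csize c1 + csize c2 + 3"
| "csize (While e c) = ecost e + csize c + 3"

text \<open>Cells from \<open>K\<close> on hold intermediate results; \<open>k\<close> is the address of the first instruction.\<close>

fun compile :: "nat \<Rightarrow> nat \<Rightarrow> com \<Rightarrow> instr list" where
  "compile K k (Assign x e) = cexp K e @ [Const x 0, Arith Add x x K]"
| "compile K k (Read x e) = cexp K e @ [CatLoad x K]"
| "compile K k (Write e e') = cexp K e @ cexp (Suc K) e' @ [CatStore K (Suc K)]"
| "compile K k (Ask x ys) = [Query x ys]"
| "compile K k (Seq c1 c2) = compile K k c1 @ compile K (k + csize c1) c2"
| "compile K k (Cond e c1 c2) =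
     cexp K e @ [JumpZero K (k + ecost e + csize c1 + 3)] @ compile K (k + ecost e + 1) c1 @
     [Const K 0, JumpZero K (k + ecost e + csize c1 + csize c2 + 3)] @
     compile K (k + ecost e + csize c1 + 3) c2"
| "compile K k (While e c) =
     cexp K e @ [JumpZero K (k + ecost e + csize c + 3)] @ compile K (k + ecost e + 1) c @
     [Const K 0, JumpZero K k]"

lemma length_compile [simp]: "length (compile K k c) = csize c"
  by (induction K k c rule: compile.induct) auto

section \<open>Runs of the machine with an invariant on every configuration\<close>

inductive steps :: "program \<Rightarrow> (nat list \<Rightarrow> nat) \<Rightarrow> (config \<Rightarrow> bool) \<Rightarrow> nat \<Rightarrow> config \<Rightarrow> config \<Rightarrow> bool"
  for A D P where
  stop: "P s \<Longrightarrow> steps A D P 0 s s"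
| move: "P s \<Longrightarrow> step A D s = Some s' \<Longrightarrow> steps A D P k s' s'' \<Longrightarrow> steps A D P (Suc k) s s''"

lemma steps_trans:
  assumes "steps A D P k s s'" "steps A D P l s' s''"
  shows "steps A D P (k + l) s s''"
  using assms by (induction rule: steps.induct) (auto intro: steps.move)

lemma steps_single: "P s \<Longrightarrow> step A D s = Some s' \<Longrightarrow> P s' \<Longrightarrow> steps A D P 1 s s'"
  using steps.move[OF _ _ steps.stop] by simp

lemma steps_imp_list:
  assumes "steps A D P k s s'"
  shows "\<exists>cs. cs \<noteq> [] \<and> hd cs = s \<and> last cs = s' \<and> length cs = Suc k \<and>
    successively (\<lambda>s s'. step A D s = Some s') cs \<and> (\<forall>s\<in>set cs. P s)"
  using assms
proof (induction rule: steps.induct)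
  case (stop s)
  then show ?case by (intro exI[of _ "[s]"]) auto
next
  case (move s s' k s'')
  then obtain cs where cs: "cs \<noteq> []" "hd cs = s'" "last cs = s''" "length cs = Suc k"
    "successively (\<lambda>s s'. step A D s = Some s') cs" "\<forall>s\<in>set cs. P s" by blast
  with move show ?case
    by (intro exI[of _ "s # cs"]) (auto simp: successively_Cons)
qed

lemma querying_not_halted: "querying A s \<Longrightarrow> \<not> halted A s"
  by (simp add: querying_def)

text \<open>Queries are bounded by counting moves: a run of \<open>k\<close> moves has
  \<open>k + 1\<close> configurations, but the last one is halted and hence does not query.\<close>

lemma catalytic_computes_steps:
  assumes "steps A D (\<lambda>s. fits_free_space S (free s)) k (initial xs \<tau>) s"
    and "halted A s" "free s 0 = y" "cat s = \<tau>" "k \<le> T" "k \<le> Q"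
  shows "catalytic_computes A D xs \<tau> y T S Q"
proof -
  obtain cs where cs: "cs \<noteq> []" "hd cs = initial xs \<tau>" "last cs = s" "length cs = Suc k"
    "successively (\<lambda>s s'. step A D s = Some s') cs" "\<forall>s\<in>set cs. fits_free_space S (free s)"
    using steps_imp_list[OF assms(1)] by blast
  have "cs = butlast cs @ [s]" using cs(1,3) append_butlast_last_id by metis
  then have "filter (querying A) cs = filter (querying A) (butlast cs)"
    using querying_not_halted[of A s] assms(2)
    by (metis append_Nil2 filter.simps(1,2) filter_append)
  then have "length (filter (querying A) cs) \<le> k"
    using cs(4) length_filter_le[of "querying A" "butlast cs"] by simp
  with cs assms show ?thesis unfolding catalytic_computes_def by (intro exI[of _ cs]) auto
qed

definition code_at :: "program \<Rightarrow> nat \<Rightarrow> instr list \<Rightarrow> bool" where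
  "code_at A k cs \<longleftrightarrow> (\<exists>xs ys. A = xs @ cs @ ys \<and> length xs = k)"

lemma code_at_append: "code_at A k (cs @ ds) \<longleftrightarrow> code_at A k cs \<and> code_at A (k + length cs) ds"
proof
  assume "code_at A k (cs @ ds)"
  then obtain xs ys where *: "A = xs @ (cs @ ds) @ ys" "length xs = k" by (auto simp: code_at_def)
  show "code_at A k cs \<and> code_at A (k + length cs) ds"
    unfolding code_at_def
    by (intro conjI exI[of _ xs] exI[of _ "ds @ ys"] exI[of _ "xs @ cs"] exI[of _ ys]) (use * in auto)
next
  assume "code_at A k cs \<and> code_at A (k + length cs) ds"
  then obtain xs ys zs us where *: "A = xs @ cs @ ys" "length xs = k" "A = zs @ ds @ us"
    "length zs = k + length cs" unfolding code_at_def by blast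
  then have "(xs @ cs) @ ys = zs @ (ds @ us)" by (metis append.assoc)
  moreover have "length (xs @ cs) = length zs" using * by simp
  ultimately have "zs = xs @ cs" using append_eq_append_conv by metis
  with * show "code_at A k (cs @ ds)" unfolding code_at_def
    by (intro exI[of _ xs] exI[of _ us]) auto
qed

lemma code_at_Cons: "code_at A k (c # cs) \<longleftrightarrow> k < length A \<and> A ! k = c \<and> code_at A (Suc k) cs"
proof -
  have "code_at A k [c] \<longleftrightarrow> k < length A \<and> A ! k = c"
  proof
    assume "code_at A k [c]"
    then show "k < length A \<and> A ! k = c" by (auto simp: code_at_def)
  next
    assume "k < length A \<and> A ! k = c"
    then show "code_at A k [c]" unfolding code_at_def
      by (intro exI[of _ "take k A"] exI[of _ "drop (Suc k) A"]) (auto simp: Cons_nth_drop_Suc)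
  qed
  then show ?thesis using code_at_append[of A k "[c]" cs] by simp
qed

section \<open>Simulation of the structured language by compiled code\<close>

locale layout =
  fixes A :: program and D :: "nat list \<Rightarrow> nat" and Z K c d :: nat
  assumes Z2: "2 \<le> Z" and cZ: "c \<le> Z" and d1: "1 \<le> d"
begin

definition good :: "(nat \<Rightarrow> nat) \<Rightarrow> bool" where
  "good g \<longleftrightarrow> (\<forall>x. g x \<le> Z ^ d) \<and> (\<forall>x\<ge>K + d. g x = 0)"

text \<open>Only the \<open>K\<close> program cells are tied to the abstract state; scratch cells
  may keep any left-over value within the bound.\<close>

definition sim :: "(nat \<Rightarrow> nat) \<Rightarrow> (nat \<Rightarrow> nat) \<Rightarrow> bool" where
  "sim f g \<longleftrightarrow> (\<forall>x<K. g x = f x \<and> f x \<le> Z) \<and> good g"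

abbreviation run :: "nat \<Rightarrow> config \<Rightarrow> config \<Rightarrow> bool" where
  "run \<equiv> steps A D (\<lambda>s. good (free s))"

abbreviation conf :: "nat \<Rightarrow> (nat \<Rightarrow> nat) \<Rightarrow> bool list \<Rightarrow> config" where
  "conf k g \<tau> \<equiv> \<lparr>pc = k, free = g, cat = \<tau>\<rparr>"

lemma Z_le: "Z \<le> Z ^ d"
  using Z2 d1 self_le_power[of Z d] by simp

lemma good_upd: "good g \<Longrightarrow> x < K + d \<Longrightarrow> v \<le> Z ^ d \<Longrightarrow> good (g(x := v))"
  by (auto simp: good_def)

lemma run_instr:
  assumes "k < length A" "A ! k = i" "good g" "exec D i (conf k g \<tau>) = Some s'" "good (free s')"
  shows "run 1 (conf k g \<tau>) s'"
  using assms by (intro steps_single) (auto simp: step_def halted_def)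

text \<open>Both operand bounds are at least 2, and \<open>x + y \<le> x * y\<close> for such
  numbers, so the product of the bounds covers every operation, addition included.\<close>

lemma ev_bound:
  assumes "wf_exp K c e" "\<forall>x<K. f x \<le> Z"
  shows "ev e f \<le> Z ^ esize e"
  using assms
proof (induction e)
  case (Bin g a b)
  have a: "ev a f \<le> Z ^ esize a" and b: "ev b f \<le> Z ^ esize b" using Bin by auto
  have pos: "1 \<le> esize e" for e by (induction e) auto
  have ge: "2 \<le> Z ^ esize e" for e using Z2 pos[of e] self_le_power[of Z "esize e"] by simp
  have sum: "Z ^ esize a + Z ^ esize b \<le> Z ^ esize a * Z ^ esize b"
  proof -
    obtain x y where "Z ^ esize a = x + 2" "Z ^ esize b = y + 2"
      using ge[of a] ge[of b] by (metis le_add_diff_inverse2)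
    then show ?thesis by (simp add: algebra_simps)
  qed
  show ?case
  proof (cases g)
    case Mul
    then show ?thesis using mult_le_mono[OF a b] by (simp add: power_add)
  next
    case Add
    then show ?thesis using a b sum by (simp add: power_add)
  next
    case Sub
    then show ?thesis using a b sum by (simp add: power_add)
  next
    case Div
    have "ev a f div ev b f \<le> ev a f" by simp
    then have "ev a f div ev b f \<le> Z ^ esize a * Z ^ esize b" using a sum by linarith
    then show ?thesis using Div by (simp add: power_add)
  next
    case Mod
    have "ev a f mod ev b f \<le> ev a f" by simp
    then have "ev a f mod ev b f \<le> Z ^ esize a * Z ^ esize b" using a sum by linarith
    then show ?thesis using Mod by (simp add: power_add)
  qed
qed (use Z2 cZ in auto)

text \<open>Stack discipline: evaluation at \<open>h\<close> leaves the cells below \<open>h\<close>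
  alone, so the left operand waits in \<open>h\<close> while the right one is computed from
  \<open>Suc h\<close> on.\<close>

lemma cexp_run:
  assumes "code_at A k (cexp h e)" "wf_exp K c e" "\<forall>x<K. g x = f x \<and> f x \<le> Z" "good g"
    "K \<le> h" "h + esize e \<le> K + d"
  shows "\<exists>g'. run (ecost e) (conf k g \<tau>) (conf (k + ecost e) g' \<tau>) \<and> good g' \<and>
    g' h = ev e f \<and> (\<forall>x<h. g' x = g x)"
  using assms
proof (induction e arbitrary: k h g)
  case (Lit a)
  then have "good (g(h := a))"
    using Z_le cZ by (intro good_upd) auto
  then have "run 1 (conf k g \<tau>) (conf (Suc k) (g(h := a)) \<tau>)"
    using Lit by (intro run_instr[where i="Const h a"]) (auto simp: set_free_def code_at_Cons)
  with \<open>good (g(h := a))\<close> show ?case by auto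
next
  case (Var x)
  have z: "good (g(h := 0))" using Var by (intro good_upd) auto
  have r1: "run 1 (conf k g \<tau>) (conf (Suc k) (g(h := 0)) \<tau>)"
    using Var z by (intro run_instr[where i="Const h 0"]) (auto simp: set_free_def code_at_Cons)
  have z': "good (g(h := g x))"
    using Var Z_le by (intro good_upd) (auto intro: order_trans)
  have "run 1 (conf (Suc k) (g(h := 0)) \<tau>) (conf (Suc (Suc k)) (g(h := g x)) \<tau>)"
    using Var z z' by (intro run_instr[where i="Arith Add h h x"])
      (auto simp: set_free_def code_at_Cons)
  note r = steps_trans[OF r1 this]
  have "1 + 1 = ecost (Var x)" "Suc (Suc k) = k + ecost (Var x)" by simp_all
  note r = r[unfolded this]
  have "(g(h := g x)) h = ev (Var x) f" "\<forall>y<h. (g(h := g x)) y = g y" using Var by auto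
  with r z' show ?case by blast
next
  case (Bin F a b)
  have pos: "1 \<le> esize e" for e by (induction e) auto
  have at: "code_at A k (cexp h a)" "code_at A (k + ecost a) (cexp (Suc h) b)"
    "code_at A (k + ecost a + ecost b) [Arith F h h (Suc h)]"
    using Bin.prems(1) by (auto simp: code_at_append code_at_Cons add.assoc)
  obtain g1 where g1: "run (ecost a) (conf k g \<tau>) (conf (k + ecost a) g1 \<tau>)" "good g1"
    "g1 h = ev a f" "\<forall>x<h. g1 x = g x"
    using Bin.IH(1)[OF at(1) _ Bin.prems(3,4,5)] Bin.prems pos[of b] by auto
  have ag: "\<forall>x<K. g1 x = f x \<and> f x \<le> Z" using g1 Bin.prems by auto
  obtain g2 where g2: "run (ecost b) (conf (k + ecost a) g1 \<tau>) (conf (k + ecost a + ecost b) g2 \<tau>)"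
    "good g2" "g2 (Suc h) = ev b f" "\<forall>x<Suc h. g2 x = g1 x"
    using Bin.IH(2)[OF at(2) _ ag g1(2)] Bin.prems pos[of a] by auto
  let ?v = "arith_val F (ev a f) (ev b f)"
  have "ev (Bin F a b) f \<le> Z ^ esize (Bin F a b)"
    using Bin.prems by (intro ev_bound) auto
  also have "\<dots> \<le> Z ^ d" using Bin.prems Z2 by (intro power_increasing) auto
  finally have v: "?v \<le> Z ^ d" by simp
  have z: "good (g2(h := ?v))" using Bin.prems g2 v pos[of a] by (intro good_upd) auto
  have "run 1 (conf (k + ecost a + ecost b) g2 \<tau>) (conf (Suc (k + ecost a + ecost b)) (g2(h := ?v)) \<tau>)"
    using g2 g1 z at(3) by (intro run_instr[where i="Arith F h h (Suc h)"]) (auto simp: set_free_def code_at_Cons)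
  note r = steps_trans[OF steps_trans[OF g1(1) g2(1)] this]
  have "ecost a + ecost b + 1 = ecost (Bin F a b)"
    "Suc (k + ecost a + ecost b) = k + ecost (Bin F a b)" by simp_all
  note r = r[unfolded this]
  have "(g2(h := ?v)) h = ev (Bin F a b) f" "\<forall>y<h. (g2(h := ?v)) y = g y"
    using g1 g2 by auto
  with r z show ?case by blast
qed

lemma sim_upd: "sim f g \<Longrightarrow> x < K \<Longrightarrow> v \<le> Z \<Longrightarrow> sim (f(x := v)) (g(x := v))"
  using Z_le by (auto simp: sim_def intro!: good_upd)

lemma sim_cong: "sim f g \<Longrightarrow> good g' \<Longrightarrow> \<forall>x<K. g' x = g x \<Longrightarrow> sim f g'"
  by (auto simp: sim_def)

lemma sim_goodD: "sim f g \<Longrightarrow> good g" by (simp add: sim_def)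

lemma cexp_run_sim:
  assumes "code_at A k (cexp K e)" "wf_exp K c e" "esize e \<le> d" "sim f g"
  shows "\<exists>g'. run (ecost e) (conf k g \<tau>) (conf (k + ecost e) g' \<tau>) \<and> sim f g' \<and> g' K = ev e f"
proof -
  obtain g' where "run (ecost e) (conf k g \<tau>) (conf (k + ecost e) g' \<tau>)" "good g'"
    "g' K = ev e f" "\<forall>x<K. g' x = g x"
    using cexp_run[OF assms(1,2), of g f \<tau>] assms unfolding sim_def by auto
  then show ?thesis using sim_cong[OF assms(4)] by auto
qed

lemma compile_run:
  assumes "big Z D cm st t st'" "code_at A k (compile K k cm)" "wf_com K c d cm" "sim (fst st) g"
  shows "\<exists>g'. run t (conf k g (snd st)) (conf (k + csize cm) g' (snd st')) \<and> sim (fst st') g'"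
  using assms
proof (induction arbitrary: k g rule: big.induct)
  case (Assign e f x \<tau>)
  then obtain g1 where g1: "run (ecost e) (conf k g \<tau>) (conf (k + ecost e) g1 \<tau>)" "sim f g1"
    "g1 K = ev e f"
    using cexp_run_sim[of k e f g \<tau>] by (auto simp: code_at_append code_at_Cons)
  have x: "x < K" using Assign by simp
  \<comment> \<open>Clearing \<open>x\<close> loses nothing even if \<open>e\<close> mentions it,
    because the value of \<open>e\<close> already lies in cell \<open>K\<close>.\<close>
  have s2: "sim (f(x := 0)) (g1(x := 0))" using sim_upd[OF g1(2) x] by simp
  have r2: "run 1 (conf (k + ecost e) g1 \<tau>) (conf (Suc (k + ecost e)) (g1(x := 0)) \<tau>)"
    using Assign sim_goodD[OF g1(2)] sim_goodD[OF s2]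
    by (intro run_instr[where i="Const x 0"])
      (auto simp: set_free_def code_at_append code_at_Cons)
  have s3: "sim (f(x := ev e f)) (g1(x := ev e f))" using sim_upd[OF g1(2) x] Assign by simp
  have "run 1 (conf (Suc (k + ecost e)) (g1(x := 0)) \<tau>) (conf (Suc (Suc (k + ecost e))) (g1(x := ev e f)) \<tau>)"
    using Assign sim_goodD[OF s2] sim_goodD[OF s3] g1 x
    by (intro run_instr[where i="Arith Add x x K"])
      (auto simp: set_free_def code_at_append code_at_Cons)
  note r = steps_trans[OF steps_trans[OF g1(1) r2] this]
  have "ecost e + 1 + 1 = ecost e + 2" "Suc (Suc (k + ecost e)) = k + csize (Assign x e)" by simp_all
  from r[unfolded this] s3 show ?case unfolding fst_conv snd_conv by blast
next
  case (Read e f \<tau> x)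
  then obtain g1 where g1: "run (ecost e) (conf k g \<tau>) (conf (k + ecost e) g1 \<tau>)" "sim f g1"
    "g1 K = ev e f"
    using cexp_run_sim[of k e f g \<tau>] by (auto simp: code_at_append code_at_Cons)
  let ?v = "of_bool (\<tau> ! ev e f)"
  have s2: "sim (f(x := ?v)) (g1(x := ?v))" using sim_upd[OF g1(2)] Read Z2 by auto
  have "run 1 (conf (k + ecost e) g1 \<tau>) (conf (Suc (k + ecost e)) (g1(x := ?v)) \<tau>)"
    using Read sim_goodD[OF g1(2)] sim_goodD[OF s2] g1
    by (intro run_instr[where i="CatLoad x K"]) (auto simp: set_free_def code_at_append code_at_Cons)
  note r = steps_trans[OF g1(1) this]
  have "Suc (k + ecost e) = k + csize (Read x e)" by simp
  from r[unfolded this] s2 show ?case unfolding fst_conv snd_conv by blast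
next
  case (Write e f \<tau> e')
  have pos: "1 \<le> esize e" for e by (induction e) auto
  obtain g1 where g1: "run (ecost e) (conf k g \<tau>) (conf (k + ecost e) g1 \<tau>)" "sim f g1"
    "g1 K = ev e f"
    using cexp_run_sim[of k e f g \<tau>] Write by (auto simp: code_at_append code_at_Cons)
  obtain g2 where g2: "run (ecost e') (conf (k + ecost e) g1 \<tau>) (conf (k + ecost e + ecost e') g2 \<tau>)"
    "good g2" "g2 (Suc K) = ev e' f" "\<forall>x<Suc K. g2 x = g1 x"
    using cexp_run[of "k + ecost e" "Suc K" e' g1 f \<tau>] Write g1 pos[of e]
    by (auto simp: code_at_append code_at_Cons sim_def)
  have s: "sim f g2" using sim_cong[OF g1(2) g2(2)] g2 by auto
  have "run 1 (conf (k + ecost e + ecost e') g2 \<tau>)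
    (conf (Suc (k + ecost e + ecost e')) g2 (\<tau>[ev e f := (ev e' f \<noteq> 0)]))"
    using Write g2 g1 by (intro run_instr[where i="CatStore K (Suc K)"]) (auto simp: code_at_append code_at_Cons add.assoc)
  from steps_trans[OF steps_trans[OF g1(1) g2(1)] this] s show ?case by (auto simp: add.assoc)
next
  case (Ask f ys x \<tau>)
  have m: "map g ys = map f ys" using Ask by (auto simp: sim_def)
  have s: "sim (f(x := D (map f ys))) (g(x := D (map f ys)))"
    using Ask by (intro sim_upd) auto
  have "good g" using Ask sim_goodD by simp
  then have "run 1 (conf k g \<tau>) (conf (Suc k) (g(x := D (map f ys))) \<tau>)"
    using Ask sim_goodD[OF s]
    by (intro run_instr[where i="Query x ys"]) (simp_all add: set_free_def code_at_Cons m del: map_eq_conv)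
  moreover have "Suc k = k + csize (Ask x ys)" by simp
  ultimately show ?case using s unfolding fst_conv snd_conv by metis
next
  case (Seq c1 st1 t1 st2 c2 t2 st3)
  obtain g1 where g1: "run t1 (conf k g (snd st1)) (conf (k + csize c1) g1 (snd st2))" "sim (fst st2) g1"
    using Seq.IH(1)[of k g] Seq.prems by (auto simp: code_at_append code_at_Cons)
  obtain g2 where "run t2 (conf (k + csize c1) g1 (snd st2)) (conf (k + csize c1 + csize c2) g2 (snd st3))"
    "sim (fst st3) g2"
    using Seq.IH(2)[of "k + csize c1" g1] Seq.prems g1 by (auto simp: code_at_append code_at_Cons)
  with steps_trans[OF g1(1) this(1)] show ?case by (auto simp: add.assoc)
next
  case (CondT e st c1 t st' c2)
  obtain g1 where g1: "run (ecost e) (conf k g (snd st)) (conf (k + ecost e) g1 (snd st))"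
    "sim (fst st) g1" "g1 K = ev e (fst st)"
    using cexp_run_sim[of k e "fst st" g "snd st"] CondT by (auto simp: code_at_append code_at_Cons)
  have r1: "run 1 (conf (k + ecost e) g1 (snd st)) (conf (k + ecost e + 1) g1 (snd st))"
    using CondT g1 sim_goodD
    by (intro run_instr[where i="JumpZero K (k + ecost e + csize c1 + 3)"])
      (auto simp: code_at_append code_at_Cons)
  obtain g2 where g2: "run t (conf (k + ecost e + 1) g1 (snd st)) (conf (k + ecost e + 1 + csize c1) g2 (snd st'))"
    "sim (fst st') g2"
    using CondT.IH[of "k + ecost e + 1" g1] CondT.prems g1 
    by (auto simp: code_at_append code_at_Cons)
  have z: "good (g2(K := 0))" using sim_goodD[OF g2(2)] d1 by (intro good_upd) auto
  have r3: "run 1 (conf (k + ecost e + 1 + csize c1) g2 (snd st')) (conf (k + ecost e + 2 + csize c1) (g2(K := 0)) (snd st'))"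
    using CondT z g2 sim_goodD
    by (intro run_instr[where i="Const K 0"])
      (auto simp: set_free_def code_at_append code_at_Cons)
  have r4: "run 1 (conf (k + ecost e + 2 + csize c1) (g2(K := 0)) (snd st')) (conf (k + csize (Cond e c1 c2)) (g2(K := 0)) (snd st'))"
    using CondT z
    by (intro run_instr[where i="JumpZero K (k + ecost e + csize c1 + csize c2 + 3)"])
      (auto simp: set_free_def code_at_append code_at_Cons)
  have "sim (fst st') (g2(K := 0))" using sim_cong[OF g2(2) z] by simp
  note r = steps_trans[OF steps_trans[OF steps_trans[OF steps_trans[OF g1(1) r1] g2(1)] r3] r4]
  have "ecost e + 1 + t + 1 + 1 = ecost e + 3 + t" by simp
  from r[unfolded this] \<open>sim (fst st') (g2(K := 0))\<close> show ?case by blast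
next
  case (CondF e st c2 t st' c1)
  obtain g1 where g1: "run (ecost e) (conf k g (snd st)) (conf (k + ecost e) g1 (snd st))"
    "sim (fst st) g1" "g1 K = ev e (fst st)"
    using cexp_run_sim[of k e "fst st" g "snd st"] CondF by (auto simp: code_at_append code_at_Cons)
  have r1: "run 1 (conf (k + ecost e) g1 (snd st)) (conf (k + ecost e + csize c1 + 3) g1 (snd st))"
    using CondF g1 sim_goodD
    by (intro run_instr[where i="JumpZero K (k + ecost e + csize c1 + 3)"])
      (auto simp: code_at_append code_at_Cons)
  obtain g2 where g2: "run t (conf (k + ecost e + csize c1 + 3) g1 (snd st)) (conf (k + ecost e + csize c1 + 3 + csize c2) g2 (snd st'))"
    "sim (fst st') g2"
    using CondF.IH[of "k + ecost e + csize c1 + 3" g1] CondF.prems g1 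
    by (auto simp: code_at_append code_at_Cons numeral_eq_Suc)
  with steps_trans[OF steps_trans[OF g1(1) r1] g2(1)]
  show ?case by (intro exI[of _ g2]) (auto simp: numeral_eq_Suc add_ac)
next
  case (WhileF e st c')
  obtain g1 where g1: "run (ecost e) (conf k g (snd st)) (conf (k + ecost e) g1 (snd st))"
    "sim (fst st) g1" "g1 K = ev e (fst st)"
    using cexp_run_sim[of k e "fst st" g "snd st"] WhileF by (auto simp: code_at_append code_at_Cons)
  have r1: "run 1 (conf (k + ecost e) g1 (snd st)) (conf (k + csize (While e c')) g1 (snd st))"
    using WhileF g1 sim_goodD
    by (intro run_instr[where i="JumpZero K (k + ecost e + csize c' + 3)"])
      (auto simp: code_at_append code_at_Cons)
  from steps_trans[OF g1(1) r1] g1 show ?case by (intro exI[of _ g1]) simp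
next
  case (WhileT e st c' t st' t' st'')
  obtain g1 where g1: "run (ecost e) (conf k g (snd st)) (conf (k + ecost e) g1 (snd st))"
    "sim (fst st) g1" "g1 K = ev e (fst st)"
    using cexp_run_sim[of k e "fst st" g "snd st"] WhileT by (auto simp: code_at_append code_at_Cons)
  have r1: "run 1 (conf (k + ecost e) g1 (snd st)) (conf (k + ecost e + 1) g1 (snd st))"
    using WhileT g1 sim_goodD
    by (intro run_instr[where i="JumpZero K (k + ecost e + csize c' + 3)"])
      (auto simp: code_at_append code_at_Cons)
  obtain g2 where g2: "run t (conf (k + ecost e + 1) g1 (snd st)) (conf (k + ecost e + 1 + csize c') g2 (snd st'))"
    "sim (fst st') g2"
    using WhileT.IH(1)[of "k + ecost e + 1" g1] WhileT.prems g1 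
    by (auto simp: code_at_append code_at_Cons)
  have z: "good (g2(K := 0))" using sim_goodD[OF g2(2)] d1 by (intro good_upd) auto
  have r3: "run 1 (conf (k + ecost e + 1 + csize c') g2 (snd st')) (conf (k + ecost e + 2 + csize c') (g2(K := 0)) (snd st'))"
    using WhileT z g2 sim_goodD
    by (intro run_instr[where i="Const K 0"])
      (auto simp: set_free_def code_at_append code_at_Cons)
  have r4: "run 1 (conf (k + ecost e + 2 + csize c') (g2(K := 0)) (snd st')) (conf k (g2(K := 0)) (snd st'))"
    using WhileT z
    by (intro run_instr[where i="JumpZero K k"])
      (auto simp: set_free_def code_at_append code_at_Cons)
  have "sim (fst st') (g2(K := 0))" using sim_cong[OF g2(2) z] by simp
  then obtain g3 where "run t' (conf k (g2(K := 0)) (snd st')) (conf (k + csize (While e c')) g3 (snd st''))"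
    "sim (fst st'') g3"
    using WhileT.IH(2)[OF WhileT.prems(1,2)] by blast
  with steps_trans[OF steps_trans[OF steps_trans[OF steps_trans[OF steps_trans[OF g1(1) r1] g2(1)] r3] r4] this(1)]
  show ?case by (intro exI[of _ g3]) (auto simp: numeral_eq_Suc)
qed

text \<open>The number \<open>K + d\<close> of cells depends on the program alone, so the bound is
  \<open>O(log Z)\<close> for a fixed program.\<close>

lemma good_fits:
  assumes "good g"
  shows "fits_free_space ((K + d) * floorlog 2 (Z ^ d)) g"
proof -
  have "max 1 (floorlog 2 (g i)) \<le> floorlog 2 (Z ^ d)" for i
  proof -
    have "floorlog 2 1 \<le> floorlog 2 (Z ^ d)" using Z_le Z2 by (intro floorlog_mono) auto
    moreover have "floorlog 2 (1::nat) = 1" by (simp add: floorlog_def)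
    moreover have "floorlog 2 (g i) \<le> floorlog 2 (Z ^ d)"
      using assms by (intro floorlog_mono) (auto simp: good_def)
    ultimately show ?thesis by simp
  qed
  then have "(\<Sum>i<K + d. max 1 (floorlog 2 (g i))) \<le> (\<Sum>i<K + d. floorlog 2 (Z ^ d))"
    by (intro sum_mono) auto
  then show ?thesis using assms unfolding fits_free_space_def good_def
    by (intro exI[of _ "K + d"]) auto
qed

end

lemma steps_mono: "steps A D P k s s' \<Longrightarrow> (\<And>s. P s \<Longrightarrow> P' s) \<Longrightarrow> steps A D P' k s s'"
  by (induction rule: steps.induct) (auto intro: steps.intros)

theorem compile_correct:
  assumes "big Z D cm (free (initial xs \<tau>), \<tau>) t (f', \<tau>)"
    and "wf_com K c d cm" "2 \<le> Z" "c \<le> Z" "1 \<le> d" "length xs \<le> K" "\<forall>x\<in>set xs. x \<le> Z"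
    and "0 < K" "t \<le> T" "t \<le> Q"
  shows "catalytic_computes (compile K 0 cm) D xs \<tau> (f' 0) T ((K + d) * floorlog 2 (Z ^ d)) Q"
proof -
  interpret layout "compile K 0 cm" D Z K c d using assms by unfold_locales auto
  let ?g = "free (initial xs \<tau>)"
  have le: "?g x \<le> Z" for x
    using assms by (auto simp: initial_def)
  have sim: "sim ?g ?g"
    using le Z_le assms by (auto simp: sim_def good_def initial_def intro: order_trans)
  have "code_at (compile K 0 cm) 0 (compile K 0 cm)" by (auto simp: code_at_def)
  from compile_run[OF assms(1) this assms(2)] sim obtain g' where
    g': "run t (conf 0 ?g \<tau>) (conf (csize cm) g' \<tau>)" "sim f' g'" by auto
  have "steps (compile K 0 cm) D (\<lambda>s. fits_free_space ((K + d) * floorlog 2 (Z ^ d)) (free s)) t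
    (initial xs \<tau>) (conf (csize cm) g' \<tau>)"
    using steps_mono[OF g'(1)] good_fits by (simp add: initial_def)
  then show ?thesis
    using g' assms by (intro catalytic_computes_steps) (auto simp: halted_def sim_def)
qed

section \<open>Weakest preconditions\<close>

text \<open>One derivation suffices, since \<open>compile_run\<close> turns it into a run of the
  machine. The postcondition sees the time, so correctness and cost are proved together.\<close>

definition wp :: "nat \<Rightarrow> (nat list \<Rightarrow> nat) \<Rightarrow> com \<Rightarrow> state \<Rightarrow> (nat \<Rightarrow> state \<Rightarrow> bool) \<Rightarrow> bool" where
  "wp Z D c st R \<longleftrightarrow> (\<exists>t st'. big Z D c st t st' \<and> R t st')"

lemma wp_mono: "wp Z D c st R \<Longrightarrow> (\<And>t st'. R t st' \<Longrightarrow> R' t st') \<Longrightarrow> wp Z D c st R'"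
  unfolding wp_def by blast

lemma wp_SeqI:
  "wp Z D c1 st P \<Longrightarrow> (\<And>t1 st1. P t1 st1 \<Longrightarrow> wp Z D c2 st1 (\<lambda>t2. R (t1 + t2))) \<Longrightarrow> wp Z D (Seq c1 c2) st R"
  unfolding wp_def by (blast intro: big.Seq)

text \<open>All loops here have a number \<open>N\<close> of rounds that is known in advance. An
  invariant indexed by the round then replaces a variant; the induction is over the rounds that
  remain.\<close>

lemma wp_While:
  assumes "I 0 st"
    and body: "\<And>i st. i < N \<Longrightarrow> I i st \<Longrightarrow>
      ev e (fst st) \<noteq> 0 \<and> wp Z D c st (\<lambda>t st'. t \<le> T \<and> I (Suc i) st')"
    and stop: "\<And>st. I N st \<Longrightarrow> ev e (fst st) = 0"
    and post: "\<And>t st. t \<le> N * (T + ecost e + 3) + ecost e + 1 \<Longrightarrow> I N st \<Longrightarrow> R t st"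
  shows "wp Z D (While e c) st R"
proof -
  have "i \<le> N \<Longrightarrow> I (N - i) st \<Longrightarrow>
    \<exists>t st'. big Z D (While e c) st t st' \<and> t \<le> i * (T + ecost e + 3) + ecost e + 1 \<and> I N st'" for i st
  proof (induction i arbitrary: st)
    case 0
    then have "I N st" by simp
    with big.WhileF[OF stop[OF this]] show ?case by (metis add_0 mult_0 order_refl)
  next
    case (Suc i)
    then have "N - Suc i < N" "Suc (N - Suc i) = N - i" by auto
    with body[of "N - Suc i" st] Suc.prems obtain t st1 where
      1: "ev e (fst st) \<noteq> 0" "big Z D c st t st1" "t \<le> T" "I (N - i) st1"
      unfolding wp_def by auto
    obtain t' st2 where 2: "big Z D (While e c) st1 t' st2"
      "t' \<le> i * (T + ecost e + 3) + ecost e + 1" "I N st2"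
      using Suc.IH[of st1] Suc.prems 1 by auto
    have "ecost e + 3 + t + t' \<le> Suc i * (T + ecost e + 3) + ecost e + 1" using 1 2 by simp
    with big.WhileT[OF 1(1,2) 2(1)] 2 show ?case by blast
  qed
  from this[of N st] assms(1) post show ?thesis unfolding wp_def by (metis diff_self_eq_0 order_refl)
qed

inductive_simps big_Assign: "big Z D (Assign x e) (f, \<tau>) t st"
inductive_simps big_Read: "big Z D (Read x e) (f, \<tau>) t st"
inductive_simps big_Write: "big Z D (Write e e') (f, \<tau>) t st"
inductive_simps big_Ask: "big Z D (Ask x ys) (f, \<tau>) t st"
inductive_simps big_Seq: "big Z D (Seq c1 c2) (f, \<tau>) t st"
inductive_simps big_Cond: "big Z D (Cond e c1 c2) (f, \<tau>) t st"

lemma wp_simps: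
  "wp Z D (Assign x e) (f, \<tau>) R \<longleftrightarrow> ev e f \<le> Z \<and> R (ecost e + 2) (f(x := ev e f), \<tau>)"
  "wp Z D (Read x e) (f, \<tau>) R \<longleftrightarrow>
     ev e f < length \<tau> \<and> R (ecost e + 1) (f(x := of_bool (\<tau> ! ev e f)), \<tau>)"
  "wp Z D (Write e e') (f, \<tau>) R \<longleftrightarrow>
     ev e f < length \<tau> \<and> R (ecost e + ecost e' + 1) (f, \<tau>[ev e f := (ev e' f \<noteq> 0)])"
  "wp Z D (Ask x ys) (f, \<tau>) R \<longleftrightarrow> D (map f ys) \<le> Z \<and> R 1 (f(x := D (map f ys)), \<tau>)"
  "wp Z D (Seq c1 c2) (f, \<tau>) R \<longleftrightarrow> wp Z D c1 (f, \<tau>) (\<lambda>t1 st1. wp Z D c2 st1 (\<lambda>t2. R (t1 + t2)))"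
  "wp Z D (Cond e c1 c2) (f, \<tau>) R \<longleftrightarrow> 
     (if ev e f \<noteq> 0 then wp Z D c1 (f, \<tau>) (\<lambda>t. R (ecost e + 3 + t))
      else wp Z D c2 (f, \<tau>) (\<lambda>t. R (ecost e + 1 + t)))"
  unfolding wp_def big_Assign big_Read big_Write big_Ask big_Seq big_Cond by (auto; blast)+

section \<open>Transparent matrix products\<close>

text \<open>\<open>G X c\<close> is the content of cell \<open>c\<close> of the vector register \<open>X\<close>.\<close>

type_synonym regs = "nat \<Rightarrow> nat \<Rightarrow> int"

text \<open>The first index of \<open>A\<close> is the source and the second the target, so products
  of such matrices read in the order of the walk.\<close>

definition add_image :: "nat \<Rightarrow> nat \<Rightarrow> nat \<Rightarrow> (nat \<Rightarrow> nat \<Rightarrow> int) \<Rightarrow> int \<Rightarrow> regs \<Rightarrow> regs" where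
  "add_image W X Y A s G = G(Y := (\<lambda>c. G Y c + s * (\<Sum>z<W. A z c * G X z)))"

lemma add_image_sum:
  assumes "X \<noteq> Y"
  shows "fold (\<lambda>m. add_image W X Y (A m) s) [0..<B] G = add_image W X Y (\<lambda>z c. \<Sum>m<B. A m z c) s G"
proof (induction B)
  case (Suc B)
  have "add_image W X Y (A B) s (add_image W X Y (\<lambda>z c. \<Sum>m<B. A m z c) s G)
      = add_image W X Y (\<lambda>z c. \<Sum>m<Suc B. A m z c) s G"
    using assms by (auto simp: add_image_def fun_eq_iff algebra_simps sum.distrib sum_distrib_left)
  with Suc show ?case by simp
qed (simp add: add_image_def)

text \<open>The unknown content of \<open>Z\<close> reaches \<open>Y\<close> twice, with opposite
  signs. The sign \<open>s\<close> is attached to the updates of \<open>Y\<close> only; those of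
  \<open>Z\<close> are always \<open>1\<close> and \<open>- 1\<close>.\<close>

lemma add_image_product:
  assumes "X \<noteq> Y" "X \<noteq> Z" "Y \<noteq> Z"
  shows "add_image W Z Y A2 (- s) (add_image W X Z A1 (- 1) (add_image W Z Y A2 s (add_image W X Z A1 1 G)))
    = add_image W X Y (\<lambda>c c'. \<Sum>z<W. A1 c z * A2 z c') s G"
proof -
  have "(\<Sum>z<W. A2 z c * (\<Sum>y<W. A1 y z * G X y)) = (\<Sum>y<W. (\<Sum>z<W. A1 y z * A2 z c) * G X y)" for c
  proof -
    have "(\<Sum>z<W. A2 z c * (\<Sum>y<W. A1 y z * G X y)) = (\<Sum>z<W. \<Sum>y<W. A1 y z * A2 z c * G X y)"
      by (simp add: sum_distrib_left mult_ac)
    also have "\<dots> = (\<Sum>y<W. \<Sum>z<W. A1 y z * A2 z c * G X y)" by (rule sum.swap)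
    finally show ?thesis by (simp add: sum_distrib_right)
  qed
  then show ?thesis
    using assms by (auto simp: add_image_def fun_eq_iff algebra_simps sum.distrib sum_negf)
qed

lemma add_image_inverse:
  assumes "X \<noteq> Y"
  shows "add_image W X Y A (- s) (add_image W X Y A s G) = G"
  using assms by (auto simp: add_image_def fun_eq_iff)

text \<open>Loop indices are written as \<open>m * c + i\<close>. This groups the four calls of a
  block, and later the leaves of a subtree.\<close>

lemma fold_upt_mult:
  "fold f [0..<k * c] G = fold (\<lambda>m. fold (\<lambda>i. f (m * c + i)) [0..<c]) [0..<k] G"
proof (induction k)
  case (Suc k)
  have "[0..<Suc k * c] = [0..<k * c] @ map (\<lambda>i. k * c + i) [0..<c]"
    using upt_add_eq_append[of 0 "k * c" c] map_add_upt[of "k * c" c] by (simp add: add.commute)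
  with Suc show ?case by (simp add: fold_map comp_def)
qed simp

section \<open>The recursion over blocks of the grid\<close>

text \<open>Indices within a layer are shifted by the block width \<open>w\<close>: the vertex \<open>(s, j)\<close> has position
  \<open>J = j + w\<close>, and position \<open>J\<close> occupies cell \<open>J mod (3 * w)\<close> of a register. Block \<open>a\<close> consists of the
  positions with \<open>J div w = a + 1\<close> and lies in the middle of the window
  \<open>{a * w..<a * w + 3 * w}\<close>. A node \<open>(s, a, e, fs, fe)\<close> of the recursion covers walks that start in
  layer \<open>s\<close>; they start in block \<open>a\<close> if \<open>fs\<close>, end in block \<open>e\<close> if \<open>fe\<close> and otherwise stay in the
  window of block \<open>a\<close>. Walks longer than \<open>w\<close> are split according to the block of their midpoint; for
  shorter ones the window contains all possible midpoints.\<close>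

type_synonym node = "nat \<times> nat \<times> nat \<times> bool \<times> bool"
type_synonym call = "node \<times> nat \<times> nat \<times> nat \<times> nat"

locale blocks =
  fixes n w :: nat and \<mu> :: "(nat \<times> nat) \<times> (nat \<times> nat) \<Rightarrow> nat"
  assumes w0: "0 < w"
begin

definition B :: nat where "B = n div w + 1"

definition inner :: "nat \<Rightarrow> bool" where "inner J \<longleftrightarrow> w \<le> J \<and> J \<le> n + w"

definition arcw :: "nat \<Rightarrow> nat \<Rightarrow> nat \<Rightarrow> int" where
  "arcw s J K = (if inner J \<and> inner K \<and> J \<le> K + 1 \<and> K \<le> J + 1
     then int (\<mu> ((s, J - w), (s + 1, K - w))) else 0)"

definition window :: "nat \<Rightarrow> nat set" where "window a = {a * w..<a * w + 3 * w}"

definition Bs :: "nat \<Rightarrow> nat" where "Bs h = (if w < 2 ^ h then B else 1)"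

text \<open>The midpoint of a short walk is not confined to a block: each half keeps the block
  condition at its outer end only, and both halves keep the window of \<open>a\<close>. The midpoint
  of a long walk lies in block \<open>m\<close>, which becomes the end block of one half and the
  start block of the other.\<close>

fun left :: "nat \<Rightarrow> node \<Rightarrow> nat \<Rightarrow> node" where
  "left h (s, a, e, fs, fe) m = (if w < 2 ^ h then (s, a, m, fs, fe) else (s, a, e, fs, False))"

fun right :: "nat \<Rightarrow> node \<Rightarrow> nat \<Rightarrow> node" where
  "right h (s, a, e, fs, fe) m =
     (if w < 2 ^ h then (s + 2 ^ (h - 1), m, e, fs, fe) else (s + 2 ^ (h - 1), a, e, False, fe))"

text \<open>The digit encodes the block (\<open>d div 4\<close>), the half (parity) and the sign
  (\<open>d mod 4 div 2\<close>), in the order of the updates in \<open>add_image_product\<close>.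
  The register that a child neither reads nor adds to becomes its scratch register, so three
  registers suffice at every depth.\<close>

fun child :: "nat \<Rightarrow> call \<Rightarrow> nat \<Rightarrow> call" where
  "child h (g, X, Y, Z, sg) d =
     (if even d then (left h g (d div 4), X, Z, Y, d mod 4 div 2)
      else (right h g (d div 4), Z, Y, X, (sg + d mod 4 div 2) mod 2))"

text \<open>The \<open>9 * w\<close> numbers enumerate the \<open>3 * w\<close> positions of a
  window with three steps each. The \<open>- 1\<close> in \<open>tgt\<close> truncates only at
  source position 0, which is not \<open>inner\<close>.\<close>

definition src :: "node \<Rightarrow> nat \<Rightarrow> nat" where
  "src g i = fst (snd g) * w + i div 3"

definition tgt :: "node \<Rightarrow> nat \<Rightarrow> nat" where
  "tgt g i = src g i + i mod 3 - 1"

fun guard :: "node \<Rightarrow> nat \<Rightarrow> bool" where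
  "guard (s, a, e, fs, fe) i \<longleftrightarrow> (let J = src (s, a, e, fs, fe) i; K = tgt (s, a, e, fs, fe) i in
     inner J \<and> inner K \<and> K \<in> window a \<and> (fs \<longrightarrow> J div w = a + 1) \<and> (fe \<longrightarrow> K div w = e + 1))"

definition elem :: "node \<Rightarrow> nat \<Rightarrow> nat \<Rightarrow> nat \<Rightarrow> int" where
  "elem g i c c' = (if guard g i \<and> src g i mod (3 * w) = c \<and> tgt g i mod (3 * w) = c'
     then int (\<mu> ((fst g, src g i - w), (fst g + 1, tgt g i - w))) else 0)"

fun leaf :: "call \<Rightarrow> nat \<Rightarrow> regs \<Rightarrow> regs" where
  "leaf (g, X, Y, Z, sg) i = add_image (3 * w) X Y (elem g i) ((- 1) ^ sg)"

fun tree :: "nat \<Rightarrow> call \<Rightarrow> regs \<Rightarrow> regs" where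
  "tree 0 q = fold (leaf q) [0..<9 * w]"
| "tree (Suc h) q = fold (\<lambda>d. tree h (child (Suc h) q d)) [0..<Bs (Suc h) * 4]"

fun mat :: "nat \<Rightarrow> node \<Rightarrow> nat \<Rightarrow> nat \<Rightarrow> int" where
  "mat 0 g c c' = (\<Sum>i<9 * w. elem g i c c')"
| "mat (Suc h) g c c' = (\<Sum>m<Bs (Suc h). \<Sum>z<3 * w.
     mat h (left (Suc h) g m) c z * mat h (right (Suc h) g m) z c')"

text \<open>By induction, the four calls for a block \<open>m\<close> are the four updates of
  \<open>add_image_product\<close>. They restore the scratch register, so the blocks simply add up
  by \<open>add_image_sum\<close>.\<close>

lemma tree_eq:
  assumes "X \<noteq> Y" "X \<noteq> Z" "Y \<noteq> Z"
  shows "tree h (g, X, Y, Z, sg) G = add_image (3 * w) X Y (mat h g) ((- 1) ^ sg) G"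
  using assms
proof (induction h arbitrary: g X Y Z sg G)
  case 0
  have "mat 0 g = (\<lambda>z c. \<Sum>m<9 * w. elem g m z c)" by (auto simp: fun_eq_iff)
  moreover have "leaf (g, X, Y, Z, sg) = (\<lambda>i. add_image (3 * w) X Y (elem g i) ((- 1) ^ sg))"
    by (simp add: fun_eq_iff)
  ultimately show ?case using add_image_sum[OF \<open>X \<noteq> Y\<close>] by (simp only: tree.simps)
next
  case (Suc h)
  have four: "[0..<4] = [0, 1, 2, 3::nat]" by (simp add: upt_rec)
  have "fold (\<lambda>i. tree h (child (Suc h) (g, X, Y, Z, sg) (m * 4 + i))) [0..<4] G =
    add_image (3 * w) X Y
      (\<lambda>c c'. \<Sum>z<3 * w. mat h (left (Suc h) g m) c z * mat h (right (Suc h) g m) z c')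
      ((- 1) ^ sg) G" (is "?l m G = ?r m G") for m G
  proof -
    have d: "Suc (m * 4) div 4 = m" "(m * 4 + 3) div 4 = m" "(m * 4 + 2) div 4 = m"
       "Suc (m * 4) mod 4 = 1" "(m * 4 + 3) mod 4 = 3" "(m * 4 + 2) mod 4 = 2"
       "Suc (Suc (m * 4)) div 4 = m" "Suc (Suc (m * 4)) mod 4 = 2" by presburger+
    have "(- 1 :: int) ^ (Suc sg mod 2) = - ((- 1) ^ sg)" "(- 1 :: int) ^ (sg mod 2) = (- 1) ^ sg"
      by (auto simp: minus_one_power_iff)
    then have "fold (\<lambda>i. tree h (child (Suc h) (g, X, Y, Z, sg) (m * 4 + i))) [0..<4] G =
      add_image (3 * w) Z Y (mat h (right (Suc h) g m)) (- ((- 1) ^ sg))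
        (add_image (3 * w) X Z (mat h (left (Suc h) g m)) (- 1)
          (add_image (3 * w) Z Y (mat h (right (Suc h) g m)) ((- 1) ^ sg)
            (add_image (3 * w) X Z (mat h (left (Suc h) g m)) 1 G)))"
      using Suc.prems by (simp add: four Suc.IH d)
    then show ?thesis using Suc.prems by (simp add: add_image_product)
  qed
  then have "?l = ?r" by (simp only: fun_eq_iff) simp
  moreover have "tree (Suc h) (g, X, Y, Z, sg) G = fold ?l [0..<Bs (Suc h)] G"
    by (simp only: tree.simps fold_upt_mult)
  ultimately have "tree (Suc h) (g, X, Y, Z, sg) G =
    fold (\<lambda>m. add_image (3 * w) X Y
      (\<lambda>c c'. \<Sum>z<3 * w. mat h (left (Suc h) g m) c z * mat h (right (Suc h) g m) z c')
      ((- 1) ^ sg)) [0..<Bs (Suc h)] G"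
    by (simp only:)
  also have "\<dots> = add_image (3 * w) X Y (mat (Suc h) g) ((- 1) ^ sg) G"
    by (subst add_image_sum[OF \<open>X \<noteq> Y\<close>]) (simp add: fun_eq_iff add_image_def)
  finally show ?case .
qed

section \<open>The recursion as a single loop over its leaves\<close>

fun cnt :: "nat \<Rightarrow> nat" where
  "cnt 0 = 9 * w"
| "cnt (Suc h) = Bs (Suc h) * 4 * cnt h"

lemma cnt_pos: "0 < cnt h"
  using w0 by (induction h) (auto simp: Bs_def B_def)

text \<open>A mixed radix expansion of the leaf number, most significant digit first. Only the
  current call and a remainder have to be remembered, so no recursion stack is needed.\<close>

fun decode :: "nat \<Rightarrow> call \<Rightarrow> nat \<Rightarrow> call \<times> nat" where
  "decode 0 q t = (q, t)"
| "decode (Suc h) q t = decode h (child (Suc h) q (t div cnt h)) (t mod cnt h)"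

lemma tree_flat: "tree h q G = fold (\<lambda>t. case_prod leaf (decode h q t)) [0..<cnt h] G"
proof (induction h arbitrary: q G)
  case (Suc h)
  have d: "(m * cnt h + i) div cnt h = m" "(m * cnt h + i) mod cnt h = i" if "i < cnt h" for m i
    using that by auto
  have "fold (\<lambda>t. case_prod leaf (decode (Suc h) q t)) [0..<cnt (Suc h)] G =
    fold (\<lambda>m. fold (\<lambda>i. case_prod leaf (decode (Suc h) q (m * cnt h + i))) [0..<cnt h])
      [0..<Bs (Suc h) * 4] G"
    by (simp add: fold_upt_mult)
  also have "\<dots> = fold (\<lambda>m. tree h (child (Suc h) q m)) [0..<Bs (Suc h) * 4] G"
  proof (rule fold_cong[OF refl refl], rule ext)
    fix m G
    show "fold (\<lambda>i. case_prod leaf (decode (Suc h) q (m * cnt h + i))) [0..<cnt h] G =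
      tree h (child (Suc h) q m) G"
      unfolding Suc.IH by (intro fold_cong refl) (use d in auto)
  qed
  finally show ?case by simp
qed simp

section \<open>Weights of walks between layers, and the block matrices\<close>

fun wm :: "nat set \<Rightarrow> nat \<Rightarrow> nat \<Rightarrow> nat \<Rightarrow> nat \<Rightarrow> int" where
  "wm S s 0 J K = of_bool (J = K)"
| "wm S s (Suc l) J K = (\<Sum>H\<in>S. arcw s J H * wm S (Suc s) l H K)"

text \<open>Walks are split at layer \<open>s + l\<close>. The set \<open>S\<close> restricts all
  positions but the first, and for \<open>l = 0\<close> the first is the splitting position; hence
  \<open>J \<in> S\<close>.\<close>

lemma wm_add:
  assumes "finite S" "J \<in> S"
  shows "wm S s (l + l') J K = (\<Sum>H\<in>S. wm S s l J H * wm S (s + l) l' H K)"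
  using assms(2)
proof (induction l arbitrary: s J)
  case 0
  have "(\<Sum>H\<in>S. of_bool (J = H) * wm S s l' H K) = (\<Sum>H\<in>S. if H = J then wm S s l' H K else 0)"
    by (intro sum.cong) auto
  then show ?case using assms 0 by simp
next
  case (Suc l)
  have "wm S s (Suc l + l') J K = (\<Sum>H\<in>S. arcw s J H * (\<Sum>M\<in>S. wm S (Suc s) l H M * wm S (Suc s + l) l' M K))"
    by (simp add: Suc.IH)
  also have "\<dots> = (\<Sum>M\<in>S. (\<Sum>H\<in>S. arcw s J H * wm S (Suc s) l H M) * wm S (s + Suc l) l' M K)"
    unfolding sum_distrib_left sum_distrib_right by (subst sum.swap) (simp add: mult.assoc)
  finally show ?case by simp
qed

lemma wm_1: "finite S \<Longrightarrow> K \<in> S \<Longrightarrow> wm S s 1 J K = arcw s J K"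
proof -
  assume *: "finite S" "K \<in> S"
  have "(\<Sum>H\<in>S. arcw s J H * of_bool (H = K)) = (\<Sum>H\<in>S. if H = K then arcw s J H else 0)"
    by (intro sum.cong) auto
  with * show ?thesis by simp
qed

lemma mod_3w_div: "J mod (3 * w) div w = J div w mod 3"
  using w0 mod_mult2_eq[of J w 3] by (simp add: mult.commute)

lemma mod_window_inj:
  assumes "J \<in> window a" "K \<in> window a" "J mod (3 * w) = K mod (3 * w)"
  shows "J = K"
proof -
  obtain x y where "J = a * w + x" "K = a * w + y" "x < 3 * w" "y < 3 * w"
    using assms(1,2) by (auto simp: window_def le_iff_add)
  moreover have "x = y" if "x \<le> y" "y < 3 * w" "(a * w + x) mod (3 * w) = (a * w + y) mod (3 * w)" for x y
  proof -
    have "3 * w dvd y - x" using that mod_eq_dvd_iff_nat[of "a * w + x" "a * w + y" "3 * w"] by simp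
    then show ?thesis using that by (auto dest: dvd_imp_le)
  qed
  ultimately show ?thesis using assms(3) by (metis nat_le_linear)
qed

text \<open>An interval of length \<open>3 * w\<close> meets every residue once, so a vector
  register holds exactly one window, whichever block it belongs to.\<close>

lemma bij_window: "bij_betw (\<lambda>J. J mod (3 * w)) (window a) {..<3 * w}"
proof -
  have inj: "inj_on (\<lambda>J. J mod (3 * w)) (window a)"
    using mod_window_inj by (auto intro: inj_onI)
  have "(\<lambda>J. J mod (3 * w)) ` window a = {..<3 * w}"
  proof (rule card_subset_eq)
    show "(\<lambda>J. J mod (3 * w)) ` window a \<subseteq> {..<3 * w}" using w0 by auto
    show "card ((\<lambda>J. J mod (3 * w)) ` window a) = card {..<3 * w}"
      by (simp add: card_image[OF inj]) (simp add: window_def)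
  qed simp
  with inj show ?thesis by (simp add: bij_betw_def)
qed

lemma finite_window [simp]: "finite (window a)" by (simp add: window_def)

text \<open>By \<open>bij_window\<close> a sum over cells is a sum over positions of the window, and
  the halving recursion becomes \<open>wm_add\<close> with \<open>S = window a\<close>.\<close>

lemma mat_short:
  assumes "2 ^ h \<le> w" "J \<in> window a" "K \<in> window a"
  shows "mat h (s, a, e, fs, fe) (J mod (3 * w)) (K mod (3 * w)) =
    (if (fs \<longrightarrow> J div w = a + 1) \<and> (fe \<longrightarrow> K div w = e + 1) then wm (window a) s (2 ^ h) J K else 0)"
  using assms
proof (induction h arbitrary: s J K fs fe)
  case 0
  let ?g = "(s, a, e, fs, fe)"
  let ?c = "(fs \<longrightarrow> J div w = a + 1) \<and> (fe \<longrightarrow> K div w = e + 1)"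
  \<comment> \<open>The only leaf number that can describe the arc: three per source position, and
    the direction \<open>K + 1 - J\<close> is 0, 1 or 2.\<close>
  define i0 where "i0 = 3 * (J - a * w) + (K + 1 - J)"
  let ?v = "if ?c then arcw s J K else 0"
  have "elem ?g i (J mod (3 * w)) (K mod (3 * w)) = (if i = i0 then ?v else 0)" if i: "i < 9 * w" for i
  proof -
    have sw: "src ?g i \<in> window a" using i by (auto simp: src_def window_def)
    have s1: "src ?g i mod (3 * w) = J mod (3 * w) \<longleftrightarrow> src ?g i = J"
      using mod_window_inj[OF sw 0(2)] by auto
    have s2: "tgt ?g i mod (3 * w) = K mod (3 * w) \<longleftrightarrow> tgt ?g i = K" if "tgt ?g i \<in> window a"
      using mod_window_inj[OF that 0(3)] by auto
    have a: "a * w \<le> J" "a * w \<le> K" using 0 by (auto simp: window_def)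
    have key: "src ?g i = J \<and> tgt ?g i = K \<longleftrightarrow> i = i0 \<and> J \<le> K + 1 \<and> K \<le> J + 1" if "inner J"
    proof -
      have "1 \<le> J" using that w0 by (simp add: inner_def)
      then have "src ?g i = J \<and> tgt ?g i = K \<longleftrightarrow> i div 3 = J - a * w \<and> J + i mod 3 = K + 1"
        using a by (auto simp: src_def tgt_def) arith
      also have "\<dots> \<longleftrightarrow> i = i0 \<and> J \<le> K + 1 \<and> K \<le> J + 1"
      proof
        assume *: "i div 3 = J - a * w \<and> J + i mod 3 = K + 1"
        then have "K + 1 - J = i mod 3" by (metis add_diff_cancel_left')
        then have "i = i0"
          using * div_mult_mod_eq[of i 3] unfolding i0_def by (simp add: mult.commute)
        moreover have "i mod 3 < 3" by simp
        ultimately show "i = i0 \<and> J \<le> K + 1 \<and> K \<le> J + 1" using * by linarith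
      next
        assume *: "i = i0 \<and> J \<le> K + 1 \<and> K \<le> J + 1"
        then have "K + 1 - J < 3" by linarith
        then have "i0 div 3 = J - a * w" "i0 mod 3 = K + 1 - J" unfolding i0_def by auto
        with * show "i div 3 = J - a * w \<and> J + i mod 3 = K + 1" by simp
      qed
      finally show ?thesis .
    qed
    show ?thesis
    proof (cases "inner J \<and> src ?g i = J \<and> tgt ?g i = K")
      case True
      then have "i = i0" "J \<le> K + 1" "K \<le> J + 1" using key by auto
      with True 0(3) show ?thesis by (simp add: elem_def arcw_def Let_def)
    next
      case False
      then have "elem ?g i (J mod (3 * w)) (K mod (3 * w)) = 0"
        using s1 s2 by (auto simp: elem_def Let_def)
      moreover have "arcw s J K = 0" if "i = i0"
        using False key that by (auto simp: arcw_def)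
      ultimately show ?thesis by auto
    qed
  qed
  then have "mat 0 ?g (J mod (3 * w)) (K mod (3 * w)) = (\<Sum>i<9 * w. if i = i0 then ?v else 0)"
    by simp
  also have "\<dots> = ?v"
  proof (cases "?v = 0")
    case False
    then have "K \<le> J + 1" "arcw s J K \<noteq> 0" by (auto simp: arcw_def split: if_splits)
    then have "i0 < 9 * w"
      using 0(2) by (auto simp: i0_def window_def)
    then show ?thesis by simp
  qed (auto intro: sum.neutral)
  finally show ?case using 0(3) wm_1[of "window a" K s J] by simp
next
  case (Suc h)
  then have h: "2 ^ h \<le> w" and h': "\<not> w < 2 * 2 ^ h" by auto
  let ?W = "3 * w"
  have "mat (Suc h) (s, a, e, fs, fe) (J mod ?W) (K mod ?W) =
    (\<Sum>z<?W. mat h (s, a, e, fs, False) (J mod ?W) z * mat h (s + 2 ^ h, a, e, False, fe) z (K mod ?W))"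
    using h' by (simp add: Bs_def)
  also have "\<dots> = (\<Sum>H\<in>window a. mat h (s, a, e, fs, False) (J mod ?W) (H mod ?W) *
      mat h (s + 2 ^ h, a, e, False, fe) (H mod ?W) (K mod ?W))"
    by (rule sum.reindex_bij_betw[OF bij_window, symmetric])
  also have "\<dots> = (\<Sum>H\<in>window a. if (fs \<longrightarrow> J div w = a + 1) \<and> (fe \<longrightarrow> K div w = e + 1)
      then wm (window a) s (2 ^ h) J H * wm (window a) (s + 2 ^ h) (2 ^ h) H K else 0)"
    using Suc.prems by (intro sum.cong) (auto simp: Suc.IH[OF h])
  also have "\<dots> = (if (fs \<longrightarrow> J div w = a + 1) \<and> (fe \<longrightarrow> K div w = e + 1)
      then wm (window a) s (2 ^ h + 2 ^ h) J K else 0)"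
    using Suc.prems by (subst wm_add) auto
  finally show ?case by (simp add: mult_2)
qed

text \<open>The inner positions, rounded up to whole blocks so that sums split evenly. The surplus
  positions carry no arcs.\<close>

definition full :: "nat set" where "full = {w..<w + B * w}"

lemma finite_full [simp]: "finite full" by (simp add: full_def)

lemma inner_full: "inner J \<Longrightarrow> J \<in> full"
proof -
  assume "inner J"
  moreover have "n < B * w" using w0 by (simp add: B_def) (metis dividend_less_div_times add.commute)
  ultimately show ?thesis by (auto simp: full_def inner_def)
qed

text \<open>A walk moves by at most one position per layer, so it cannot leave the window within
  \<open>l\<close> steps.\<close>

lemma wm_local:
  assumes "a * w + l \<le> J" "J + l < a * w + 3 * w"
  shows "wm (window a) s l J K = wm full s l J K"
  using assms
proof (induction l arbitrary: s J)
  case (Suc l)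
  have "(\<Sum>H\<in>window a. arcw s J H * wm (window a) (Suc s) l H K)
      = (\<Sum>H\<in>full \<inter> window a. arcw s J H * wm full (Suc s) l H K)"
  proof (intro sum.mono_neutral_cong_right ballI)
    fix H assume "H \<in> window a - full \<inter> window a"
    then show "arcw s J H * wm (window a) (Suc s) l H K = 0"
      using inner_full by (auto simp: arcw_def)
  next
    fix H assume "H \<in> full \<inter> window a"
    show "arcw s J H * wm (window a) (Suc s) l H K = arcw s J H * wm full (Suc s) l H K"
    proof (cases "arcw s J H = 0")
      case False
      then have "J \<le> H + 1" "H \<le> J + 1" by (auto simp: arcw_def split: if_splits)
      with Suc show ?thesis by simp
    qed simp
  qed auto
  also have "\<dots> = (\<Sum>H\<in>full. arcw s J H * wm full (Suc s) l H K)"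
  proof (intro sum.mono_neutral_left ballI)
    fix H assume "H \<in> full - full \<inter> window a"
    with Suc.prems show "arcw s J H * wm full (Suc s) l H K = 0"
      by (auto simp: arcw_def window_def)
  qed auto
  finally show ?case by simp
qed simp

lemma wm_far: "wm S s l J K \<noteq> 0 \<Longrightarrow> K \<le> J + l \<and> J \<le> K + l"
proof (induction l arbitrary: s J)
  case (Suc l)
  then obtain H where "H \<in> S" "arcw s J H * wm S (Suc s) l H K \<noteq> 0"
    by (auto elim: sum.not_neutral_contains_not_neutral)
  with Suc.IH[of "Suc s" H] show ?case by (auto simp: arcw_def split: if_splits)
qed (auto split: if_splits)

text \<open>The start flag survives in every left child down to the leaves. It confines the nonzero
  entries to the third of the register in which block \<open>a\<close> lies, so a sum over all cells
  at a midpoint picks up no other block.\<close>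

lemma mat_source:
  "mat h (s, a, e, True, fe) c c' \<noteq> 0 \<Longrightarrow> c div w = (a + 1) mod 3"
proof (induction h arbitrary: s e fe c')
  case 0
  then obtain i where "elem (s, a, e, True, fe) i c c' \<noteq> 0"
    by (auto elim: sum.not_neutral_contains_not_neutral)
  then show ?case by (auto simp: elem_def Let_def mod_3w_div split: if_splits)
next
  case (Suc h)
  from Suc.prems[unfolded mat.simps] obtain m where "(\<Sum>z<3 * w.
      mat h (left (Suc h) (s, a, e, True, fe) m) c z *
      mat h (right (Suc h) (s, a, e, True, fe) m) z c') \<noteq> 0"
    using sum.not_neutral_contains_not_neutral by blast
  then obtain z where "mat h (left (Suc h) (s, a, e, True, fe) m) c z *
      mat h (right (Suc h) (s, a, e, True, fe) m) z c' \<noteq> 0"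
    using sum.not_neutral_contains_not_neutral by blast
  then show ?case using Suc.IH by (auto split: if_splits)
qed

lemma block_eqI:
  assumes "J div w = b" "K div w = b" "J mod (3 * w) = K mod (3 * w)"
  shows "J = K"
proof -
  have "J \<in> window b" "K \<in> window b"
    using assms div_mult_mod_eq[of J w] div_mult_mod_eq[of K w] mod_less_divisor[OF w0, of J]
      mod_less_divisor[OF w0, of K] by (auto simp: window_def simp del: mod_less_divisor)
  with assms show ?thesis using mod_window_inj by blast
qed

lemma bij_block:
  "bij_betw (\<lambda>J. J mod (3 * w)) {b * w..<b * w + w} {z. z < 3 * w \<and> z div w = b mod 3}"
proof (rule bij_betwI')
  have dv: "J div w = b" if "J \<in> {b * w..<b * w + w}" for J
    using that w0 by (intro div_nat_eqI) (auto simp: algebra_simps)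
  fix J K assume J: "J \<in> {b * w..<b * w + w}"
  show "J mod (3 * w) \<in> {z. z < 3 * w \<and> z div w = b mod 3}"
    using dv[OF J] w0 by (simp add: mod_3w_div)
  assume K: "K \<in> {b * w..<b * w + w}"
  show "(J mod (3 * w) = K mod (3 * w)) = (J = K)"
    using block_eqI[OF dv[OF J] dv[OF K]] by auto
next
  fix z assume z: "z \<in> {z. z < 3 * w \<and> z div w = b mod 3}"
  let ?J = "b * w + z mod w"
  have "?J mod (3 * w) = (b mod 3) * w + z mod w"
  proof -
    have "?J mod (3 * w) = w * (?J div w mod 3) + ?J mod w"
      by (metis mod_mult2_eq mult.commute)
    then show ?thesis using w0 by (simp add: mult.commute)
  qed
  also have "\<dots> = z" using z by (auto simp: mult.commute)  (metis div_mult_mod_eq mult.commute)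
  finally show "\<exists>J\<in>{b * w..<b * w + w}. z = J mod (3 * w)"
    using w0 by (intro bexI[of _ ?J]) auto
qed

lemma sum_full: "(\<Sum>H\<in>full. f H) = (\<Sum>m<B. \<Sum>H\<in>{(m + 1) * w..<(m + 1) * w + w}. f H)" for f :: "nat \<Rightarrow> int"
proof -
  have "(\<Sum>H\<in>full. f H) = (\<Sum>j<B * w. f (j + w))"
    unfolding full_def
    by (rule sum.reindex_bij_witness[of _ "\<lambda>j. j + w" "\<lambda>J. J - w"]) auto
  also have "\<dots> = (\<Sum>m<B. \<Sum>j\<in>{m * w..<m * w + w}. f (j + w))"
    by (rule sum.nat_group[symmetric])
  also have "\<dots> = (\<Sum>m<B. \<Sum>H\<in>{(m + 1) * w..<(m + 1) * w + w}. f H)"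
    by (intro sum.cong refl sum.reindex_bij_witness[of _ "\<lambda>J. J - w" "\<lambda>j. j + w"]) auto
  finally show ?thesis .
qed

text \<open>A cell fixes a position only modulo \<open>3 * w\<close>; with both flags set the block
  numbers supply the rest. Long walks are summed over the block of their midpoint, and once they are
  short, a start in the middle block keeps them inside the window.\<close>

lemma mat_block:
  assumes "J div w = a + 1" "a < B" "K div w = e + 1"
  shows "mat h (s, a, e, True, True) (J mod (3 * w)) (K mod (3 * w)) = wm full s (2 ^ h) J K"
proof -
  have short: "mat h (s, a, e, True, True) (J mod (3 * w)) (K mod (3 * w)) = wm full s (2 ^ h) J K"
    if h: "2 ^ h \<le> w" and J: "J div w = a + 1" and K: "K div w = e + 1" 
    for h s a e J K
  proof -
    have Jb: "a * w + w \<le> J" "J < a * w + 2 * w"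
      using J div_mult_mod_eq[of J w] mod_less_divisor[OF w0, of J] by (auto simp del: mod_less_divisor)
    then have Jw: "J \<in> window a" by (auto simp: window_def)
    have "K mod (3 * w) \<in> (\<lambda>J. J mod (3 * w)) ` window a"
      using bij_window[of a] w0 by (auto simp: bij_betw_def)
    then obtain K' where K': "K' \<in> window a" "K mod (3 * w) = K' mod (3 * w)" by auto
    show ?thesis
    proof (cases "K' = K")
      case True
      then have Kw: "K \<in> window a" using K' by simp
      have "wm (window a) s (2 ^ h) J K = wm full s (2 ^ h) J K"
        by (rule wm_local) (use h Jb in linarith)+
      then show ?thesis using mat_short[OF h Jw Kw, of s e True True] J K by simp
    next
      \<comment> \<open>Here \<open>K\<close> lies outside the window and merely shares its cell
        with \<open>K'\<close>. Both sides vanish: the end flag rejects \<open>K'\<close>, and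
        \<open>K\<close> is too far away to be reached from \<open>J\<close>.\<close>
      case False
      then have "K' div w \<noteq> e + 1" using block_eqI[of K "e + 1" K'] K K' by auto
      then have 0: "mat h (s, a, e, True, True) (J mod (3 * w)) (K mod (3 * w)) = 0"
        using mat_short[OF h Jw K'(1)] K'(2) by simp
      have "K \<notin> window a" using False K' mod_window_inj by metis
      then have "K < a * w \<or> a * w + 3 * w \<le> K" by (auto simp: window_def)
      then have "wm full s (2 ^ h) J K = 0"
      proof -
        have "\<not> (K \<le> J + 2 ^ h \<and> J \<le> K + 2 ^ h)"
          using \<open>K < a * w \<or> a * w + 3 * w \<le> K\<close> Jb h by linarith
        then show ?thesis using wm_far by blast
      qed
      with 0 show ?thesis by simp
    qed
  qed
  show ?thesis
    using assms
  proof (induction h arbitrary: s a e J K)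
    case 0
    then show ?case using short[of 0] w0 by simp
  next
    case (Suc h)
    show ?case
    proof (cases "2 ^ Suc h \<le> w")
      case True
      then show ?thesis by (rule short[OF _ Suc.prems(1,3)])
    next
      case False
      let ?W = "3 * w"
      let ?f = "\<lambda>m z. mat h (s, a, m, True, True) (J mod ?W) z *
          mat h (s + 2 ^ h, m, e, True, True) z (K mod ?W)"
      have inner_sum: "(\<Sum>z<?W. ?f m z) = (\<Sum>H\<in>{(m + 1) * w..<(m + 1) * w + w}.
          wm full s (2 ^ h) J H * wm full (s + 2 ^ h) (2 ^ h) H K)" if m: "m < B" for m
      proof -
        \<comment> \<open>The start flag of the right half discards the cells outside block
          \<open>m\<close>.\<close>
        have "(\<Sum>z<?W. ?f m z) = (\<Sum>z | z < ?W \<and> z div w = (m + 1) mod 3. ?f m z)"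
          using mat_source[of h "s + 2 ^ h" m e True _ "K mod ?W"]
          by (intro sum.mono_neutral_right) fastforce+
        also have "\<dots> = (\<Sum>H\<in>{(m + 1) * w..<(m + 1) * w + w}. ?f m (H mod ?W))"
          by (rule sum.reindex_bij_betw[OF bij_block, symmetric])
        also have "\<dots> = (\<Sum>H\<in>{(m + 1) * w..<(m + 1) * w + w}.
          wm full s (2 ^ h) J H * wm full (s + 2 ^ h) (2 ^ h) H K)"
        proof (intro sum.cong refl)
          fix H assume "H \<in> {(m + 1) * w..<(m + 1) * w + w}"
          then have "H div w = m + 1" using w0 by (intro div_nat_eqI) (auto simp: algebra_simps)
          then show "?f m (H mod ?W) = wm full s (2 ^ h) J H * wm full (s + 2 ^ h) (2 ^ h) H K"
            using Suc.IH Suc.prems m by simp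
        qed
        finally show ?thesis .
      qed
      have J: "J \<in> full"
      proof -
        have "J < (a + 2) * w" "(a + 1) * w \<le> J"
          using Suc.prems(1) div_mult_mod_eq[of J w] mod_less_divisor[OF w0, of J]
          by (auto simp del: mod_less_divisor)
        moreover have "(a + 2) * w \<le> (B + 1) * w" using Suc.prems(2) by (intro mult_right_mono) auto
        ultimately show ?thesis by (auto simp: full_def)
      qed
      have "mat (Suc h) (s, a, e, True, True) (J mod ?W) (K mod ?W) = (\<Sum>m<B. \<Sum>z<?W. ?f m z)"
        using False by (simp add: Bs_def)
      also have "\<dots> = (\<Sum>H\<in>full. wm full s (2 ^ h) J H * wm full (s + 2 ^ h) (2 ^ h) H K)"
        unfolding sum_full by (intro sum.cong refl inner_sum) auto
      also have "\<dots> = wm full s (2 ^ h + 2 ^ h) J K" using J by (subst wm_add) auto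
      finally show ?thesis by (simp add: mult_2)
    qed
  qed
qed

end

section \<open>Paths of the grid\<close>

lemma grid_arcs_iff:
  "((i, j), (i', j')) \<in> grid_arcs n \<longleftrightarrow>
    i < n \<and> i' = i + 1 \<and> j \<le> n \<and> j' \<le> n \<and> j \<le> j' + 1 \<and> j' \<le> j + 1"
  by (auto simp: grid_arcs_def)

lemma Grid_simps:
  "verts (Grid n) = {(i, j). i \<le> n \<and> j \<le> n}" "arcs (Grid n) = grid_arcs n"
  "tail (Grid n) = fst" "head (Grid n) = snd"
  by (simp_all add: Grid_def)

lemma wf_digraph_Grid: "wf_digraph (Grid n)"
  by unfold_locales (auto simp: Grid_def grid_arcs_def)

context
  fixes n :: nat
begin

interpretation wf_digraph "Grid n" by (rule wf_digraph_Grid)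

lemma awalk_Grid_Cons:
  "awalk (s, j) (x # p) v \<longleftrightarrow>
    (\<exists>k. x = ((s, j), (s + 1, k)) \<and> ((s, j), (s + 1, k)) \<in> grid_arcs n \<and> awalk (s + 1, k) p v)"
proof -
  have "awalk (s, j) (x # p) v \<longleftrightarrow> x \<in> grid_arcs n \<and> (s, j) = fst x \<and> awalk (snd x) p v"
    by (simp add: awalk_Cons_iff Grid_simps)
  moreover have "x \<in> grid_arcs n \<Longrightarrow> (s, j) = fst x \<Longrightarrow> \<exists>k. x = ((s, j), (s + 1, k))"
    by (cases x) (auto simp: grid_arcs_def)
  ultimately show ?thesis by fastforce
qed

lemma awalk_Grid_layers:
  "awalk (s, j) p (s', j') \<Longrightarrow> map fst (awalk_verts (s, j) p) = [s..<Suc s'] \<and> s' = s + length p"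
proof (induction p arbitrary: s j)
  case Nil
  then show ?case by (simp add: awalk_Nil_iff)
next
  case (Cons x p)
  then obtain k where k: "x = ((s, j), (s + 1, k))" "awalk (s + 1, k) p (s', j')"
    unfolding awalk_Grid_Cons by blast
  with Cons.IH[OF this(2)] have *: "map fst (awalk_verts (s + 1, k) p) = [s + 1..<Suc s']"
    "s' = s + 1 + length p" by auto
  then have "s < Suc s'" by simp
  then have "[s..<Suc s'] = s # [s + 1..<Suc s']" using upt_conv_Cons by simp
  with * k(1) show ?case by (simp add: Grid_simps del: upt_Suc)
qed

text \<open>Layers strictly increase along a walk, so no vertex repeats.\<close>

lemma apath_Grid_iff: "apath (s, j) p (s', j') \<longleftrightarrow> awalk (s, j) p (s', j')"
  using awalk_Grid_layers[of s j p s' j'] distinct_upt[of s "Suc s'"]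
  unfolding apath_def by (metis distinct_map)

text \<open>All walks between two given vertices have the same length, the difference of their
  layers. A finite distance shows that some walk exists, since the infimum of the empty set is
  infinite.\<close>

lemma graph_dist_Grid:
  assumes "graph_dist (Grid n) (s, j) (s', j') = ereal (2 ^ k)"
  shows "s' = s + 2 ^ k"
proof -
  have d: "graph_dist (Grid n) (s, j) (s', j') =
    (INF p\<in>{p. awalk (s, j) p (s', j')}. ereal (awalk_cost (\<lambda>_. 1) p))"
    by (simp add: graph_dist_def \<mu>_def)
  have ne: "{p. awalk (s, j) p (s', j')} \<noteq> {}"
  proof
    assume e: "{p. awalk (s, j) p (s', j')} = {}"
    have "graph_dist (Grid n) (s, j) (s', j') = \<infinity>"
      unfolding d e by (simp add: top_ereal_def)
    with assms show False by simp
  qed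
  then obtain p where p: "awalk (s, j) p (s', j')" by auto
  have c: "awalk_cost (\<lambda>_. 1) q = real (length q)" for q
    by (induction q) (auto simp: awalk_cost_def)
  have "ereal (awalk_cost (\<lambda>_. 1) q) = ereal (real (s' - s))" if "awalk (s, j) q (s', j')" for q
    using awalk_Grid_layers[OF that] by (simp add: c)
  then have "graph_dist (Grid n) (s, j) (s', j') =
    (INF p\<in>{p. awalk (s, j) p (s', j')}. ereal (real (s' - s)))"
    unfolding d by (intro INF_cong) auto
  also have "\<dots> = ereal (real (s' - s))" using ne by (rule INF_const)
  finally have "ereal (2 ^ k) = ereal (real (s' - s))" using assms by simp
  then have "real (2 ^ k) = real (s' - s)" by simp
  then have "2 ^ k = s' - s" using of_nat_eq_iff by blast
  moreover have "s \<le> s'" using awalk_Grid_layers[OF p] by simp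
  ultimately show ?thesis by simp
qed

text \<open>Removing the first arc of a path yields the recursion of \<open>wm\<close>. Finiteness
  is carried through the induction because a sum over an infinite set would be 0 by default.\<close>

lemma path_sum_Grid:
  assumes "0 < w" "s + l \<le> n" "j \<le> n" "j' \<le> n"
  shows "int (path_sum (Grid n) wt (s, j) (s + l, j')) =
    blocks.wm n w wt (blocks.full n w) s l (j + w) (j' + w)"
proof -
  interpret blocks n w wt using assms by unfold_locales
  let ?P = "\<lambda>s l j. {p. awalk (s, j) p (s + l, j')}"
  have "finite (?P s l j) \<and>
    int (\<Sum>p\<in>?P s l j. path_weight wt p) = wm full s l (j + w) (j' + w)"
    using assms(2,3)
  proof (induction l arbitrary: s j)
    case 0
    have "?P s 0 j = (if j = j' then {[]} else {})"
    proof -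
      have "p = []" if "awalk (s, j) p (s + 0, j')" for p
        using awalk_Grid_layers[OF that] by simp
      moreover have "awalk (s, j) [] (s + 0, j') \<longleftrightarrow> j = j'"
        using 0 by (auto simp: awalk_Nil_iff Grid_simps)
      ultimately have "awalk (s, j) p (s + 0, j') \<longleftrightarrow> p = [] \<and> j = j'" for p by metis
      then show ?thesis by simp
    qed
    then show ?case by (auto simp: path_weight_def)
  next
    case (Suc l)
    define N where "N = {k. k \<le> n \<and> j \<le> k + 1 \<and> k \<le> j + 1}"
    have finN: "finite N" by (simp add: N_def)
    let ?e = "\<lambda>k. ((s, j), (s + 1, k))"
    have P: "?P s (Suc l) j = (\<Union>k\<in>N. Cons (?e k) ` ?P (Suc s) l k)"
    proof (intro set_eqI iffI)
      fix p assume "p \<in> ?P s (Suc l) j"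
      then have aw: "awalk (s, j) p (s + Suc l, j')" by simp
      with awalk_Grid_layers[OF this] obtain x q where p: "p = x # q" by (cases p) auto
      with aw show "p \<in> (\<Union>k\<in>N. Cons (?e k) ` ?P (Suc s) l k)"
        unfolding p awalk_Grid_Cons by (auto simp: N_def grid_arcs_iff)
    next
      fix p assume "p \<in> (\<Union>k\<in>N. Cons (?e k) ` ?P (Suc s) l k)"
      then obtain k q where "k \<in> N" "p = ?e k # q" "awalk (Suc s, k) q (Suc s + l, j')" by auto
      then show "p \<in> ?P s (Suc l) j"
        using Suc.prems by (auto simp: awalk_Grid_Cons N_def grid_arcs_iff)
    qed
    have IH: "finite (?P (Suc s) l k)"
      "int (\<Sum>p\<in>?P (Suc s) l k. path_weight wt p) = wm full (Suc s) l (k + w) (j' + w)"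
      if "k \<in> N" for k
      using Suc.IH[of "Suc s" k] Suc.prems that by (auto simp: N_def)
    have "(\<Sum>p\<in>?P s (Suc l) j. path_weight wt p) =
      (\<Sum>k\<in>N. \<Sum>p\<in>Cons (?e k) ` ?P (Suc s) l k. path_weight wt p)"
      unfolding P by (rule sum.UNION_disjoint) (use finN IH in auto)
    also have "\<dots> = (\<Sum>k\<in>N. wt (?e k) * (\<Sum>p\<in>?P (Suc s) l k. path_weight wt p))"
    proof (intro sum.cong refl)
      fix k
      have "(\<Sum>p\<in>Cons (?e k) ` ?P (Suc s) l k. path_weight wt p) =
        (\<Sum>p\<in>?P (Suc s) l k. path_weight wt (?e k # p))"
        by (subst sum.reindex) auto
      then show "(\<Sum>p\<in>Cons (?e k) ` ?P (Suc s) l k. path_weight wt p) =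
        wt (?e k) * (\<Sum>p\<in>?P (Suc s) l k. path_weight wt p)"
        by (simp add: path_weight_def sum_distrib_left)
    qed
    finally have "int (\<Sum>p\<in>?P s (Suc l) j. path_weight wt p) =
      (\<Sum>k\<in>N. int (wt (?e k)) * wm full (Suc s) l (k + w) (j' + w))"
      using IH(2) by simp
    also have "\<dots> = (\<Sum>k\<in>N. arcw s (j + w) (k + w) * wm full (Suc s) l (k + w) (j' + w))"
      using Suc.prems by (intro sum.cong) (auto simp: arcw_def N_def inner_def)
    also have "\<dots> = (\<Sum>H\<in>(\<lambda>k. k + w) ` N. arcw s (j + w) H * wm full (Suc s) l H (j' + w))"
      by (subst sum.reindex) (auto simp: inj_on_def)
    also have "\<dots> = (\<Sum>H\<in>full. arcw s (j + w) H * wm full (Suc s) l H (j' + w))"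
    proof (intro sum.mono_neutral_left ballI)
      show "(\<lambda>k. k + w) ` N \<subseteq> full" by (auto simp: N_def inner_def intro!: inner_full)
      fix H assume H: "H \<in> full - (\<lambda>k. k + w) ` N"
      show "arcw s (j + w) H * wm full (Suc s) l H (j' + w) = 0"
      proof (rule ccontr)
        assume "arcw s (j + w) H * wm full (Suc s) l H (j' + w) \<noteq> 0"
        then have "w \<le> H" "H - w \<in> N" by (auto simp: arcw_def inner_def N_def split: if_splits)
        with H show False by (auto simp: image_iff)
      qed
    qed auto
    finally show ?case using P finN IH(1) by simp
  qed
  then show ?thesis by (simp add: path_sum_def apath_Grid_iff)
qed

end

section \<open>Registers on the catalytic tape\<close>

text \<open>Cell usage throughout: 0--5 input (cell 0 is also the output), 6 block width \<open>w\<close>, 7 \<open>3 * w\<close>,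
  8 number \<open>9 * w\<close> of registers, 9 number of blocks, 10 distance of the end points, 11 bits per
  register, 12 the corresponding power of 2, 13 end of the usable range, 14 offset, 15 number of
  leaves, 16--20 loops and results, 21--40 the current leaf, 41 summand, 42 register number,
  43--46 scratch cells of the register access.\<close>

definition read_bit :: com where
  "read_bit = seqs [Assign 44 (Var 44 [-] Lit 1), Read 45 (Var 42 [*] Var 11 [+] Var 44),
     Assign 43 (Lit 2 [*] Var 43 [+] Var 45)]"

definition read_reg :: com where
  "read_reg = seqs [Assign 43 (Lit 0), Assign 44 (Var 11), While (Var 44) read_bit]"

text \<open>Writing proceeds upward from the least significant bit by halving, whereas
  \<open>read_bit\<close> descends from the top by Horner's rule.\<close>

definition write_bit :: com where
  "write_bit = seqs [Write (Var 42 [*] Var 11 [+] Var 44) (Var 46 [mod] Lit 2),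
     Assign 46 (Var 46 [div] Lit 2), Assign 44 (Var 44 [+] Lit 1)]"

definition write_reg :: com where
  "write_reg = seqs [Assign 44 (Lit 0), While (Var 11 [-] Var 44) write_bit]"

text \<open>The \<open>9 * w\<close> registers of \<open>b\<close> bits are three vector registers
  of \<open>3 * w\<close> cells each. The tape may be longer; the rest keeps its contents.\<close>

locale tape =
  fixes w b Z :: nat and \<tau>0 :: "bool list"
  assumes space: "9 * w * b \<le> length \<tau>0" and bZ: "2 ^ b \<le> Z"
begin

text \<open>The tape whose register \<open>r\<close> has the bits \<open>\<beta> r\<close>, with the least significant bit first.\<close>

definition of_bits :: "(nat \<Rightarrow> nat \<Rightarrow> bool) \<Rightarrow> bool list" where
  "of_bits \<beta> = map (\<lambda>i. if i < 9 * w * b then \<beta> (i div b) (i mod b) else \<tau>0 ! i) [0..<length \<tau>0]"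

lemma length_of_bits [simp]: "length (of_bits \<beta>) = length \<tau>0"
  by (simp add: of_bits_def)

lemma address_less: "r < 9 * w \<Longrightarrow> i < b \<Longrightarrow> r * b + i < 9 * w * b"
proof -
  assume "r < 9 * w" "i < b"
  then have "r * b + i < Suc r * b" by simp
  also have "\<dots> \<le> 9 * w * b" using \<open>r < 9 * w\<close> by (intro mult_le_mono) auto
  finally show ?thesis .
qed

lemma nth_of_bits:
  assumes "r < 9 * w" "i < b"
  shows "of_bits \<beta> ! (r * b + i) = \<beta> r i"
  using address_less[OF assms] assms space by (simp add: of_bits_def)

lemma update_of_bits:
  assumes "r < 9 * w" "i < b"
  shows "(of_bits \<beta>)[r * b + i := v] = of_bits (\<beta>(r := (\<beta> r)(i := v)))"
proof (rule nth_equalityI)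
  fix j assume j: "j < length ((of_bits \<beta>)[r * b + i := v])"
  have "j = r * b + i \<longleftrightarrow> j div b = r \<and> j mod b = i"
    using assms div_mult_mod_eq[of j b] by auto
  with j assms address_less[OF assms] show "(of_bits \<beta>)[r * b + i := v] ! j = of_bits (\<beta>(r := (\<beta> r)(i := v))) ! j"
    by (auto simp: of_bits_def nth_list_update)
qed simp

lemma of_bits_cong: "(\<And>r i. r < 9 * w \<Longrightarrow> i < b \<Longrightarrow> \<beta> r i = \<beta>' r i) \<Longrightarrow> of_bits \<beta> = of_bits \<beta>'"
proof -
  assume *: "\<And>r i. r < 9 * w \<Longrightarrow> i < b \<Longrightarrow> \<beta> r i = \<beta>' r i"
  have "\<beta> (i div b) (i mod b) = \<beta>' (i div b) (i mod b)" if "i < 9 * w * b" for i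
    using that by (intro *) (auto simp: less_mult_imp_div_less intro!: mod_less_divisor gr0I)
  then show ?thesis by (auto simp: of_bits_def)
qed

lemma Z_pos: "1 \<le> Z" using bZ one_le_power[of "2::nat" b] by linarith

lemma b_le: "b \<le> Z" using bZ less_exp[of b] by linarith

lemma wp_read_reg:
  assumes f: "f 11 = b" "f 42 = r" and r: "r < 9 * w"
    and v: "v < 2 ^ b" "\<And>i. i < b \<Longrightarrow> \<beta> r i = bit v i"
    and post: "\<And>t f'. t \<le> 40 * b + 20 \<Longrightarrow> \<forall>x<43. f' x = f x \<Longrightarrow> f' 43 = v \<Longrightarrow> R t (f', of_bits \<beta>)"
  shows "wp Z D read_reg (f, of_bits \<beta>) R"
proof -
  have loop: "wp Z D (While (Var 44) read_bit) (f(43 := 0, 44 := b), of_bits \<beta>) (\<lambda>t. R (t0 + t))"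
    if "t0 \<le> 10" for t0
  proof (rule wp_While[where N = b and T = 30 and
      I = "\<lambda>i st. snd st = of_bits \<beta> \<and> (\<forall>x<43. fst st x = f x) \<and> fst st 44 = b - i \<and> fst st 43 = v div 2 ^ (b - i)"])
    fix i st
    assume i: "i < b" and I: "snd st = of_bits \<beta> \<and> (\<forall>x<43. fst st x = f x) \<and> fst st 44 = b - i \<and> fst st 43 = v div 2 ^ (b - i)"
    obtain g where st: "st = (g, of_bits \<beta>)" using I by (cases st) auto
    have g: "\<forall>x<43. g x = f x" "g 44 = b - i" "g 43 = v div 2 ^ (b - i)" using I st by auto
    define j where "j = b - Suc i"
    have j: "b - i = Suc j" "j < b" using i by (auto simp: j_def)
    have dv: "2 * (v div 2 ^ Suc j) + of_bool (bit v j) = v div 2 ^ j"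
    proof -
      have "v div 2 ^ j = 2 * (v div 2 ^ j div 2) + v div 2 ^ j mod 2" by simp
      moreover have "v div 2 ^ j div 2 = v div 2 ^ Suc j" by (simp add: div_mult2_eq[symmetric] mult.commute)
      moreover have "v div 2 ^ j mod 2 = of_bool (bit v j)" by (simp add: bit_iff_odd mod2_eq_if)
      ultimately show ?thesis by simp
    qed
    have "v div 2 ^ j \<le> Z" using v bZ div_le_dividend[of v "2 ^ j"] by linarith
    with dv have dz: "2 * (v div (2 * 2 ^ j)) + of_bool (bit v j) \<le> Z" by simp
    show "ev (Var 44) (fst st) \<noteq> 0 \<and> wp Z D read_bit st
      (\<lambda>t st'. t \<le> 30 \<and> snd st' = of_bits \<beta> \<and> (\<forall>x<43. fst st' x = f x) \<and> fst st' 44 = b - Suc i \<and>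
        fst st' 43 = v div 2 ^ (b - Suc i))"
      using b_le j dz dv address_less[OF r j(2)] space
      by (simp add: st read_bit_def wp_simps g f nth_of_bits[OF r j(2)] v(2)[OF j(2)] j_def[symmetric])
  next
    fix t st assume "t \<le> b * (30 + ecost (Var 44) + 3) + ecost (Var 44) + 1"
      "snd st = of_bits \<beta> \<and> (\<forall>x<43. fst st x = f x) \<and> fst st 44 = b - b \<and> fst st 43 = v div 2 ^ (b - b)"
    then show "R (t0 + t) st" using post[of "t0 + t" "fst st"] that by (cases st) simp
  qed (use f v in auto)
  have "f(43 := 0, 44 := (f(43 := 0)) 11) = f(43 := 0, 44 := b)" using f by simp
  then show ?thesis
    using b_le f loop[of "3 + 4"] by (simp add: read_reg_def wp_simps)
qed

lemma wp_write_reg: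
  assumes f: "f 11 = b" "f 42 = r" "f 46 = z" and r: "r < 9 * w" and z: "z < 2 ^ b"
    and post: "\<And>t f'. t \<le> 40 * b + 20 \<Longrightarrow> \<forall>x<43. f' x = f x \<Longrightarrow> R t (f', of_bits (\<beta>(r := bit z)))"
  shows "wp Z D write_reg (f, of_bits \<beta>) R"
proof -
  let ?\<beta> = "\<lambda>i. \<beta>(r := \<lambda>j. if j < i then bit z j else \<beta> r j)"
  let ?I = "\<lambda>i st. snd st = of_bits (?\<beta> i) \<and> (\<forall>x<43. fst st x = f x) \<and> fst st 44 = i \<and> fst st 46 = z div 2 ^ i"
  have final: "of_bits (?\<beta> b) = of_bits (\<beta>(r := bit z))"
    by (intro of_bits_cong) auto
  have loop: "wp Z D (While (Var 11 [-] Var 44) write_bit)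
     (f(44 := 0), of_bits \<beta>) (\<lambda>t. R (t0 + t))" if "t0 \<le> 10" for t0
  proof (rule wp_While[where N = b and T = 30 and I = ?I])
    fix i st
    assume i: "i < b" and I: "?I i st"
    obtain g where st: "st = (g, of_bits (?\<beta> i))" using I by (cases st) auto
    have g: "\<forall>x<43. g x = f x" "g 44 = i" "g 46 = z div 2 ^ i" using I st by auto
    have "z div 2 ^ Suc i \<le> Z" using z bZ div_le_dividend[of z "2 ^ Suc i"] by linarith
    moreover have "z div 2 ^ i div 2 = z div 2 ^ Suc i" by (simp add: div_mult2_eq[symmetric] mult.commute)
    moreover have "0 < z div 2 ^ i mod 2 \<longleftrightarrow> bit z i" by (simp add: bit_iff_odd odd_iff_mod_2_eq_one)
    moreover have "(of_bits (?\<beta> i))[r * b + i := bit z i] = of_bits (?\<beta> (Suc i))"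
      unfolding update_of_bits[OF r i] by (intro of_bits_cong) (auto simp: less_Suc_eq)
    ultimately show "ev (Var 11 [-] Var 44) (fst st) \<noteq> 0 \<and> wp Z D write_bit st (\<lambda>t st'. t \<le> 30 \<and> ?I (Suc i) st')"
      using b_le i address_less[OF r i] space
      by (simp add: st write_bit_def wp_simps g f del: power_Suc)
  next
    have "(\<lambda>j. if j < 0 then bit z j else \<beta> r j) = \<beta> r" by simp
    then show "?I 0 (f(44 := 0), of_bits \<beta>)" using f by simp
  next
    fix t st assume "t \<le> b * (30 + ecost (Var 11 [-] Var 44) + 3) + ecost (Var 11 [-] Var 44) + 1" "?I b st"
    then show "R (t0 + t) st" using post[of "t0 + t" "fst st"] that by (cases st) (auto simp: final)
  qed (use f in auto)
  show ?thesis
    using f loop[of 3] by (simp add: write_reg_def wp_simps numeral_3_eq_3)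
qed

definition x0 :: "nat \<Rightarrow> nat" where
  "x0 r = horner_sum of_bool 2 (map (\<lambda>i. \<tau>0 ! (r * b + i)) [0..<b])"

lemma x0_less: "x0 r < 2 ^ b"
  using horner_sum_of_bool_2_less[of "map (\<lambda>i. \<tau>0 ! (r * b + i)) [0..<b]"] by (simp add: x0_def)

lemma bit_x0: "i < b \<Longrightarrow> bit (x0 r) i = \<tau>0 ! (r * b + i)"
  by (simp add: x0_def bit_horner_sum_bit_iff)

lemma of_bits_x0: "of_bits (\<lambda>r. bit (x0 r)) = \<tau>0"
proof (rule nth_equalityI)
  fix i assume "i < length (of_bits (\<lambda>r. bit (x0 r)))"
  moreover have "bit (x0 (i div b)) (i mod b) = \<tau>0 ! i" if "i < 9 * w * b"
    using that by (subst bit_x0) (auto intro!: mod_less_divisor gr0I)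
  ultimately show "of_bits (\<lambda>r. bit (x0 r)) ! i = \<tau>0 ! i" by (simp add: of_bits_def)
qed simp

end

text \<open>Register contents \<open>\<ge> p * (M div p)\<close> cannot be changed within their residue class modulo \<open>p\<close>.
  Each register forbids at most one of the offsets \<open>p, 2 * p, \<dots>\<close>.\<close>

lemma good_offset:
  fixes x :: "nat \<Rightarrow> nat"
  assumes "0 < p" "(R + 2) * p \<le> M" "\<And>r. r < R \<Longrightarrow> x r < M"
  shows "\<exists>k\<in>{1..R + 1}. \<forall>r<R. (x r + k * p) mod M < p * (M div p)"
proof (rule ccontr)
  assume "\<not> ?thesis"
  then have "\<forall>k\<in>{1..R + 1}. \<exists>r<R. p * (M div p) \<le> (x r + k * p) mod M" by (auto simp: not_less)
  then obtain r where r: "\<And>k. k \<in> {1..R + 1} \<Longrightarrow> r k < R"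
    "\<And>k. k \<in> {1..R + 1} \<Longrightarrow> p * (M div p) \<le> (x (r k) + k * p) mod M" by metis
  have "inj_on r {1..R + 1}"
  proof (rule linorder_inj_onI')
    fix i j assume ij: "i \<in> {1..R + 1}" "j \<in> {1..R + 1}" "i < j"
    show "r i \<noteq> r j"
    proof
      assume eq: "r i = r j"
      let ?x = "x (r i)" and ?E = "p * (M div p)"
      \<comment> \<open>The forbidden values from \<open>?E\<close> to \<open>M\<close> form an
        interval shorter than \<open>p\<close>, whereas the two sums differ by
        \<open>(j - i) * p\<close>, which lies between \<open>p\<close> and \<open>M - p\<close>. So
        they cannot both fall into it, even modulo \<open>M\<close>.\<close>
      have E: "M < ?E + p" "?E \<le> M"
        using mod_less_divisor[OF assms(1), of M] mult_div_mod_eq[of p M] by linarith+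
      have M: "i * p + p \<le> j * p" "j * p + p \<le> M"
      proof -
        have "(i + 1) * p \<le> j * p" using ij by (intro mult_right_mono) auto
        then show "i * p + p \<le> j * p" by simp
        have "(j + 1) * p \<le> (R + 2) * p" using ij by (intro mult_right_mono) auto
        then show "j * p + p \<le> M" using assms(2) by simp
      qed
      have x: "?x < M" using r(1)[OF ij(1)] assms(3) by simp
      have md: "y mod M = (if y < M then y else y - M)" if "y < 2 * M" for y
        using that by (auto simp: mod_if)
      have "?E \<le> (?x + i * p) mod M" "?E \<le> (?x + j * p) mod M"
        using r(2)[OF ij(1)] r(2)[OF ij(2)] eq by auto
      moreover have "?x + i * p < 2 * M" "?x + j * p < 2 * M" using M x by linarith+
      ultimately show False
        using md[of "?x + i * p"] md[of "?x + j * p"] E M x by (auto split: if_splits)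
    qed
  qed
  then have "card {1..R + 1} \<le> card {..<R}"
    using r(1) by (intro card_inj_on_le) auto
  then show False by simp
qed

section \<open>Arithmetic modulo \<open>p\<close> on registers with arbitrary contents\<close>

definition get_val :: com where
  "get_val = Seq read_reg (Assign 43 ((Var 43 [+] Var 14) [mod] Var 12 [mod] Var 1))"

text \<open>Only the residue part of the offset content changes. Adding \<open>2 ^ b\<close> (cell
  12) before subtracting the offset (cell 14) keeps the truncated subtraction exact.\<close>

definition add_to :: com where
  "add_to = seqs [read_reg, Assign 43 ((Var 43 [+] Var 14) [mod] Var 12),
     Assign 46 ((Var 43 [div] Var 1 [*] Var 1 [+] (Var 43 [mod] Var 1 [+] Var 41) [mod] Var 1
       [+] Var 12 [-] Var 14) [mod] Var 12),
     write_reg]"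

locale registers = tape +
  fixes p \<alpha> :: nat
  assumes p2: "2 \<le> p" and \<alpha>: "\<alpha> \<le> 2 ^ b"
    and offset: "\<And>r. r < 9 * w \<Longrightarrow> (x0 r + \<alpha>) mod 2 ^ b < p * (2 ^ b div p)"
    and w_pos: "0 < w"
begin

definition y0 :: "nat \<Rightarrow> nat" where "y0 r = (x0 r + \<alpha>) mod 2 ^ b"

text \<open>The element of \<open>\<int>\<^sub>p\<close> held by a register is the residue of its offset content; the quotient never
  changes. Registers are tracked by integers \<open>G\<close>, of which only the residues are stored.\<close>

definition shifted :: "regs \<Rightarrow> nat \<Rightarrow> nat" where
  "shifted G r = y0 r div p * p + nat (G (r div (3 * w)) (r mod (3 * w)) mod int p)"

definition content :: "regs \<Rightarrow> nat \<Rightarrow> nat" where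
  "content G r = (shifted G r + 2 ^ b - \<alpha>) mod 2 ^ b"

definition tape_of :: "regs \<Rightarrow> bool list" where
  "tape_of G = of_bits (\<lambda>r. bit (content G r))"

definition initial_regs :: regs where
  "initial_regs X c = int (y0 (X * (3 * w) + c))"

lemma residue_less: "nat (x mod int p) < p"
  using p2 by (simp add: nat_less_iff)

text \<open>This is the purpose of the offset: \<open>y0 r\<close> lies in a complete run of
  \<open>p\<close> values, so every residue fits next to its quotient.\<close>

lemma shifted_less: "r < 9 * w \<Longrightarrow> shifted G r < 2 ^ b"
proof -
  assume "r < 9 * w"
  then have "y0 r < (2 ^ b div p) * p" using offset by (simp add: y0_def mult.commute)
  then have "y0 r div p < 2 ^ b div p" by (simp add: less_mult_imp_div_less)
  then have "(y0 r div p + 1) * p \<le> (2 ^ b div p) * p" by (intro mult_right_mono) auto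
  also have "\<dots> \<le> 2 ^ b" by simp
  finally show ?thesis using residue_less[of "G (r div (3 * w)) (r mod (3 * w))"]
    by (simp add: shifted_def)
qed

lemma shifted_content:
  assumes "r < 9 * w"
  shows "(content G r + \<alpha>) mod 2 ^ b = shifted G r"
proof -
  have "(content G r + \<alpha>) mod 2 ^ b = (shifted G r + 2 ^ b - \<alpha> + \<alpha>) mod 2 ^ b"
    unfolding content_def by (simp add: mod_add_left_eq)
  also have "\<dots> = shifted G r" using \<alpha> shifted_less[OF assms] by simp
  finally show ?thesis .
qed

lemma content_less: "content G r < 2 ^ b" by (simp add: content_def)

text \<open>Every initial tape has this form, and \<open>tape_of\<close> depends on the residues
  only, so restoring the residues restores every bit.\<close>

lemma tape_of_initial: "tape_of initial_regs = \<tau>0"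
proof -
  have "content initial_regs r = x0 r" for r
  proof -
    have "r div (3 * w) * (3 * w) + r mod (3 * w) = r" by (rule div_mult_mod_eq)
    then have "shifted initial_regs r = y0 r"
      by (simp add: shifted_def initial_regs_def flip: zmod_int)
    then have "content initial_regs r = (y0 r + (2 ^ b - \<alpha>)) mod 2 ^ b"
      using \<alpha> by (simp add: content_def)
    also have "\<dots> = (x0 r + \<alpha> + (2 ^ b - \<alpha>)) mod 2 ^ b"
      unfolding y0_def by (rule mod_add_left_eq)
    also have "\<dots> = x0 r" using \<alpha> x0_less[of r] by simp
    finally show ?thesis .
  qed
  then show ?thesis by (simp add: tape_of_def of_bits_x0)
qed

lemma address: "X < 3 \<Longrightarrow> c < 3 * w \<Longrightarrow> X * (3 * w) + c < 9 * w"
proof -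
  assume "X < 3" "c < 3 * w"
  then have "X * (3 * w) + c < Suc X * (3 * w)" by simp
  also have "\<dots> \<le> 3 * (3 * w)" using \<open>X < 3\<close> by (intro mult_right_mono) auto
  finally show ?thesis by simp
qed

lemma bounds: "b \<le> Z" "p \<le> Z" "\<alpha> \<le> Z" "x < 2 ^ b \<Longrightarrow> x \<le> Z" "x < p \<Longrightarrow> x \<le> Z"
proof -
  show "b \<le> Z" by (rule b_le)
  show "\<alpha> \<le> Z" using \<alpha> bZ by linarith
  show "x < 2 ^ b \<Longrightarrow> x \<le> Z" using bZ by linarith
  have "p * (2 ^ b div p) \<le> 2 ^ b" by simp
  moreover have "0 < p * (2 ^ b div p)" using offset[of 0] w_pos by linarith
  then have "p * 1 \<le> p * (2 ^ b div p)" by (intro mult_le_mono2) auto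
  ultimately show "p \<le> Z" using bZ by linarith
  then show "x < p \<Longrightarrow> x \<le> Z" by linarith
qed

lemma wp_get_val:
  assumes f: "f 1 = p" "f 11 = b" "f 12 = 2 ^ b" "f 14 = \<alpha>" "f 42 = X * (3 * w) + c"
    and Xc: "X < 3" "c < 3 * w"
    and post: "\<And>t f'. t \<le> 40 * b + 50 \<Longrightarrow> \<forall>x<43. f' x = f x \<Longrightarrow> f' 43 = nat (G X c mod int p) \<Longrightarrow>
      R t (f', tape_of G)"
  shows "wp Z D get_val (f, tape_of G) R"
proof -
  let ?r = "X * (3 * w) + c"
  have c: "(content G ?r + \<alpha>) mod 2 ^ b mod p = nat (G X c mod int p)"
    using shifted_content[OF address[OF Xc]] Xc residue_less[of "G X c"] by (simp add: shifted_def)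
  have "nat (G X c mod int p) \<le> Z" using bounds residue_less by blast
  with c f post show ?thesis unfolding get_val_def wp_simps tape_of_def
    by (intro wp_read_reg[where r = ?r and v = "content G ?r"])
      (auto simp: wp_simps content_less address[OF Xc])
qed

lemma wp_add_to:
  assumes f: "f 1 = p" "f 11 = b" "f 12 = 2 ^ b" "f 14 = \<alpha>" "f 42 = X * (3 * w) + c"
      "f 41 = nat (\<delta> mod int p)"
    and Xc: "X < 3" "c < 3 * w"
    and post: "\<And>t f'. t \<le> 80 * b + 120 \<Longrightarrow> \<forall>x<43. f' x = f x \<Longrightarrow>
      R t (f', tape_of (G(X := (G X)(c := G X c + \<delta>))))"
  shows "wp Z D add_to (f, tape_of G) R"
proof -
  let ?r = "X * (3 * w) + c" and ?G = "G(X := (G X)(c := G X c + \<delta>))"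
  let ?y = "shifted G ?r"
  have y: "(content G ?r + \<alpha>) mod 2 ^ b = ?y"
    by (rule shifted_content[OF address[OF Xc]])
  have yd: "?y div p = y0 ?r div p" "?y mod p = nat (G X c mod int p)"
    using Xc residue_less[of "G X c"] p2 by (simp_all add: shifted_def)
  have "int ((nat (G X c mod int p) + nat (\<delta> mod int p)) mod p) = (G X c + \<delta>) mod int p"
    using p2 by (simp add: zmod_int mod_add_eq)
  then have "(nat (G X c mod int p) + nat (\<delta> mod int p)) mod p = nat ((G X c + \<delta>) mod int p)"
    by linarith
  then have new: "(?y div p * p + (?y mod p + nat (\<delta> mod int p)) mod p + 2 ^ b - \<alpha>) mod 2 ^ b = content ?G ?r"
    unfolding yd unfolding content_def shifted_def using Xc by simp
  have upd: "of_bits ((\<lambda>r. bit (content G r))(?r := bit (content ?G ?r))) = tape_of ?G"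
    unfolding tape_of_def
  proof (intro of_bits_cong)
    fix r i
    have "r div (3 * w) = X \<and> r mod (3 * w) = c \<Longrightarrow> r = ?r" by (metis div_mult_mod_eq)
    then have "r \<noteq> ?r \<Longrightarrow> content ?G r = content G r"
      by (auto simp: content_def shifted_def)
    then show "((\<lambda>r. bit (content G r))(?r := bit (content ?G ?r))) r i = bit (content ?G r) i" by auto
  qed
  have Z: "?y \<le> Z" "content ?G ?r \<le> Z" using bounds shifted_less[OF address[OF Xc]] content_less by blast+
  show ?thesis unfolding add_to_def tape_of_def seqs.simps wp_simps
  proof (rule wp_read_reg[where r = ?r and v = "content G ?r"])
    fix t1 f1 assume 1: "t1 \<le> 40 * b + 20" "\<forall>x<43. f1 x = f x" "f1 43 = content G ?r"
    let ?f2 = "f1(43 := ?y, 46 := content ?G ?r)"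
    have "wp Z D write_reg (?f2, of_bits (\<lambda>r. bit (content G r))) (\<lambda>t. R (t1 + (t0 + t)))" if "t0 \<le> 60" for t0
    proof (rule wp_write_reg[where r = ?r and z = "content ?G ?r"])
      fix t2 f2 assume "t2 \<le> 40 * b + 20" "\<forall>x<43. f2 x = ?f2 x"
      then show "R (t1 + (t0 + t2)) (f2, of_bits ((\<lambda>r. bit (content G r))(?r := bit (content ?G ?r))))"
        unfolding upd using 1 that by (intro post) auto
    qed (use f 1 content_less address[OF Xc] in auto)
    from this[of "ecost ((Var 43 [+] Var 14) [mod] Var 12) + 2 + (ecost ((Var 43 [div] Var 1 [*] Var 1 [+] (Var 43 [mod] Var 1 [+] Var 41) [mod] Var 1
       [+] Var 12 [-] Var 14) [mod] Var 12) + 2)"]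
    show "wp Z D (Seq (Assign 43 ((Var 43 [+] Var 14) [mod] Var 12))
       (Seq (Assign 46 ((Var 43 [div] Var 1 [*] Var 1 [+] (Var 43 [mod] Var 1 [+] Var 41) [mod] Var 1
       [+] Var 12 [-] Var 14) [mod] Var 12)) write_reg)) (f1, of_bits (\<lambda>r. bit (content G r)))
       (\<lambda>t2. R (t1 + t2))"
      using 1 f y new Z by (simp add: wp_simps add.assoc)
  qed (use f content_less address[OF Xc] in auto)
qed

end

section \<open>The main loop\<close>

abbreviation exp_eq (infix "[=]" 50) where "a [=] b \<equiv> (a [\<le>] b) [*] (b [\<le>] a)"

text \<open>Cell 21 holds the leaf number within the current subtree, 22 its number of leaves, 23
  its walk length, 24 to 28 the node, 29 to 31 the source, target and scratch registers, and 32 the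
  sign.\<close>

definition leaf_init :: com where
  "leaf_init = seqs [Assign 21 (Var 20), Assign 22 (Var 15), Assign 23 (Var 10), Assign 24 (Var 2),
     Assign 25 (Var 3 [div] Var 6), Assign 26 (Var 5 [div] Var 6), Assign 27 (Lit 1),
     Assign 28 (Lit 1), Assign 29 (Lit 0), Assign 30 (Lit 1), Assign 31 (Lit 2), Assign 32 (Var 19)]"

definition descend_left :: com where
  "descend_left = seqs [Assign 36 (Var 30), Assign 30 (Var 31), Assign 31 (Var 36),
     Assign 32 (Var 35), Cond (Var 23 [-] Var 6) (Assign 26 (Var 34)) (Assign 28 (Lit 0))]"

definition descend_right :: com where
  "descend_right = seqs [Assign 36 (Var 29), Assign 29 (Var 31), Assign 31 (Var 36),
     Assign 24 (Var 24 [+] Var 23 [div] Lit 2), Assign 32 ((Var 32 [+] Var 35) [mod] Lit 2),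
     Cond (Var 23 [-] Var 6) (Assign 25 (Var 34)) (Assign 27 (Lit 0))]"

text \<open>The size of a child's subtree is recovered by division, so the values of
  \<open>cnt\<close> need not be stored.\<close>

definition digit_com :: com where
  "digit_com = seqs [Assign 22 (Var 22 [div] (Var 34 [*] Lit 4)), Assign 33 (Var 21 [div] Var 22),
     Assign 21 (Var 21 [mod] Var 22), Assign 34 (Var 33 [div] Lit 4),
     Assign 35 (Var 33 [mod] Lit 4 [div] Lit 2)]"

definition descend :: com where
  "descend = seqs [Cond (Var 23 [-] Var 6) (Assign 34 (Var 9)) (Assign 34 (Lit 1)),
     digit_com,
     Cond (Var 33 [mod] Lit 2) descend_right descend_left, Assign 23 (Var 23 [div] Lit 2)]"

text \<open>Products act as conjunctions, and adding \<open>Lit 1\<close> minus a flag turns a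
  condition into an implication from that flag.\<close>

definition guard_exp :: exp where
  "guard_exp = (Var 6 [\<le>] Var 35) [*] (Var 35 [\<le>] Var 0 [+] Var 6) [*]
     (Var 6 [\<le>] Var 36) [*] (Var 36 [\<le>] Var 0 [+] Var 6) [*]
     (Var 25 [*] Var 6 [\<le>] Var 36) [*] (Var 36 [+] Lit 1 [\<le>] Var 25 [*] Var 6 [+] Var 7) [*]
     (Lit 1 [-] Var 27 [+] (Var 35 [div] Var 6 [=] Var 25 [+] Lit 1)) [*]
     (Lit 1 [-] Var 28 [+] (Var 36 [div] Var 6 [=] Var 26 [+] Lit 1))"

text \<open>It is executed under the guard only. Queries that are not arcs have unspecified answers,
  which might even exceed the space bound.\<close>

definition leaf_update :: com where
  "leaf_update = seqs [Assign 38 (Var 35 [-] Var 6), Assign 39 (Var 36 [-] Var 6),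
     Assign 40 (Var 24 [+] Lit 1), Ask 37 [24, 38, 40, 39],
     Assign 42 (Var 29 [*] Var 7 [+] Var 35 [mod] Var 7), get_val,
     Cond (Var 32) (Assign 41 ((Var 1 [-] Var 37 [*] Var 43 [mod] Var 1) [mod] Var 1))
       (Assign 41 (Var 37 [*] Var 43 [mod] Var 1)),
     Assign 42 (Var 30 [*] Var 7 [+] Var 36 [mod] Var 7), add_to]"

definition leaf_body :: com where
  "leaf_body = seqs [Assign 35 (Var 25 [*] Var 6 [+] Var 21 [div] Lit 3),
     Assign 36 (Var 35 [+] Var 21 [mod] Lit 3 [-] Lit 1),
     Cond guard_exp leaf_update (Assign 41 (Lit 0))]"

definition leaf_com :: com where
  "leaf_com = seqs [leaf_init, While (Var 23 [-] Lit 1) descend, leaf_body,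
     Assign 20 (Var 20 [+] Lit 1)]"

definition run_com :: com where
  "run_com = Seq (Assign 20 (Lit 0)) (While (Var 15 [-] Var 20) leaf_com)"

locale machine = registers w b Z \<tau>0 p \<alpha> + blocks n w \<mu>
  for w b Z \<tau>0 p \<alpha> n \<mu> +
  fixes D :: "nat list \<Rightarrow> nat" and iu ju jv k :: nat
  assumes weights: "weight_oracle n p \<mu> D"
    and layers: "iu + 2 ^ k \<le> n" and ju: "ju \<le> n" and jv: "jv \<le> n"
    and Zn: "n + 3 * w + 5 \<le> Z" and Zcnt: "cnt k \<le> Z"
begin

lemma Z_le: "x \<le> n + 3 * w + 5 \<Longrightarrow> x \<le> Z" using Zn by linarith

definition glob :: "(nat \<Rightarrow> nat) \<Rightarrow> bool" where
  "glob f \<longleftrightarrow> f 0 = n \<and> f 1 = p \<and> f 2 = iu \<and> f 3 = ju \<and> f 5 = jv \<and> f 6 = w \<and> f 7 = 3 * w \<and>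
     f 9 = B \<and> f 10 = 2 ^ k \<and> f 11 = b \<and> f 12 = 2 ^ b \<and> f 14 = \<alpha> \<and> f 15 = cnt k"

lemma glob_cong: "glob f \<Longrightarrow> \<forall>x<16. f' x = f x \<Longrightarrow> glob f'"
  by (simp add: glob_def)

fun represents :: "(nat \<Rightarrow> nat) \<Rightarrow> call \<Rightarrow> bool" where
  "represents f ((s, a, e, fs, fe), X, Y, V, sg) \<longleftrightarrow> f 24 = s \<and> f 25 = a \<and> f 26 = e \<and>
     f 27 = of_bool fs \<and> f 28 = of_bool fe \<and> f 29 = X \<and> f 30 = Y \<and> f 31 = V \<and> f 32 = sg"

fun valid :: "nat \<Rightarrow> call \<Rightarrow> bool" where
  "valid h ((s, a, e, fs, fe), X, Y, V, sg) \<longleftrightarrow> a < B \<and> e < B \<and> s + 2 ^ h \<le> iu + 2 ^ k \<and>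
     X < 3 \<and> Y < 3 \<and> V < 3 \<and> X \<noteq> Y \<and> X \<noteq> V \<and> Y \<noteq> V \<and> sg < 2"

lemma B_le: "B \<le> n + 1"
  by (simp add: B_def)

lemma cnt_mono: "h \<le> k \<Longrightarrow> cnt h \<le> cnt k"
proof (induction k)
  case (Suc k)
  have "1 * cnt k \<le> cnt (Suc k)" unfolding cnt.simps by (intro mult_right_mono) (simp_all add: Bs_def B_def)
  with Suc show ?case by (cases "h = Suc k") (auto simp del: cnt.simps)
qed simp

lemma pow_le: "h \<le> k \<Longrightarrow> 2 ^ h \<le> n"
proof -
  assume "h \<le> k"
  then have "(2::nat) ^ h \<le> 2 ^ k" by (intro power_increasing) auto
  with layers show ?thesis by linarith
qed

lemma wp_descend:
  assumes "glob f" and f: "f 22 = cnt (Suc h)" "f 23 = 2 ^ Suc h" and t: "f 21 < cnt (Suc h)"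
    and "represents f q" "valid (Suc h) q" and h: "Suc h \<le> k"
  shows "wp Z D descend (f, \<tau>) (\<lambda>t st'. t \<le> 250 \<and> snd st' = \<tau> \<and> (\<forall>x<21. fst st' x = f x) \<and>
    fst st' 22 = cnt h \<and> fst st' 23 = 2 ^ h \<and> fst st' 21 = f 21 mod cnt h \<and>
    represents (fst st') (child (Suc h) q (f 21 div cnt h)) \<and> valid h (child (Suc h) q (f 21 div cnt h)))"
proof -
  obtain s a e fs fe X Y V sg where q: "q = ((s, a, e, fs, fe), X, Y, V, sg)" by (cases q) auto
  have g: "f 6 = w" "f 9 = B" using \<open>glob f\<close> by (simp_all add: glob_def)
  have r: "f 24 = s" "f 25 = a" "f 26 = e" "f 27 = of_bool fs" "f 28 = of_bool fe"
    "f 29 = X" "f 30 = Y" "f 31 = V" "f 32 = sg"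
    using \<open>represents f q\<close> by (simp_all add: q)
  have v: "a < B" "e < B" "s + 2 * 2 ^ h \<le> iu + 2 ^ k" "X < 3" "Y < 3" "V < 3" "X \<noteq> Y" "X \<noteq> V" "Y \<noteq> V" "sg < 2"
    using \<open>valid (Suc h) q\<close> by (simp_all add: q)
  define d where "d = f 21 div cnt h"
  have Bs: "0 < Bs (Suc h)" by (simp add: Bs_def B_def)
  have c: "cnt (Suc h) div (Bs (Suc h) * 4) = cnt h" using Bs by simp
  have d: "d < Bs (Suc h) * 4" using t by (simp add: d_def less_mult_imp_div_less)
  then have m: "d div 4 < Bs (Suc h)" by (simp add: less_mult_imp_div_less)
  have Z: "cnt h \<le> Z" "f 21 mod cnt h \<le> Z" "d \<le> Z" "d div 4 \<le> Z" "d mod 4 div 2 \<le> Z"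
    "2 ^ h \<le> Z" "s + 2 ^ h \<le> Z" "B \<le> Z" "X \<le> Z" "Y \<le> Z" "V \<le> Z"
  proof -
    show ch: "cnt h \<le> Z" using cnt_mono[of h] h Zcnt by linarith
    show "f 21 mod cnt h \<le> Z" using ch mod_less_divisor[OF cnt_pos[of h], of "f 21"] by linarith
    have "f 21 \<le> Z" using t cnt_mono[OF h] Zcnt by linarith
    then show "d \<le> Z" unfolding d_def by (rule order_trans[OF div_le_dividend])
    then show "d div 4 \<le> Z" using div_le_dividend[of d 4] by linarith
    show "d mod 4 div 2 \<le> Z" using Zn by linarith
    show "2 ^ h \<le> Z" using pow_le[of h] h Zn by simp
    show "s + 2 ^ h \<le> Z" using v(3) layers Zn by linarith
    show "B \<le> Z" "X \<le> Z" "Y \<le> Z" "V \<le> Z" using B_le v Zn by linarith+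
  qed
  have sg: "(sg + d mod 4 div 2) mod 2 \<le> Z" "d mod 4 div 2 < 2" using Z_le[of "(sg + d mod 4 div 2) mod 2"] Zn by linarith+
  have Z1: "Suc 0 \<le> Z" using Z_pos by simp
  have mB: "d div 4 < B" if "w < 2 * 2 ^ h" using m that by (simp add: Bs_def)
  define m where "m = d div 4"
  define y where "y = d mod 4 div 2"
  have child: "child (Suc h) q d = (if even d
    then (left (Suc h) (s, a, e, fs, fe) m, X, V, Y, y)
    else (right (Suc h) (s, a, e, fs, fe) m, V, Y, X, (sg + y) mod 2))"
    by (simp add: q m_def y_def)
  have Zm: "m \<le> Z" "y \<le> Z" "y < 2" "(sg + y) mod 2 \<le> Z" and mB: "w < 2 * 2 ^ h \<Longrightarrow> m < B"
    using Z sg mB by (simp_all add: m_def y_def)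
  let ?P = "\<lambda>f'. f' 6 = w \<and> f' 9 = B \<and> f' 21 = f 21 mod cnt h \<and> f' 22 = cnt h \<and> f' 23 = 2 * 2 ^ h \<and>
    f' 24 = s \<and> f' 25 = a \<and> f' 26 = e \<and> f' 27 = of_bool fs \<and> f' 28 = of_bool fe \<and> f' 29 = X \<and>
    f' 30 = Y \<and> f' 31 = V \<and> f' 32 = sg \<and> f' 33 = d \<and> f' 34 = m \<and> f' 35 = y \<and>
    (\<forall>x<21. f' x = f x)"
  let ?Q = "\<lambda>st'. snd st' = \<tau> \<and> (\<forall>x<21. fst st' x = f x) \<and>
    fst st' 22 = cnt h \<and> fst st' 23 = 2 ^ h \<and> fst st' 21 = f 21 mod cnt h \<and>
    represents (fst st') (child (Suc h) q d) \<and> valid h (child (Suc h) q d)"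
  have last: "wp Z D (seqs [Cond (Var 33 [mod] Lit 2) descend_right descend_left, Assign 23 (Var 23 [div] Lit 2)])
    (f', \<tau>) (\<lambda>t st'. t \<le> 150 \<and> ?Q st')" if f': "?P f'" for f'
  proof (cases "even d")
    case True
    then have "d mod 2 = 0" by presburger
    then show ?thesis using True Z(6,9-) Z1 Zm v mB f'
      by (simp add: wp_simps descend_left_def child)
  next
    case False
    then have "d mod 2 = 1" by presburger
    moreover have "s + 2 ^ h + 2 ^ h \<le> iu + 2 ^ k" using v(3) by simp
    ultimately show ?thesis using False Z(6,7,9-) Z1 Zm v(1,2,4-) mB f'
      by (simp add: wp_simps descend_right_def child)
  qed
  have first: "wp Z D (Cond (Var 23 [-] Var 6) (Assign 34 (Var 9)) (Assign 34 (Lit 1))) (f, \<tau>)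
    (\<lambda>t st'. t \<le> 20 \<and> st' = (f(34 := Bs (Suc h)), \<tau>))"
    using f g Z Z1 by (simp add: wp_simps Bs_def)
  have mid: "wp Z D digit_com (f(34 := Bs (Suc h)), \<tau>) (\<lambda>t st'. t \<le> 80 \<and> ?P (fst st') \<and> snd st' = \<tau>)"
    using f(1) Z by (simp add: digit_com_def wp_simps c r g f(2) d_def[symmetric] m_def y_def del: cnt.simps)
  have rest: "wp Z D (Seq digit_com
     (seqs [Cond (Var 33 [mod] Lit 2) descend_right descend_left, Assign 23 (Var 23 [div] Lit 2)]))
     (f(34 := Bs (Suc h)), \<tau>) (\<lambda>t st'. t \<le> 230 \<and> ?Q st')"
  proof (rule wp_SeqI[OF mid])
    fix t1 :: nat and st1 assume 1: "t1 \<le> 80 \<and> ?P (fst st1) \<and> snd st1 = \<tau>"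
    then obtain f' where st1: "st1 = (f', \<tau>)" by (cases st1) auto
    show "wp Z D (seqs [Cond (Var 33 [mod] Lit 2) descend_right descend_left, Assign 23 (Var 23 [div] Lit 2)])
      st1 (\<lambda>t2 st'. t1 + t2 \<le> 230 \<and> ?Q st')"
      unfolding st1 by (rule wp_mono[OF last]) (use 1 st1 in auto)
  qed
  show ?thesis
    unfolding d_def[symmetric] descend_def seqs.simps(3)[of _ digit_com] seqs.simps(3)[of digit_com]
  proof (rule wp_SeqI[OF first], elim conjE, hypsubst)
    fix t1 :: nat assume "t1 \<le> 20"
    then show "wp Z D (Seq digit_com (seqs [Cond (Var 33 [mod] Lit 2) descend_right descend_left, Assign 23 (Var 23 [div] Lit 2)]))
     (f(34 := Bs (Suc h)), \<tau>) (\<lambda>t2 st'. t1 + t2 \<le> 250 \<and> ?Q st')"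
      by (intro wp_mono[OF rest]) auto
  qed
qed

text \<open>At most one entry of \<open>elem g i\<close> is nonzero, so a leaf needs just one query
  and one register update.\<close>

lemma leaf_eq:
  "leaf (g, X, Y, V, sg) i G = (if guard g i then
     G(Y := (G Y)(tgt g i mod (3 * w) := G Y (tgt g i mod (3 * w)) + (- 1) ^ sg *
       int (\<mu> ((fst g, src g i - w), (fst g + 1, tgt g i - w))) * G X (src g i mod (3 * w)))) else G)"
proof -
  let ?J = "src g i mod (3 * w)" and ?K = "tgt g i mod (3 * w)"
  let ?m = "int (\<mu> ((fst g, src g i - w), (fst g + 1, tgt g i - w)))"
  have "(\<Sum>z<3 * w. elem g i z c * G X z) = (\<Sum>z<3 * w. if z = ?J then
      (if guard g i \<and> c = ?K then ?m * G X ?J else 0) else 0)" for c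
    by (intro sum.cong) (auto simp: elem_def)
  then have "(\<Sum>z<3 * w. elem g i z c * G X z) = (if guard g i \<and> c = ?K then ?m * G X ?J else 0)" for c
    using w0 by simp
  then show ?thesis by (auto simp: add_image_def fun_eq_iff)
qed

lemma wp_leaf_body:
  assumes "glob f" and i: "f 21 < 9 * w" and "represents f q" "valid 0 q"
    and post: "\<And>t f'. t \<le> 120 * b + 600 \<Longrightarrow> \<forall>x<21. f' x = f x \<Longrightarrow> R t (f', tape_of (leaf q (f 21) G))"
  shows "wp Z D leaf_body (f, tape_of G) R"
proof -
  obtain s a e fs fe X Y V sg where q: "q = ((s, a, e, fs, fe), X, Y, V, sg)" by (cases q) auto
  let ?g = "(s, a, e, fs, fe)"
  define J where "J = src ?g (f 21)"
  define K where "K = tgt ?g (f 21)"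
  have g: "f 0 = n" "f 1 = p" "f 6 = w" "f 7 = 3 * w" "f 11 = b" "f 12 = 2 ^ b" "f 14 = \<alpha>"
    using \<open>glob f\<close> by (simp_all add: glob_def)
  have r: "f 24 = s" "f 25 = a" "f 26 = e" "f 27 = of_bool fs" "f 28 = of_bool fe"
    "f 29 = X" "f 30 = Y" "f 31 = V" "f 32 = sg"
    using \<open>represents f q\<close> by (simp_all add: q)
  have v: "a < B" "e < B" "s + 1 \<le> iu + 2 ^ k" "X < 3" "Y < 3" "X \<noteq> Y" "sg < 2"
    using \<open>valid 0 q\<close> by (simp_all add: q)
  have JK: "a * w + f 21 div 3 = J" "J + f 21 mod 3 - Suc 0 = K"
    by (simp_all add: J_def K_def src_def tgt_def)
  have aw: "a * w \<le> n"
  proof -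
    have "a \<le> n div w" using v(1) by (simp add: B_def)
    then have "a * w \<le> n div w * w" by simp
    also have "\<dots> \<le> n" by simp
    finally show ?thesis .
  qed
  have JZ: "J \<le> n + 3 * w" "K \<le> n + 3 * w + 1"
  proof -
    show "J \<le> n + 3 * w" using JK aw i by linarith
    moreover have "f 21 mod 3 < 3" by simp
    ultimately show "K \<le> n + 3 * w + 1" using JK by linarith
  qed
  have Z: "J \<le> Z" "K \<le> Z" "J - w \<le> Z" "K - w \<le> Z" "Suc s \<le> Z" using JZ v layers Zn by linarith+
  let ?f1 = "f(35 := J, 36 := K)"
  have guard: "ev guard_exp ?f1 \<noteq> 0 \<longleftrightarrow> guard ?g (f 21)"
    by (auto simp: guard_exp_def Let_def J_def[symmetric] K_def[symmetric] inner_def window_def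
      g r of_bool_def)
  have upd: "wp Z D leaf_update (?f1, tape_of G) (\<lambda>t. R (t0 + t))"
    if gd: "guard ?g (f 21)" and t0: "t0 \<le> 250" for t0
  proof -
    have in': "inner J" "inner K" using gd by (auto simp: Let_def J_def K_def)
    have "J \<le> K + 1" "K \<le> J + 1"
    proof -
      have "1 \<le> J" using in' w0 by (simp add: inner_def)
      then show "J \<le> K + 1" using JK by linarith
      have "f 21 mod 3 < 3" by simp
      then show "K \<le> J + 1" using JK by linarith
    qed
    then have "((s, J - w), (s + 1, K - w)) \<in> arcs (Grid n)"
      using in' v layers by (auto simp: Grid_simps grid_arcs_iff inner_def)
    then have D: "D [s, J - w, Suc s, K - w] = \<mu> ((s, J - w), (s + 1, K - w)) mod p"
      using weights by (auto simp: weight_oracle_def)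
    define m where "m = \<mu> ((s, J - w), (s + 1, K - w))"
    define c where "c = J mod (3 * w)"
    define c' where "c' = K mod (3 * w)"
    have c: "c < 3 * w" "c' < 3 * w" using w0 by (simp_all add: c_def c'_def)
    define x where "x = nat (G X c mod int p)"
    define \<delta> where "\<delta> = (- 1) ^ sg * int m * G X c"
    define \<delta>' where "\<delta>' = nat (\<delta> mod int p)"
    define y where "y = m mod p"
    have Dy: "D [s, J - w, Suc s, K - w] = y" using D by (simp add: y_def m_def)
    have DZ: "y \<le> Z" using bounds(5) p2 by (simp add: y_def)
    have xs: "X * (3 * w) + c \<le> Z" "Y * (3 * w) + c' \<le> Z"
    proof -
      have "9 * w \<le> Z" using cnt_mono[of 0] Zcnt by simp
      then show "X * (3 * w) + c \<le> Z" "Y * (3 * w) + c' \<le> Z"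
        using address[OF v(4) c(1)] address[OF v(5) c(2)] by linarith+
    qed
    have "int (y * x mod p) = int m * G X c mod int p"
      using p2 by (simp add: zmod_int mod_mult_eq y_def x_def)
    then have pos: "y * x mod p = nat (int m * G X c mod int p)" by linarith
    have "int ((p - y) mod p) = (- int y) mod int p" if "y < p" for y
    proof -
      have "int (p - y) = int p + (- int y)" using that by simp
      then show ?thesis by (simp add: zmod_int)
    qed
    from this[of "y * x mod p"]
    have "int ((p - y * x mod p) mod p) = (- (int m * G X c mod int p)) mod int p"
      using p2 \<open>int (y * x mod p) = int m * G X c mod int p\<close> by simp
    also have "\<dots> = (- (int m * G X c)) mod int p" by (rule mod_minus_eq)
    finally have neg: "(p - y * x mod p) mod p = nat (- (int m * G X c) mod int p)" by linarith
    have sgc: "sg = 0 \<or> sg = 1" using v by auto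
    have \<delta>: "(if sg \<noteq> 0 then (p - y * x mod p) mod p else y * x mod p) = \<delta>'"
      using sgc pos neg by (auto simp: \<delta>'_def \<delta>_def)
    have dz: "(p - y * x mod p) mod p \<le> Z" "y * x mod p \<le> Z" using bounds(5) p2 by simp_all
    let ?f2 = "?f1(38 := J - w, 39 := K - w, 40 := Suc s, 37 := y, 42 := X * (3 * w) + c)"
    have fin: "leaf q (f 21) G = G(Y := (G Y)(c' := G Y c' + \<delta>))"
      using gd by (simp add: q leaf_eq J_def[symmetric] K_def[symmetric] c_def c'_def \<delta>_def m_def del: leaf.simps)
    have "wp Z D get_val (?f2, tape_of G) (\<lambda>t1 st1. wp Z D (seqs [
      Cond (Var 32) (Assign 41 ((Var 1 [-] Var 37 [*] Var 43 [mod] Var 1) [mod] Var 1))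
       (Assign 41 (Var 37 [*] Var 43 [mod] Var 1)),
       Assign 42 (Var 30 [*] Var 7 [+] Var 36 [mod] Var 7), add_to]) st1 (\<lambda>t2. R (t0' + (t1 + t2))))"
      if t0': "t0' \<le> 320" for t0'
    proof (rule wp_get_val[where X = X and c = c])
      fix t1 f1 assume 1: "t1 \<le> 40 * b + 50" "\<forall>x<43. f1 x = ?f2 x" "f1 43 = nat (G X c mod int p)"
      let ?f3 = "f1(41 := \<delta>', 42 := Y * (3 * w) + c')"
      have 3: "wp Z D add_to (?f3, tape_of G) (\<lambda>t. R (t0' + (t1 + (t3 + t))))" if "t3 \<le> 50" for t3
      proof (rule wp_add_to[where X = Y and c = c' and \<delta> = \<delta>])
        fix t f' assume "t \<le> 80 * b + 120" "\<forall>x<43. f' x = ?f3 x"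
        then show "R (t0' + (t1 + (t3 + t))) (f', tape_of (G(Y := (G Y)(c' := G Y c' + \<delta>))))"
          unfolding fin[symmetric] using that t0' 1 by (intro post) auto
      qed (use 1 g v c in \<open>auto simp: \<delta>'_def\<close>)
      show "wp Z D (seqs [
      Cond (Var 32) (Assign 41 ((Var 1 [-] Var 37 [*] Var 43 [mod] Var 1) [mod] Var 1))
       (Assign 41 (Var 37 [*] Var 43 [mod] Var 1)),
       Assign 42 (Var 30 [*] Var 7 [+] Var 36 [mod] Var 7), add_to]) (f1, tape_of G) (\<lambda>t2. R (t0' + (t1 + t2)))"
      proof (cases "sg = 0")
        case True
        with 3[of "ecost (Var 32) + 1 + (ecost (Var 37 [*] Var 43 [mod] Var 1) + 2) + (ecost (Var 30 [*] Var 7 [+] Var 36 [mod] Var 7) + 2)"]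
        show ?thesis using 1[folded x_def] g r dz xs \<delta> by (simp add: wp_simps add.assoc c'_def[symmetric])
      next
        case False
        with 3[of "ecost (Var 32) + 3 + (ecost ((Var 1 [-] Var 37 [*] Var 43 [mod] Var 1) [mod] Var 1) + 2) + (ecost (Var 30 [*] Var 7 [+] Var 36 [mod] Var 7) + 2)"]
        show ?thesis using 1[folded x_def] g r dz xs \<delta> by (simp add: wp_simps add.assoc c'_def[symmetric])
      qed
    qed (use g v c in auto)
    from this[of "t0 + (ecost (Var 35 [-] Var 6) + 2 + (ecost (Var 36 [-] Var 6) + 2 + (ecost (Var 24 [+] Lit 1) + 2 + (1 +
       (ecost (Var 29 [*] Var 7 [+] Var 35 [mod] Var 7) + 2)))))"] show ?thesis
      using t0 g r Z Dy DZ xs by (simp add: leaf_update_def wp_simps add.assoc c_def)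
  qed
  have skip: "leaf q (f 21) G = G" if "\<not> guard ?g (f 21)"
    using that by (simp add: q leaf_eq del: leaf.simps)
  have "wp Z D (Cond guard_exp leaf_update (Assign 41 (Lit 0))) (?f1, tape_of G) (\<lambda>t. R (t0 + t))" if "t0 \<le> 30" for t0
  proof -
    have gc: "ecost guard_exp \<le> 200" by (simp add: guard_exp_def)
    show ?thesis
    proof (cases "guard ?g (f 21)")
      case True
      then show ?thesis using guard gc that upd[of "t0 + (ecost guard_exp + 3)"]
        by (simp add: wp_simps add.assoc del: guard.simps)
    next
      case False
      then show ?thesis using guard gc that post[of "t0 + (ecost guard_exp + 1 + (ecost (Lit 0) + 2))" "?f1(41 := 0)"] skip
        by (simp add: wp_simps add.assoc del: guard.simps)
    qed
  qed
  from this[of "ecost (Var 25 [*] Var 6 [+] Var 21 [div] Lit 3) + 2 + (ecost (Var 35 [+] Var 21 [mod] Lit 3 [-] Lit 1) + 2)"]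
  show ?thesis using g r Z JK by (simp add: leaf_body_def wp_simps add.assoc)
qed


definition root :: "nat \<Rightarrow> call" where
  "root sg = ((iu, ju div w, jv div w, True, True), 0, 1, 2, sg)"

lemma wp_leaf_com:
  assumes "glob f" and t: "f 20 = t0" "t0 < cnt k" and sg: "f 19 = sg" "sg < 2"
    and post: "\<And>t f'. t \<le> 120 * b + 260 * k + 900 \<Longrightarrow> \<forall>x<20. f' x = f x \<Longrightarrow> f' 20 = t0 + 1 \<Longrightarrow>
      R t (f', tape_of (case_prod leaf (decode k (root sg) t0) G))"
  shows "wp Z D leaf_com (f, tape_of G) R"
proof -
  have g: "f 0 = n" "f 1 = p" "f 2 = iu" "f 3 = ju" "f 5 = jv" "f 6 = w" "f 10 = 2 ^ k" "f 15 = cnt k"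
    using \<open>glob f\<close> by (simp_all add: glob_def)
  have Z: "iu \<le> Z" "ju div w \<le> Z" "jv div w \<le> Z" "2 ^ k \<le> Z" "cnt k \<le> Z" "t0 \<le> Z" "t0 + 1 \<le> Z" "Suc 0 \<le> Z" "2 \<le> Z" "sg \<le> Z"
    using layers Zn Zcnt t sg order_trans[OF div_le_dividend[of ju w]] ju order_trans[OF div_le_dividend[of jv w]] jv pow_le[of k]
    by auto
  have blocks: "ju div w < B" "jv div w < B"
    using ju jv by (simp_all add: B_def div_le_mono less_Suc_eq_le)
  define q where "q = decode k (root sg) t0"
  \<comment> \<open>The descent consumes one digit per round; the leaf \<open>q\<close> that the
    remaining digits lead to stays the same.\<close>
  let ?I = "\<lambda>i st. snd st = tape_of G \<and> (\<forall>x<21. fst st x = f x) \<and> fst st 22 = cnt (k - i) \<and>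
    fst st 23 = 2 ^ (k - i) \<and> fst st 21 < cnt (k - i) \<and>
    (\<exists>c. represents (fst st) c \<and> valid (k - i) c \<and> decode (k - i) c (fst st 21) = q)"
  have "wp Z D leaf_init (f, tape_of G) (\<lambda>t st. t \<le> 60 \<and> snd st = tape_of G \<and> (\<forall>x<21. fst st x = f x) \<and>
    fst st 22 = cnt k \<and> fst st 23 = 2 ^ k \<and> fst st 21 = t0 \<and> represents (fst st) (root sg))"
    using g t sg Z by (simp add: leaf_init_def wp_simps root_def)
  then have init: "wp Z D leaf_init (f, tape_of G) (\<lambda>t st. t \<le> 60 \<and> ?I 0 st)"
  proof (rule wp_mono, elim conjE, intro conjI)
    fix t' st assume 1: "fst st 21 = t0" "represents (fst st) (root sg)"
    have "valid k (root sg)" using blocks sg by (simp add: root_def)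
    then show "\<exists>c. represents (fst st) c \<and> valid (k - 0) c \<and> decode (k - 0) c (fst st 21) = q"
      using 1 by (intro exI[of _ "root sg"]) (simp add: q_def)
  qed (use t in simp_all)
  have loop: "wp Z D (While (Var 23 [-] Lit 1) descend) st
    (\<lambda>t st'. t \<le> k * 260 + 10 \<and> ?I k st')" if "?I 0 st" for st
  proof (rule wp_While[where N = k and T = 250 and I = ?I])
    fix i st assume i: "i < k" and I: "?I i st"
    then obtain c where c: "represents (fst st) c" "valid (k - i) c" "decode (k - i) c (fst st 21) = q" by blast
    define h where "h = k - Suc i"
    have h: "k - i = Suc h" "Suc h \<le> k" using i by (auto simp: h_def)
    obtain f1 where st: "st = (f1, tape_of G)" using I by (cases st) auto
    have f1: "\<forall>x<21. f1 x = f x" "f1 22 = cnt (Suc h)" "f1 23 = 2 ^ Suc h" "f1 21 < cnt (Suc h)"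
      using I unfolding st h(1) by auto
    have "glob f1" using glob_cong[OF \<open>glob f\<close>] f1(1) by simp
    from wp_descend[OF this f1(2-4) c(1)[unfolded st fst_conv] c(2)[unfolded h(1)] h(2)]
    have "wp Z D descend st (\<lambda>t st'. t \<le> 250 \<and> ?I (Suc i) st')"
      unfolding st h_def[symmetric]
    proof (rule wp_mono, elim conjE, intro conjI)
      fix t st' assume r: "fst st' 21 = f1 21 mod cnt h" "represents (fst st') (child (Suc h) c (f1 21 div cnt h))"
        "valid h (child (Suc h) c (f1 21 div cnt h))"
      show "fst st' 21 < cnt h" using r cnt_pos[of h] by simp
      show "\<exists>c. represents (fst st') c \<and> valid h c \<and> decode h c (fst st' 21) = q"
        using r c(3)[unfolded st fst_conv h(1)] by (intro exI[of _ "child (Suc h) c (f1 21 div cnt h)"]) simp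
    qed (use f1 in auto)
    moreover have "Suc 0 < 2 * 2 ^ h"
      by (metis One_nat_def one_less_numeral_iff one_less_power power_Suc semiring_norm(76) zero_less_Suc)
    ultimately show "ev (Var 23 [-] Lit 1) (fst st) \<noteq> 0 \<and> wp Z D descend st (\<lambda>t st'. t \<le> 250 \<and> ?I (Suc i) st')"
      using f1 by (simp add: st)
  qed (use that in auto)
  show ?thesis unfolding leaf_com_def seqs.simps wp_simps
  proof (rule wp_mono[OF init])
    fix t1 :: nat and st1 assume 1: "t1 \<le> 60 \<and> ?I 0 st1"
    obtain f1 \<tau>1 where st1: "st1 = (f1, \<tau>1)" by (cases st1)
    show "wp Z D (Seq (While (Var 23 [-] Lit 1) descend) (Seq leaf_body (Assign 20 (Var 20 [+] Lit 1)))) st1 (\<lambda>t2. R (t1 + t2))"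
      unfolding st1 wp_simps
    proof (rule wp_mono[OF loop[OF conjunct2[OF 1[unfolded st1]]]])
      fix t2 :: nat and st2 assume 2: "t2 \<le> k * 260 + 10 \<and> ?I k st2"
      obtain f2 where st2: "st2 = (f2, tape_of G)" using 2 by (cases st2) auto
      obtain c where c: "represents f2 c" "valid 0 c" "decode 0 c (f2 21) = q" using 2 st2 by auto
      have f2: "\<forall>x<21. f2 x = f x" "f2 21 < 9 * w" using 2 st2 by auto
      have "glob f2" using glob_cong[OF \<open>glob f\<close>] f2(1) by simp
      then show "wp Z D (Seq leaf_body (Assign 20 (Var 20 [+] Lit 1))) st2 (\<lambda>t. R (t1 + (t2 + t)))"
        unfolding st2 wp_simps
      proof (rule wp_leaf_body[OF _ f2(2) c(1,2)])
        fix t3 :: nat and f3 assume 3: "t3 \<le> 120 * b + 600" "\<forall>x<21. f3 x = f2 x"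
        have "f3 20 = t0" using 3 f2 t by simp
        moreover have "leaf c (f2 21) G = case_prod leaf (decode k (root sg) t0) G"
          unfolding q_def[symmetric] c(3)[symmetric] by (simp del: leaf.simps)
        ultimately show "wp Z D (Assign 20 (Var 20 [+] Lit 1)) (f3, tape_of (leaf c (f2 21) G)) (\<lambda>t. R (t1 + (t2 + (t3 + t))))"
          using Z 1 2 3 f2 by (simp add: wp_simps) (intro post; simp)
      qed
    qed
  qed
qed

lemma wp_run_com:
  assumes "glob f" and sg: "f 19 = sg" "sg < 2"
    and post: "\<And>t f'. t \<le> cnt k * (120 * b + 260 * k + 920) + 20 \<Longrightarrow> \<forall>x<20. f' x = f x \<Longrightarrow>
      R t (f', tape_of (tree k (root sg) G))"
  shows "wp Z D run_com (f, tape_of G) R"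
proof -
  let ?L = "\<lambda>t. case_prod leaf (decode k (root sg) t)"
  let ?I = "\<lambda>i st. snd st = tape_of (fold ?L [0..<i] G) \<and> (\<forall>x<20. fst st x = f x) \<and> fst st 20 = i"
  have "wp Z D (While (Var 15 [-] Var 20) leaf_com) (f(20 := 0), tape_of G) (\<lambda>t. R (3 + t))"
  proof (rule wp_While[where N = "cnt k" and T = "120 * b + 260 * k + 900" and I = ?I])
    fix i st assume i: "i < cnt k" and I: "?I i st"
    obtain f1 where st: "st = (f1, tape_of (fold ?L [0..<i] G))" using I by (cases st) auto
    have f1: "\<forall>x<20. f1 x = f x" "f1 20 = i" using I st by auto
    have "glob f1" using glob_cong[OF \<open>glob f\<close>] f1(1) by simp
    then have "wp Z D leaf_com st (\<lambda>t st'. t \<le> 120 * b + 260 * k + 900 \<and> ?I (Suc i) st')"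
      unfolding st using f1 i sg by (intro wp_leaf_com[where sg = sg and ?t0.0 = i]) auto
    moreover have "f1 15 = cnt k" using \<open>glob f1\<close> by (simp add: glob_def)
    ultimately show "ev (Var 15 [-] Var 20) (fst st) \<noteq> 0 \<and>
      wp Z D leaf_com st (\<lambda>t st'. t \<le> 120 * b + 260 * k + 900 \<and> ?I (Suc i) st')"
      using i f1 by (simp add: st)
  next
    fix t st assume "t \<le> cnt k * (120 * b + 260 * k + 900 + ecost (Var 15 [-] Var 20) + 3) + ecost (Var 15 [-] Var 20) + 1" "?I (cnt k) st"
    then show "R (3 + t) st"
      using post[of "3 + t" "fst st"] by (cases st) (simp add: tree_flat algebra_simps)
  qed (use \<open>glob f\<close> in \<open>auto simp: glob_def\<close>)
  then show ?thesis by (simp add: run_com_def wp_simps numeral_3_eq_3)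
qed

end

section \<open>Extraction of one matrix entry and restoration of the tape\<close>

definition pass_com :: com where
  "pass_com = seqs [seqs [Assign 42 (Var 7 [+] (Var 5 [+] Var 6) [mod] Var 7), get_val],
     seqs [Assign 17 (Var 43), Assign 19 (Lit 0), run_com],
     seqs [Assign 42 (Var 7 [+] (Var 5 [+] Var 6) [mod] Var 7), get_val],
     seqs [Assign 18 (Var 43), Assign 19 (Lit 1), run_com]]"

text \<open>The source register holds an unknown vector, so one pass only yields the image of that
  vector. The first pass runs with 1 added to cell \<open>cu\<close>, the second without; by
  linearity the difference of their results is the entry \<open>M cu cv\<close>.\<close>

definition main_com :: com where
  "main_com = seqs [
     seqs [Assign 42 ((Var 3 [+] Var 6) [mod] Var 7), Assign 41 (Lit 1 [mod] Var 1), add_to],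
     pass_com, Assign 16 ((Var 18 [+] Var 1 [-] Var 17) [mod] Var 1),
     seqs [Assign 42 ((Var 3 [+] Var 6) [mod] Var 7), Assign 41 (Var 1 [-] Lit 1), add_to],
     pass_com, Assign 0 ((Var 16 [+] Var 17 [+] (Var 1 [-] Var 18)) [mod] Var 1)]"

context machine
begin

definition cu :: nat where "cu = (ju + w) mod (3 * w)"
definition cv :: nat where "cv = (jv + w) mod (3 * w)"

lemma cells: "cu < 3 * w" "cv < 3 * w" using w0 by (simp_all add: cu_def cv_def)

abbreviation M :: "nat \<Rightarrow> nat \<Rightarrow> int" where
  "M \<equiv> mat k (iu, ju div w, jv div w, True, True)"

definition image :: "regs \<Rightarrow> int" where
  "image G = (\<Sum>z<3 * w. M z cv * G 0 z)"

lemma M_path_sum: "M cu cv = int (path_sum (Grid n) \<mu> (iu, ju) (iu + 2 ^ k, jv))"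
proof -
  have *: "(ju + w) div w = ju div w + 1" "(jv + w) div w = jv div w + 1" using w0 by simp_all
  have "ju div w < B" using ju by (simp add: B_def div_le_mono less_Suc_eq_le)
  from mat_block[OF *(1) this *(2), of k iu] show ?thesis
    using path_sum_Grid[OF w0 layers ju jv, of \<mu>] by (simp add: cu_def cv_def)
qed

lemma tree_root: "tree k (root sg) G = add_image (3 * w) 0 1 M ((- 1) ^ sg) G"
  unfolding root_def by (rule tree_eq) auto

definition run_time :: nat where "run_time = cnt k * (120 * b + 260 * k + 920) + 20"

text \<open>The target cell is read before and after the image is added, and the same loop with the
  opposite sign then undoes the addition by \<open>add_image_inverse\<close>. The caller subtracts
  the two values.\<close>

lemma wp_pass_com:
  assumes "glob f"
    and post: "\<And>t f'. t \<le> 2 * run_time + 80 * b + 200 \<Longrightarrow> \<forall>x<17. f' x = f x \<Longrightarrow>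
      f' 17 = nat (G 1 cv mod int p) \<Longrightarrow> f' 18 = nat ((G 1 cv + image G) mod int p) \<Longrightarrow> R t (f', tape_of G)"
  shows "wp Z D pass_com (f, tape_of G) R"
proof -
  let ?y0 = "nat (G 1 cv mod int p)" and ?y1 = "nat ((G 1 cv + image G) mod int p)"
  let ?G1 = "tree k (root 0) G"
  have G2: "tree k (root 1) ?G1 = G"
    unfolding tree_root using add_image_inverse[of 0 1 "3 * w" M 1 G] by simp
  have G1: "?G1 1 cv = G 1 cv + image G"
    unfolding tree_root by (simp add: add_image_def image_def)
  have "?y0 < p" "?y1 < p" by (rule residue_less)+
  then have Z: "?y0 \<le> Z" "?y1 \<le> Z" using bounds(5) by blast+
  have Zr: "3 * w + cv \<le> Z" "Suc 0 \<le> Z"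
  proof -
    have "9 * w \<le> Z" using cnt_mono[of 0] Zcnt by simp
    then show "3 * w + cv \<le> Z" using cells(2) by linarith
    show "Suc 0 \<le> Z" using Zn by linarith
  qed
  have g: "f 0 = n" "f 1 = p" "f 2 = iu" "f 3 = ju" "f 5 = jv" "f 6 = w" "f 7 = 3 * w" "f 11 = b" "f 12 = 2 ^ b" "f 14 = \<alpha>"
    using \<open>glob f\<close> by (simp_all add: glob_def)
  define c1 where "c1 = seqs [Assign 42 (Var 7 [+] (Var 5 [+] Var 6) [mod] Var 7), get_val]"
  define c2 where "c2 = seqs [Assign 17 (Var 43), Assign 19 (Lit 0), run_com]"
  define c3 where "c3 = seqs [Assign 18 (Var 43), Assign 19 (Lit 1), run_com]"
  have val: "wp Z D c1 (f1, tape_of H) (\<lambda>t st. t \<le> 40 * b + 70 \<and>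
      (\<exists>f'. st = (f', tape_of H) \<and> (\<forall>x<42. f' x = f1 x) \<and> f' 43 = nat (H 1 cv mod int p)))"
    if "\<forall>x<16. f1 x = f x" for f1 H
  proof -
    have "wp Z D get_val (f1(42 := 3 * w + cv), tape_of H) (\<lambda>t st. t0 + t \<le> 40 * b + 70 \<and>
      (\<exists>f'. st = (f', tape_of H) \<and> (\<forall>x<42. f' x = f1 x) \<and> f' 43 = nat (H 1 cv mod int p)))"
      if "t0 \<le> 20" for t0
      by (rule wp_get_val[where X = 1 and c = cv])
        (use \<open>\<forall>x<16. f1 x = f x\<close> g cells that in auto)
    from this[of "ecost (Var 7 [+] (Var 5 [+] Var 6) [mod] Var 7) + 2"]
    show ?thesis using that g Zr by (simp add: c1_def wp_simps cv_def)
  qed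
  have r2: "wp Z D c2 (f1, tape_of G) (\<lambda>t st. t \<le> run_time + 20 \<and>
      (\<exists>f'. st = (f', tape_of ?G1) \<and> (\<forall>x<17. f' x = f1 x) \<and> f' 17 = f1 43))"
    if f1: "\<forall>x<16. f1 x = f x" "f1 43 = ?y0" for f1
  proof -
    have gl: "glob (f1(17 := ?y0, 19 := 0))" using f1(1) by (intro glob_cong[OF \<open>glob f\<close>]) auto
    have "wp Z D run_com (f1(17 := ?y0, 19 := 0), tape_of G) (\<lambda>t st. t0 + t \<le> run_time + 20 \<and>
      (\<exists>f'. st = (f', tape_of ?G1) \<and> (\<forall>x<17. f' x = f1 x) \<and> f' 17 = f1 43))" if "t0 \<le> 10" for t0
      by (rule wp_run_com[OF gl, where sg = 0]) (use f1 that in \<open>auto simp: run_time_def\<close>)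
    from this[of "4 + 3"] show ?thesis using f1(2) Z by (simp add: c2_def wp_simps add.assoc)
  qed
  have r3: "wp Z D c3 (f1, tape_of ?G1) (\<lambda>t st. t \<le> run_time + 20 \<and>
      (\<exists>f'. st = (f', tape_of G) \<and> (\<forall>x<18. f' x = f1 x) \<and> f' 18 = f1 43))"
    if f1: "\<forall>x<16. f1 x = f x" "f1 43 = ?y1" for f1
  proof -
    have gl: "glob (f1(18 := ?y1, 19 := 1))" using f1(1) by (intro glob_cong[OF \<open>glob f\<close>]) auto
    have "wp Z D run_com (f1(18 := ?y1, 19 := 1), tape_of ?G1) (\<lambda>t st. t0 + t \<le> run_time + 20 \<and>
      (\<exists>f'. st = (f', tape_of G) \<and> (\<forall>x<18. f' x = f1 x) \<and> f' 18 = f1 43))" if "t0 \<le> 10" for t0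
      by (rule wp_run_com[OF gl, where sg = 1]) (use f1 that G2 in \<open>auto simp: run_time_def\<close>)
    from this[of "4 + 3"] show ?thesis using f1(2) Z Zr by (simp add: c3_def wp_simps add.assoc)
  qed
  have "wp Z D (Seq c1 (Seq c2 (Seq c1 c3))) (f, tape_of G) R"
  proof (rule wp_SeqI[OF val], simp, elim conjE exE, hypsubst)
    fix t1 :: nat and f1 assume 1: "t1 \<le> 40 * b + 70" "\<forall>x<42. f1 x = f x" "f1 43 = ?y0"
    then have a1: "\<forall>x<16. f1 x = f x" by simp
    show "wp Z D (Seq c2 (Seq c1 c3)) (f1, tape_of G) (\<lambda>t. R (t1 + t))"
    proof (rule wp_SeqI[OF r2[OF a1 1(3)]], elim conjE exE, hypsubst)
      fix t2 :: nat and f2 assume 2: "t2 \<le> run_time + 20" "\<forall>x<17. f2 x = f1 x" "f2 17 = f1 43"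
      then have a2: "\<forall>x<16. f2 x = f x" using a1 by simp
      show "wp Z D (Seq c1 c3) (f2, tape_of ?G1) (\<lambda>t. R (t1 + (t2 + t)))"
      proof (rule wp_SeqI[OF val[OF a2]], elim conjE exE, hypsubst)
        fix t3 :: nat and f3 assume 3: "t3 \<le> 40 * b + 70" "\<forall>x<42. f3 x = f2 x" "f3 43 = nat (?G1 1 cv mod int p)"
        then have a3: "\<forall>x<16. f3 x = f x" using a2 by simp
        show "wp Z D c3 (f3, tape_of ?G1) (\<lambda>t. R (t1 + (t2 + (t3 + t))))"
        proof (rule wp_mono[OF r3[OF a3 3(3)[unfolded G1]]], elim conjE exE, hypsubst)
          fix t4 :: nat and f4 assume 4: "t4 \<le> run_time + 20" "\<forall>x<18. f4 x = f3 x" "f4 18 = f3 43"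
          show "R (t1 + (t2 + (t3 + t4))) (f4, tape_of G)"
          proof (rule post)
            show "\<forall>x<17. f4 x = f x" using 1 2 3 4 by simp
            show "f4 17 = ?y0" using 1 2 3 4 by simp
            show "f4 18 = ?y1" using 3 4 G1 by simp
          qed (use 1 2 3 4 in linarith)
        qed
      qed
    qed
  qed
  then show ?thesis
    unfolding c1_def c2_def c3_def pass_com_def seqs.simps .
qed

lemma wp_main_com:
  assumes "glob f"
    and post: "\<And>t f'. t \<le> 4 * run_time + 400 * b + 1000 \<Longrightarrow>
      f' 0 = path_sum (Grid n) \<mu> (iu, ju) (iu + 2 ^ k, jv) mod p \<Longrightarrow> R t (f', tape_of G)"
  shows "wp Z D main_com (f, tape_of G) R"
proof -
  have g: "f 0 = n" "f 1 = p" "f 2 = iu" "f 3 = ju" "f 5 = jv" "f 6 = w" "f 7 = 3 * w" "f 11 = b" "f 12 = 2 ^ b" "f 14 = \<alpha>"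
    using \<open>glob f\<close> by (simp_all add: glob_def)
  define c1 where "c1 = seqs [Assign 42 ((Var 3 [+] Var 6) [mod] Var 7), Assign 41 (Lit 1 [mod] Var 1), add_to]"
  define c2 where "c2 = seqs [Assign 42 ((Var 3 [+] Var 6) [mod] Var 7), Assign 41 (Var 1 [-] Lit 1), add_to]"
  define e1 where "e1 = Assign 16 ((Var 18 [+] Var 1 [-] Var 17) [mod] Var 1)"
  define e2 where "e2 = Assign 0 ((Var 16 [+] Var 17 [+] (Var 1 [-] Var 18)) [mod] Var 1)"
  define G1 where "G1 = G(0 := (G 0)(cu := G 0 cu + 1))"
  have G2: "G1(0 := (G1 0)(cu := G1 0 cu + - 1)) = G" by (simp add: G1_def)
  have img: "image G1 = image G + M cu cv"
  proof -
    have "image G1 = (\<Sum>z<3 * w. M z cv * G 0 z + (if z = cu then M cu cv else 0))"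
      unfolding image_def by (intro sum.cong) (auto simp: G1_def algebra_simps)
    then show ?thesis using cells by (simp add: sum.distrib image_def)
  qed
  have G11: "G1 1 cv = G 1 cv" by (simp add: G1_def)
  let ?y0 = "nat (G 1 cv mod int p)" and ?y1 = "nat ((G 1 cv + image G1) mod int p)"
    and ?y2 = "nat ((G 1 cv + image G) mod int p)"
  have y: "?y0 < p" "?y1 < p" "?y2 < p" by (rule residue_less)+
  have cuZ: "cu \<le> Z" "1 \<le> Z"
  proof -
    have "9 * w \<le> Z" using cnt_mono[of 0] Zcnt by simp
    then show "cu \<le> Z" using cells(1) by linarith
    show "1 \<le> Z" using Zn by linarith
  qed
  have add1: "wp Z D c1 (f, tape_of G) (\<lambda>t st. t \<le> 80 * b + 150 \<and>
      (\<exists>f'. st = (f', tape_of G1) \<and> (\<forall>x<41. f' x = f x)))"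
  proof -
    have "wp Z D add_to (f(42 := cu, 41 := 1 mod p), tape_of G) (\<lambda>t st. t0 + t \<le> 80 * b + 150 \<and>
      (\<exists>f'. st = (f', tape_of G1) \<and> (\<forall>x<41. f' x = f x)))" if "t0 \<le> 30" for t0
      unfolding G1_def
      by (rule wp_add_to[where X = 0 and c = cu and \<delta> = 1]) (use g cells that p2 in \<open>auto\<close>)
    from this[of "ecost ((Var 3 [+] Var 6) [mod] Var 7) + 2 + (ecost (Lit 1 [mod] Var 1) + 2)"]
    show ?thesis using g cuZ p2 by (simp add: c1_def wp_simps cu_def)
  qed
  have add2: "wp Z D c2 (f1, tape_of G1) (\<lambda>t st. t \<le> 80 * b + 150 \<and>
      (\<exists>f'. st = (f', tape_of G) \<and> (\<forall>x<41. f' x = f1 x)))" if f1: "\<forall>x<16. f1 x = f x" for f1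
  proof -
    have d: "nat (- 1 mod int p) = p - 1" using p2 by (simp add: zmod_minus1)
    have "wp Z D add_to (f1(42 := cu, 41 := p - 1), tape_of G1) (\<lambda>t st. t0 + t \<le> 80 * b + 150 \<and>
      (\<exists>f'. st = (f', tape_of (G1(0 := (G1 0)(cu := G1 0 cu + - 1)))) \<and> (\<forall>x<41. f' x = f1 x)))" if "t0 \<le> 30" for t0
      by (rule wp_add_to[where X = 0 and c = cu and \<delta> = "- 1"]) (use g cells that f1 d in \<open>auto\<close>)
    from this[of "ecost ((Var 3 [+] Var 6) [mod] Var 7) + 2 + (ecost (Var 1 [-] Lit 1) + 2)"]
    show ?thesis unfolding G2 using g cuZ f1 bounds(2) by (simp add: c2_def wp_simps cu_def)
  qed
  have pZ: "(?y1 + p - ?y0) mod p \<le> Z" using bounds(5) p2 by simp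
  \<comment> \<open>Since subtraction truncates, \<open>p\<close> is added before each difference.
    The initial value \<open>?y0\<close> cancels between the passes, and the surplus
    \<open>2 * p\<close> vanishes modulo \<open>p\<close>.\<close>
  have final: "((?y1 + p - ?y0) mod p + ?y0 + (p - ?y2)) mod p = path_sum (Grid n) \<mu> (iu, ju) (iu + 2 ^ k, jv) mod p"
  proof -
    let ?A = "G 1 cv + image G1" and ?B = "G 1 cv + image G"
    have "((?y1 + p - ?y0) mod p + ?y0 + (p - ?y2)) mod p = (?y1 + p - ?y0 + ?y0 + (p - ?y2)) mod p"
      by (simp add: mod_add_left_eq add.assoc)
    then have "int (((?y1 + p - ?y0) mod p + ?y0 + (p - ?y2)) mod p) = (?A mod int p - ?B mod int p + int p * 2) mod int p"
      using y p2 by (simp add: zmod_int of_nat_diff algebra_simps)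
    also have "\<dots> = (?A mod int p - ?B mod int p) mod int p" by (rule mod_mult_self2)
    also have "\<dots> = (?A - ?B) mod int p" by (rule mod_diff_eq)
    also have "\<dots> = M cu cv mod int p" unfolding img by simp
    finally show ?thesis unfolding M_path_sum by (simp flip: zmod_int)
  qed
  have "wp Z D (Seq c1 (Seq pass_com (Seq e1 (Seq c2 (Seq pass_com e2))))) (f, tape_of G) R"
  proof (rule wp_SeqI[OF add1], elim conjE exE, hypsubst)
    fix t1 :: nat and f1 assume 1: "t1 \<le> 80 * b + 150" "\<forall>x<41. f1 x = f x"
    have "glob f1" by (rule glob_cong[OF \<open>glob f\<close>]) (use 1 in simp)
    then show "wp Z D (Seq pass_com (Seq e1 (Seq c2 (Seq pass_com e2)))) (f1, tape_of G1) (\<lambda>t. R (t1 + t))"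
      unfolding wp_simps
    proof (rule wp_pass_com)
      fix t2 :: nat and f2 assume 2: "t2 \<le> 2 * run_time + 80 * b + 200" "\<forall>x<17. f2 x = f1 x"
        "f2 17 = nat (G1 1 cv mod int p)" "f2 18 = nat ((G1 1 cv + image G1) mod int p)"
      let ?f2 = "f2(16 := (?y1 + p - ?y0) mod p)"
      have a2: "\<forall>x<16. ?f2 x = f x" using 1 2 by simp
      have "wp Z D (Seq c2 (Seq pass_com e2)) (?f2, tape_of G1) (\<lambda>t. R (t1 + (t2 + (t3 + t))))" if t3: "t3 \<le> 15" for t3
      proof (rule wp_SeqI[OF add2[OF a2]], elim conjE exE, hypsubst)
        fix t4 :: nat and f4 assume 4: "t4 \<le> 80 * b + 150" "\<forall>x<41. f4 x = ?f2 x"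
        have "glob f4" by (rule glob_cong[OF \<open>glob f\<close>]) (use a2 4 in simp)
        then show "wp Z D (Seq pass_com e2) (f4, tape_of G) (\<lambda>t. R (t1 + (t2 + (t3 + (t4 + t)))))"
          unfolding wp_simps
        proof (rule wp_pass_com)
          fix t5 :: nat and f5 assume 5: "t5 \<le> 2 * run_time + 80 * b + 200" "\<forall>x<17. f5 x = f4 x"
            "f5 17 = nat (G 1 cv mod int p)" "f5 18 = nat ((G 1 cv + image G) mod int p)"
          have f5: "f5 16 = (?y1 + p - ?y0) mod p" "f5 1 = p" using 5 4 a2 g by auto
          have pos: "path_sum (Grid n) \<mu> (iu, ju) (iu + 2 ^ k, jv) mod p \<le> Z" using bounds(5) p2 by simp
          have "R (t1 + (t2 + (t3 + (t4 + (t5 + t6))))) (f5(0 := path_sum (Grid n) \<mu> (iu, ju) (iu + 2 ^ k, jv) mod p), tape_of G)"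
            if "t6 \<le> 20" for t6
            by (rule post) (use that t3 1 2 4 5 in auto)
          then show "wp Z D e2 (f5, tape_of G) (\<lambda>t. R (t1 + (t2 + (t3 + (t4 + (t5 + t))))))"
            using f5 5 final pos by (simp add: e2_def wp_simps)
        qed
      qed
      from this[of "ecost ((Var 18 [+] Var 1 [-] Var 17) [mod] Var 1) + 2"]
      show "wp Z D (Seq e1 (Seq c2 (Seq pass_com e2))) (f2, tape_of G1) (\<lambda>t. R (t1 + (t2 + t)))"
        using 1 2 g pZ by (subst wp_simps(5)) (simp add: e1_def wp_simps(1) G11[simplified])
    qed
  qed
  then show ?thesis
    unfolding c1_def c2_def e1_def e2_def main_com_def seqs.simps .
qed

end

section \<open>Choice of the parameters\<close>

definition sizes_com :: com where
  "sizes_com = seqs [Assign 6 (Var 0 [div] Var 18 [+] Lit 1), Assign 7 (Lit 3 [*] Var 6), Assign 8 (Lit 9 [*] Var 6),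
       Assign 9 (Var 0 [div] Var 6 [+] Lit 1), Assign 10 (Var 4 [-] Var 2)]"

text \<open>The first loop counts the binary digits of \<open>n\<close>, the second finds the
  largest \<open>g\<close> with \<open>d * g * g\<close> at most that number. The literal
  \<open>d\<close> is the only place where the program depends on \<epsilon>.\<close>

definition width_com :: "nat \<Rightarrow> com" where
  "width_com d = seqs [
     seqs [Assign 43 (Var 0), Assign 16 (Lit 0)],
     While (Var 43) (seqs [Assign 43 (Var 43 [div] Lit 2), Assign 16 (Var 16 [+] Lit 1)]),
     seqs [Assign 17 (Lit 0), Assign 18 (Lit 1)],
     While (Lit d [*] ((Var 17 [+] Lit 1) [*] (Var 17 [+] Lit 1)) [\<le>] Var 16)
       (seqs [Assign 17 (Var 17 [+] Lit 1), Assign 18 (Lit 2 [*] Var 18)]),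
     sizes_com]"

text \<open>The threshold \<open>(9 * w + 2) * p\<close> is what \<open>good_offset\<close> demands
  for \<open>9 * w\<close> registers.\<close>

definition bits_com :: com where
  "bits_com = seqs [seqs [Assign 11 (Lit 0), Assign 12 (Lit 1)],
     While (Var 12 [+] Lit 1 [\<le>] (Var 8 [+] Lit 2) [*] Var 1)
       (seqs [Assign 12 (Lit 2 [*] Var 12), Assign 11 (Var 11 [+] Lit 1)]),
     Assign 13 (Var 1 [*] (Var 12 [div] Var 1))]"

definition scan_step :: com where
  "scan_step = seqs [read_reg,
     Cond (Var 13 [\<le>] (Var 43 [+] Var 14) [mod] Var 12) (Assign 19 (Lit 1)) (Assign 43 (Lit 0)),
     Assign 42 (Var 42 [+] Lit 1)]"

definition scan_com :: com where
  "scan_com = seqs [seqs [Assign 14 (Var 14 [+] Var 1), Assign 19 (Lit 0), Assign 42 (Lit 0)],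
     While (Var 8 [-] Var 42) scan_step]"

text \<open>A linear search through the multiples of \<open>p\<close>, with a scan of all registers
  for each. By \<open>good_offset\<close> at most \<open>9 * w + 1\<close> scans occur, so the
  search stays roughly quadratic in \<open>w\<close> and does not dominate the main loop.\<close>

definition offset_com :: com where
  "offset_com = seqs [seqs [Assign 14 (Lit 0), Assign 19 (Lit 1)], While (Var 19) scan_com]"

definition count_com :: com where
  "count_com = seqs [seqs [Assign 15 (Var 8), Assign 20 (Lit 1)],
     While (Var 10 [-] Var 20) (seqs [Assign 20 (Lit 2 [*] Var 20),
       Cond (Var 20 [-] Var 6) (Assign 15 (Var 15 [*] (Lit 4 [*] Var 9))) (Assign 15 (Var 15 [*] Lit 4))])]"

definition algorithm :: "nat \<Rightarrow> com" where
  "algorithm d = seqs [width_com d, bits_com, offset_com, count_com, main_com]"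

section \<open>The parameters as functions of the input, and the programs that compute them\<close>

definition depth :: "nat \<Rightarrow> nat \<Rightarrow> nat" where
  "depth d n = floor_sqrt (floorlog 2 n div d)"

text \<open>The added 1 gives \<open>n < w * 2 ^ g\<close> with \<open>g\<close> the depth, so that
  there are at most \<open>2 ^ g\<close> blocks.\<close>

definition width :: "nat \<Rightarrow> nat \<Rightarrow> nat" where
  "width d n = n div 2 ^ depth d n + 1"

definition bits :: "nat \<Rightarrow> nat \<Rightarrow> nat \<Rightarrow> nat" where
  "bits d n p = (LEAST b. (9 * width d n + 2) * p \<le> 2 ^ b)"

lemma bits_le: "(9 * width d n + 2) * p \<le> 2 ^ bits d n p"
  unfolding bits_def by (rule LeastI_ex) (metis less_exp less_imp_le)

lemma bits_gt: "b < bits d n p \<Longrightarrow> 2 ^ b < (9 * width d n + 2) * p"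
  unfolding bits_def using not_less_Least not_le by blast

lemma le_depth_iff: "0 < d \<Longrightarrow> g \<le> depth d n \<longleftrightarrow> d * (g * g) \<le> floorlog 2 n"
  unfolding depth_def by (simp add: le_floor_sqrt_iff power2_eq_square less_eq_div_iff_mult_less_eq mult.commute)

lemma depth_le: "0 < d \<Longrightarrow> depth d n \<le> floorlog 2 n"
proof -
  assume d: "0 < d"
  have "depth d n \<le> depth d n * depth d n" by (rule le_square)
  also have "\<dots> \<le> d * (depth d n * depth d n)" using d by simp
  also have "\<dots> \<le> floorlog 2 n" using le_depth_iff[OF d, of "depth d n" n] by simp
  finally show ?thesis .
qed

lemma wp_width_com:
  assumes d: "0 < d" and f: "f 0 = n" "f 2 = iu" "f 4 = iv"
    and Z: "9 * n + 20 \<le> Z" "iv \<le> n"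
    and post: "\<And>t f'. t \<le> 100 * floorlog 2 n + 200 \<Longrightarrow> \<forall>x<6. f' x = f x \<Longrightarrow>
      f' 6 = width d n \<Longrightarrow> f' 7 = 3 * width d n \<Longrightarrow> f' 8 = 9 * width d n \<Longrightarrow>
      f' 9 = n div width d n + 1 \<Longrightarrow> f' 10 = iv - iu \<Longrightarrow> R t (f', \<tau>)"
  shows "wp Z D (width_com d) (f, \<tau>) R"
proof -
  let ?lam = "floorlog 2 n" and ?g = "depth d n"
  have lamn: "?lam \<le> n"
  proof (cases "n = 0")
    case False
    then have "2 ^ (?lam - 1) \<le> n" using floorlog_bounds[of n 2] by simp
    moreover have "?lam - 1 < 2 ^ (?lam - 1)" by (rule less_exp)
    ultimately show ?thesis by linarith
  qed (simp add: floorlog_def)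
  have pow: "2 ^ i \<le> 2 * n + 1" if "i \<le> ?lam" for i
  proof -
    have "(2::nat) ^ i \<le> 2 ^ ?lam" using that by (intro power_increasing) auto
    also have "\<dots> \<le> 2 * n + 1"
    proof (cases "n = 0")
      case False
      then have "2 ^ (?lam - 1) \<le> n" using floorlog_bounds[of n 2] by simp
      then have "2 * 2 ^ (?lam - 1) \<le> 2 * n" by simp
      moreover have "2 * 2 ^ (?lam - 1) = (2::nat) ^ ?lam"
        using False by (cases ?lam) (auto simp: floorlog_eq_zero_iff)
      ultimately show ?thesis by simp
    qed (simp add: floorlog_def)
    finally show ?thesis .
  qed
  let ?w1 = "While (Var 43) (seqs [Assign 43 (Var 43 [div] Lit 2), Assign 16 (Var 16 [+] Lit 1)])"
  let ?I1 = "\<lambda>i st. snd st = \<tau> \<and> (\<forall>x<6. fst st x = f x) \<and> fst st 16 = i \<and> floorlog 2 (fst st 43) + i = ?lam \<and> fst st 43 \<le> n"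
  have fl: "0 < m \<Longrightarrow> floorlog 2 m = Suc (floorlog 2 (m div 2))" for m
    by (subst compute_floorlog) simp
  have loop1: "wp Z D ?w1 st (\<lambda>t st'. t \<le> ?lam * 40 + 10 \<and> ?I1 ?lam st')" if "?I1 0 st" for st
  proof (rule wp_While[where N = ?lam and T = 30 and I = ?I1])
    fix i st assume i: "i < ?lam" and I: "?I1 i st"
    obtain f1 where st: "st = (f1, \<tau>)" using I by (cases st) auto
    have pos: "0 < f1 43"
      using i I by (cases "f1 43 = 0") (auto simp: st floorlog_def)
    have "f1 43 div 2 \<le> n" using I st order_trans[OF div_le_dividend] by simp
    then show "ev (Var 43) (fst st) \<noteq> 0 \<and> wp Z D (seqs [Assign 43 (Var 43 [div] Lit 2), Assign 16 (Var 16 [+] Lit 1)]) st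
      (\<lambda>t st'. t \<le> 30 \<and> ?I1 (Suc i) st')"
      using pos i I fl[OF pos] lamn Z by (simp add: st wp_simps)
  qed (use that in \<open>auto simp: floorlog_eq_zero_iff\<close>)
  let ?w2 = "While (Lit d [*] ((Var 17 [+] Lit 1) [*] (Var 17 [+] Lit 1)) [\<le>] Var 16)
       (seqs [Assign 17 (Var 17 [+] Lit 1), Assign 18 (Lit 2 [*] Var 18)])"
  let ?I2 = "\<lambda>i st. snd st = \<tau> \<and> (\<forall>x<6. fst st x = f x) \<and> fst st 16 = ?lam \<and> fst st 17 = i \<and> fst st 18 = 2 ^ i"
  have loop2: "wp Z D ?w2 st (\<lambda>t st'. t \<le> ?g * 60 + 30 \<and> ?I2 ?g st')" if "?I2 0 st" for st
  proof (rule wp_While[where N = ?g and T = 30 and I = ?I2])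
    fix i st assume i: "i < ?g" and I: "?I2 i st"
    obtain f1 where st: "st = (f1, \<tau>)" using I by (cases st) auto
    have "d * (Suc i * Suc i) \<le> ?lam" using le_depth_iff[OF d, of "Suc i" n] i by simp
    moreover have "2 * 2 ^ i \<le> Z" using pow[of "Suc i"] depth_le[OF d, of n] i Z by simp
    moreover have "Suc i \<le> Z" using depth_le[OF d, of n] i lamn Z by linarith
    ultimately show "ev (Lit d [*] ((Var 17 [+] Lit 1) [*] (Var 17 [+] Lit 1)) [\<le>] Var 16) (fst st) \<noteq> 0 \<and>
      wp Z D (seqs [Assign 17 (Var 17 [+] Lit 1), Assign 18 (Lit 2 [*] Var 18)]) st (\<lambda>t st'. t \<le> 30 \<and> ?I2 (Suc i) st')"
      using I by (simp add: st wp_simps)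
  next
    fix st assume I: "?I2 ?g st"
    have "\<not> d * (Suc ?g * Suc ?g) \<le> ?lam" using le_depth_iff[OF d, of "Suc ?g" n] by simp
    then show "ev (Lit d [*] ((Var 17 [+] Lit 1) [*] (Var 17 [+] Lit 1)) [\<le>] Var 16) (fst st) = 0" using I by simp
  qed (use that in \<open>auto\<close>)
  have gl: "?g \<le> ?lam" by (rule depth_le[OF d])
  have wn: "width d n \<le> n + 1" using div_le_dividend[of n "2 ^ ?g"] by (simp add: width_def)
  have Bn: "Suc (n div width d n) \<le> Z" "iv - iu \<le> Z"
    using div_le_dividend[of n "width d n"] Z by linarith+
  show ?thesis unfolding width_com_def seqs.simps(3)[of "seqs _"] seqs.simps(3)[of ?w1] seqs.simps(3)[of ?w2]
  proof (rule wp_SeqI[where P = "\<lambda>t st. t \<le> 20 \<and> ?I1 0 st"])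
    show "wp Z D (seqs [Assign 43 (Var 0), Assign 16 (Lit 0)]) (f, \<tau>) (\<lambda>t st. t \<le> 20 \<and> ?I1 0 st)"
      using f Z by (simp add: wp_simps)
    fix t1 :: nat and st1 assume 1: "t1 \<le> 20 \<and> ?I1 0 st1"
    show "wp Z D (Seq ?w1 (Seq (seqs [Assign 17 (Lit 0), Assign 18 (Lit 1)]) (Seq ?w2 (seqs [sizes_com])))) st1 (\<lambda>t. R (t1 + t))"
    proof (rule wp_SeqI[OF loop1[OF conjunct2[OF 1]]])
      fix t2 :: nat and st2 assume 2: "t2 \<le> ?lam * 40 + 10 \<and> ?I1 ?lam st2"
      obtain f2 where st2: "st2 = (f2, \<tau>)" using 2 by (cases st2) auto
      show "wp Z D (Seq (seqs [Assign 17 (Lit 0), Assign 18 (Lit 1)]) (Seq ?w2 (seqs [sizes_com]))) st2 (\<lambda>t. R (t1 + (t2 + t)))"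
      proof (rule wp_SeqI[where P = "\<lambda>t st. t \<le> 20 \<and> ?I2 0 st"])
        show "wp Z D (seqs [Assign 17 (Lit 0), Assign 18 (Lit 1)]) st2 (\<lambda>t st. t \<le> 20 \<and> ?I2 0 st)"
          using 2 Z by (simp add: wp_simps st2)
        fix t3 :: nat and st3 assume 3: "t3 \<le> 20 \<and> ?I2 0 st3"
        show "wp Z D (Seq ?w2 (seqs [sizes_com])) st3 (\<lambda>t. R (t1 + (t2 + (t3 + t))))"
        proof (rule wp_SeqI[OF loop2[OF conjunct2[OF 3]]])
          fix t4 :: nat and st4 assume 4: "t4 \<le> ?g * 60 + 30 \<and> ?I2 ?g st4"
          obtain f4 where st4: "st4 = (f4, \<tau>)" using 4 by (cases st4) auto
          have f4: "f4 0 = n" "f4 2 = iu" "f4 4 = iv" "f4 18 = 2 ^ ?g" "\<forall>x<6. f4 x = f x" using 4 f st4 by auto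
          have w: "Suc (n div 2 ^ ?g) = width d n" by (simp add: width_def)
          let ?f = "f4(6 := width d n, 7 := 3 * width d n, 8 := 9 * width d n, 9 := n div width d n + 1, 10 := iv - iu)"
          have "R (t1 + (t2 + (t3 + (t4 + t5)))) (?f, \<tau>)" if "t5 \<le> 60" for t5
            by (rule post) (use 1 2 3 4 gl f4 that in \<open>auto\<close>)
          then show "wp Z D (seqs [sizes_com]) st4 (\<lambda>t. R (t1 + (t2 + (t3 + (t4 + t)))))"
            using f4 wn Bn Z by (simp add: sizes_com_def wp_simps st4 w)
        qed
      qed
    qed
  qed
qed

lemma wp_bits_com:
  assumes f: "f 1 = p" "f 8 = 9 * width d n" and p: "0 < p"
    and Z: "2 ^ bits d n p \<le> Z"
    and post: "\<And>t f'. t \<le> 50 * bits d n p + 100 \<Longrightarrow> \<forall>x<11. f' x = f x \<Longrightarrow>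
      f' 11 = bits d n p \<Longrightarrow> f' 12 = 2 ^ bits d n p \<Longrightarrow>
      f' 13 = p * (2 ^ bits d n p div p) \<Longrightarrow> R t (f', \<tau>)"
  shows "wp Z D bits_com (f, \<tau>) R"
proof -
  let ?b = "bits d n p"
  have bZ: "?b < Z" using less_exp[of ?b] Z by linarith
  let ?w = "While (Var 12 [+] Lit 1 [\<le>] (Var 8 [+] Lit 2) [*] Var 1)
       (seqs [Assign 12 (Lit 2 [*] Var 12), Assign 11 (Var 11 [+] Lit 1)])"
  let ?I = "\<lambda>i st. snd st = \<tau> \<and> (\<forall>x<11. fst st x = f x) \<and> fst st 11 = i \<and> fst st 12 = 2 ^ i"
  have loop: "wp Z D ?w st (\<lambda>t st'. t \<le> ?b * 50 + 30 \<and> ?I ?b st')" if "?I 0 st" for st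
  proof (rule wp_While[where N = ?b and T = 30 and I = ?I])
    fix i st assume i: "i < ?b" and I: "?I i st"
    obtain f1 where st: "st = (f1, \<tau>)" using I by (cases st) auto
    have "(2::nat) ^ Suc i \<le> 2 ^ ?b" using i by (intro power_increasing) auto
    then have "2 * 2 ^ i \<le> Z" using Z by simp
    moreover have "Suc (2 ^ i) < Suc ((9 * width d n + 2) * p)" using bits_gt[OF i] by simp
    ultimately show "ev (Var 12 [+] Lit 1 [\<le>] (Var 8 [+] Lit 2) [*] Var 1) (fst st) \<noteq> 0 \<and>
      wp Z D (seqs [Assign 12 (Lit 2 [*] Var 12), Assign 11 (Var 11 [+] Lit 1)]) st (\<lambda>t st'. t \<le> 30 \<and> ?I (Suc i) st')"
      using I bZ i f by (simp add: st wp_simps)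
  next
    fix st assume "?I ?b st"
    then show "ev (Var 12 [+] Lit 1 [\<le>] (Var 8 [+] Lit 2) [*] Var 1) (fst st) = 0"
      using bits_le[of d n p] f by simp
  qed (use that in auto)
  have "p * (2 ^ ?b div p) \<le> 2 ^ ?b" by simp
  then have pZ: "p * (2 ^ ?b div p) \<le> Z" using Z by linarith
  show ?thesis unfolding bits_com_def seqs.simps(3)[of "seqs _"] seqs.simps(3)[of ?w]
  proof (rule wp_SeqI[where P = "\<lambda>t st. t \<le> 20 \<and> ?I 0 st"])
    show "wp Z D (seqs [Assign 11 (Lit 0), Assign 12 (Lit 1)]) (f, \<tau>) (\<lambda>t st. t \<le> 20 \<and> ?I 0 st)"
      using bZ by (simp add: wp_simps)
    fix t1 :: nat and st1 assume 1: "t1 \<le> 20 \<and> ?I 0 st1"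
    show "wp Z D (Seq ?w (seqs [Assign 13 (Var 1 [*] (Var 12 [div] Var 1))])) st1 (\<lambda>t. R (t1 + t))"
    proof (rule wp_SeqI[OF loop[OF conjunct2[OF 1]]])
      fix t2 :: nat and st2 assume 2: "t2 \<le> ?b * 50 + 30 \<and> ?I ?b st2"
      obtain f2 where st2: "st2 = (f2, \<tau>)" using 2 by (cases st2) auto
      have f2: "f2 1 = p" "f2 11 = ?b" "f2 12 = 2 ^ ?b" "\<forall>x<11. f2 x = f x" using 2 f st2 by auto
      let ?f = "f2(13 := p * (2 ^ ?b div p))"
      have "R (t1 + (t2 + t3)) (?f, \<tau>)" if "t3 \<le> 20" for t3
        by (rule post) (use 1 2 f2 that in auto)
      then show "wp Z D (seqs [Assign 13 (Var 1 [*] (Var 12 [div] Var 1))]) st2 (\<lambda>t. R (t1 + (t2 + t)))"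
        using f2 pZ by (simp add: wp_simps st2)
    qed
  qed
qed

lemma (in blocks) wp_count_com:
  assumes f: "f 6 = w" "f 8 = 9 * w" "f 9 = B" "f 10 = 2 ^ k" and Z: "cnt k \<le> Z" "2 ^ k \<le> Z"
    and post: "\<And>t f'. t \<le> 60 * k + 50 \<Longrightarrow> \<forall>x<15. f' x = f x \<Longrightarrow> f' 15 = cnt k \<Longrightarrow> R t (f', \<tau>)"
  shows "wp Z D count_com (f, \<tau>) R"
proof -
  let ?c = "seqs [Assign 20 (Lit 2 [*] Var 20),
       Cond (Var 20 [-] Var 6) (Assign 15 (Var 15 [*] (Lit 4 [*] Var 9))) (Assign 15 (Var 15 [*] Lit 4))]"
  let ?I = "\<lambda>i st. snd st = \<tau> \<and> (\<forall>x<15. fst st x = f x) \<and> fst st 15 = cnt i \<and> fst st 20 = 2 ^ i"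
  have mono: "cnt i \<le> cnt j" if "i \<le> j" for i j
    using that
  proof (induction j)
    case (Suc j)
    have "1 * cnt j \<le> cnt (Suc j)" unfolding cnt.simps by (intro mult_right_mono) (simp_all add: Bs_def B_def)
    with Suc show ?case by (cases "i = Suc j") (auto simp del: cnt.simps)
  qed simp
  have loop: "wp Z D (While (Var 10 [-] Var 20) ?c) st (\<lambda>t st'. t \<le> k * 60 + 10 \<and> ?I k st')" if "?I 0 st" for st
  proof (rule wp_While[where N = k and T = 50 and I = ?I])
    fix i st assume i: "i < k" and I: "?I i st"
    obtain f1 where st: "st = (f1, \<tau>)" using I by (cases st) auto
    have "(2::nat) ^ Suc i \<le> 2 ^ k" using i by (intro power_increasing) auto
    moreover have "(2::nat) ^ i < 2 ^ k" using i by (intro power_strict_increasing) auto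
    moreover have "cnt (Suc i) \<le> Z" using mono[of "Suc i" k] i Z by linarith
    ultimately show "ev (Var 10 [-] Var 20) (fst st) \<noteq> 0 \<and> wp Z D ?c st (\<lambda>t st'. t \<le> 50 \<and> ?I (Suc i) st')"
      using I f Z by (cases "w < 2 * 2 ^ i") (simp_all add: st wp_simps Bs_def mult_ac)
  qed (use that f in auto)
  have "9 * w \<le> Z" using mono[of 0 k] Z by simp
  moreover have "1 \<le> Z" using Z one_le_power[of "2::nat" k] by linarith
  ultimately have "wp Z D (seqs [Assign 15 (Var 8), Assign 20 (Lit 1)]) (f, \<tau>) (\<lambda>t st. t \<le> 20 \<and> ?I 0 st)"
    using f by (simp add: wp_simps)
  then show ?thesis unfolding count_com_def seqs.simps(3)[of "seqs _"]
  proof (rule wp_SeqI)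
    fix t1 :: nat and st1 assume 1: "t1 \<le> 20 \<and> ?I 0 st1"
    show "wp Z D (seqs [While (Var 10 [-] Var 20) ?c]) st1 (\<lambda>t. R (t1 + t))"
      unfolding seqs.simps(2)[of "While _ _"]
    proof (rule wp_mono[OF loop[OF conjunct2[OF 1]]])
      fix t2 :: nat and st2 assume 2: "t2 \<le> k * 60 + 10 \<and> ?I k st2"
      then show "R (t1 + t2) st2" using post[of "t1 + t2" "fst st2"] 1 by (cases st2) auto
    qed
  qed
qed

context tape
begin

lemma wp_scan_com:
  assumes f: "f 1 = p" "f 8 = 9 * w" "f 11 = b" "f 12 = 2 ^ b" "f 13 = E"
    and Z: "9 * w \<le> Z" "f 14 + p \<le> Z"
    and post: "\<And>t f'. t \<le> 9 * w * (40 * b + 90) + 50 \<Longrightarrow> \<forall>x<14. f' x = f x \<Longrightarrow> f' 14 = f 14 + p \<Longrightarrow>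
      f' 19 = of_bool (\<exists>r<9 * w. E \<le> (x0 r + (f 14 + p)) mod 2 ^ b) \<Longrightarrow> R t (f', \<tau>0)"
  shows "wp Z D scan_com (f, \<tau>0) R"
proof -
  let ?\<alpha> = "f 14 + p"
  let ?bad = "\<lambda>r. E \<le> (x0 r + ?\<alpha>) mod 2 ^ b"
  let ?I = "\<lambda>i st. snd st = \<tau>0 \<and> (\<forall>x<14. fst st x = f x) \<and> fst st 14 = ?\<alpha> \<and> fst st 42 = i \<and>
    fst st 19 = of_bool (\<exists>r<i. ?bad r)"
  have loop: "wp Z D (While (Var 8 [-] Var 42) scan_step) st (\<lambda>t st'. t \<le> 9 * w * (40 * b + 90) + 10 \<and> ?I (9 * w) st')"
    if "?I 0 st" for st
  proof (rule wp_While[where N = "9 * w" and T = "40 * b + 80" and I = ?I])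
    fix i st assume i: "i < 9 * w" and I: "?I i st"
    obtain f1 where st: "st = (f1, of_bits (\<lambda>r. bit (x0 r)))" using I of_bits_x0 by (cases st) auto
    have f1: "\<forall>x<14. f1 x = f x" "f1 14 = ?\<alpha>" "f1 42 = i" "f1 19 = of_bool (\<exists>r<i. ?bad r)" using I st by auto
    have "wp Z D scan_step st (\<lambda>t st'. t \<le> 40 * b + 80 \<and> ?I (Suc i) st')"
      unfolding st scan_step_def seqs.simps wp_simps
    proof (rule wp_read_reg[where r = i and v = "x0 i"])
      fix t f2 assume 2: "t \<le> 40 * b + 20" "\<forall>x<43. f2 x = f1 x" "f2 43 = x0 i"
      have f2: "\<forall>x<14. f2 x = f x" "f2 12 = 2 ^ b" "f2 13 = E" "f2 14 = ?\<alpha>" "f2 42 = i" "f2 43 = x0 i"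
        "f2 19 = of_bool (\<exists>r<i. ?bad r)"
        using 2 f1 f by auto
      have ex: "(\<exists>r<Suc i. ?bad r) \<longleftrightarrow> (\<exists>r<i. ?bad r) \<or> ?bad i" by (auto simp: less_Suc_eq)
      show "wp Z D (Seq (Cond (Var 13 [\<le>] (Var 43 [+] Var 14) [mod] Var 12) (Assign 19 (Lit 1)) (Assign 43 (Lit 0)))
        (Assign 42 (Var 42 [+] Lit 1))) (f2, of_bits (\<lambda>r. bit (x0 r))) (\<lambda>t2 st'. t + t2 \<le> 40 * b + 80 \<and> ?I (Suc i) st')"
      proof (cases "?bad i")
        case True
        then show ?thesis using f2 2 Z Z_pos i unfolding ex
          by (simp add: wp_simps of_bits_x0)
      next
        case False
        then show ?thesis using f2 2 Z Z_pos i unfolding ex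
          by (simp add: wp_simps of_bits_x0 not_le)
      qed
    qed (use f1 f i x0_less in auto)
    moreover have "f1 8 = 9 * w" using f1 f by simp
    ultimately show "ev (Var 8 [-] Var 42) (fst st) \<noteq> 0 \<and>
      wp Z D scan_step st (\<lambda>t st'. t \<le> 40 * b + 80 \<and> ?I (Suc i) st')"
      using i f1 by (simp add: st)
  qed (use that f in \<open>auto simp: algebra_simps\<close>)
  have "wp Z D (seqs [Assign 14 (Var 14 [+] Var 1), Assign 19 (Lit 0), Assign 42 (Lit 0)]) (f, \<tau>0) (\<lambda>t st. t \<le> 30 \<and> ?I 0 st)"
    using f Z by (simp add: wp_simps)
  then show ?thesis unfolding scan_com_def seqs.simps(3)[of "seqs _"]
  proof (rule wp_SeqI)
    fix t1 :: nat and st1 assume 1: "t1 \<le> 30 \<and> ?I 0 st1"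
    show "wp Z D (seqs [While (Var 8 [-] Var 42) scan_step]) st1 (\<lambda>t. R (t1 + t))"
      unfolding seqs.simps(2)[of "While _ _"]
    proof (rule wp_mono[OF loop[OF conjunct2[OF 1]]])
      fix t2 :: nat and st2 assume 2: "t2 \<le> 9 * w * (40 * b + 90) + 10 \<and> ?I (9 * w) st2"
      then show "R (t1 + t2) st2" using post[of "t1 + t2" "fst st2"] 1 by (cases st2) auto
    qed
  qed
qed

lemma wp_offset_com:
  assumes f: "f 1 = p" "f 8 = 9 * w" "f 11 = b" "f 12 = 2 ^ b" "f 13 = p * (2 ^ b div p)"
    and p: "0 < p" "(9 * w + 2) * p \<le> 2 ^ b"
    and post: "\<And>t f' \<alpha>. t \<le> (9 * w + 1) * (9 * w * (40 * b + 90) + 60) + 50 \<Longrightarrow> \<forall>x<14. f' x = f x \<Longrightarrow> f' 14 = \<alpha> \<Longrightarrow>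
      \<alpha> \<le> 2 ^ b \<Longrightarrow> \<forall>r<9 * w. (x0 r + \<alpha>) mod 2 ^ b < p * (2 ^ b div p) \<Longrightarrow> R t (f', \<tau>0)"
  shows "wp Z D offset_com (f, \<tau>0) R"
proof -
  let ?good = "\<lambda>k. \<forall>r<9 * w. (x0 r + k * p) mod 2 ^ b < p * (2 ^ b div p)"
  define k where "k = (LEAST k. 1 \<le> k \<and> ?good k)"
  obtain k0 where k0: "1 \<le> k0" "k0 \<le> 9 * w + 1" "?good k0"
    using good_offset[OF p(1) p(2), of x0] x0_less by auto
  then have k: "1 \<le> k" "?good k" "k \<le> 9 * w + 1"
    using LeastI[of "\<lambda>k. 1 \<le> k \<and> ?good k" k0] Least_le[of "\<lambda>k. 1 \<le> k \<and> ?good k" k0]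
    unfolding k_def[symmetric] by auto
  have less: "\<exists>r<9 * w. p * (2 ^ b div p) \<le> (x0 r + i * p) mod 2 ^ b" if "1 \<le> i" "i < k" for i
    using not_less_Least[of i "\<lambda>k. 1 \<le> k \<and> ?good k"] that unfolding k_def[symmetric] by (auto simp: not_less)
  have ip: "i * p \<le> 2 ^ b" if "i \<le> k" for i
  proof -
    have "i * p \<le> (9 * w + 2) * p" using that k by (intro mult_right_mono) auto
    with p(2) show ?thesis by linarith
  qed
  have wZ: "9 * w \<le> Z"
  proof -
    have "9 * w * 1 \<le> (9 * w + 2) * p" using p(1) by (intro mult_mono) auto
    with p(2) bZ show ?thesis by linarith
  qed
  let ?I = "\<lambda>i st. snd st = \<tau>0 \<and> (\<forall>x<14. fst st x = f x) \<and> fst st 14 = i * p \<and> (fst st 19 = 0 \<longleftrightarrow> i = k)"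
  have loop: "wp Z D (While (Var 19) scan_com) st (\<lambda>t st'. t \<le> k * (9 * w * (40 * b + 90) + 60) + 10 \<and> ?I k st')"
    if "?I 0 st" for st
  proof (rule wp_While[where N = k and T = "9 * w * (40 * b + 90) + 50" and I = ?I])
    fix i st assume i: "i < k" and I: "?I i st"
    obtain f1 where st: "st = (f1, \<tau>0)" using I by (cases st) auto
    have f1: "\<forall>x<14. f1 x = f x" "f1 14 = i * p" "f1 19 \<noteq> 0" using I i st by auto
    have e: "i * p + p = Suc i * p" by simp
    have "wp Z D scan_com st (\<lambda>t st'. t \<le> 9 * w * (40 * b + 90) + 50 \<and> ?I (Suc i) st')"
      unfolding st
    proof (rule wp_scan_com)
      fix t f' assume 1: "t \<le> 9 * w * (40 * b + 90) + 50" "\<forall>x<14. f' x = f1 x" "f' 14 = f1 14 + p"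
        "f' 19 = of_bool (\<exists>r<9 * w. p * (2 ^ b div p) \<le> (x0 r + (f1 14 + p)) mod 2 ^ b)"
      have "f' 19 = 0 \<longleftrightarrow> \<not> (\<exists>r<9 * w. p * (2 ^ b div p) \<le> (x0 r + (i * p + p)) mod 2 ^ b)"
        using 1(4) f1(2) by simp
      also have "\<dots> \<longleftrightarrow> ?good (Suc i)" unfolding e by (meson not_le)
      also have "\<dots> \<longleftrightarrow> Suc i = k"
        using k less[of "Suc i"] i by (cases "Suc i = k") (auto simp: not_less simp del: mult_Suc)
      finally show "t \<le> 9 * w * (40 * b + 90) + 50 \<and> ?I (Suc i) (f', \<tau>0)"
        using 1 f1 by simp
    qed (use f f1 wZ ip[of "Suc i"] i bZ in auto)
    then show "ev (Var 19) (fst st) \<noteq> 0 \<and>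
      wp Z D scan_com st (\<lambda>t st'. t \<le> 9 * w * (40 * b + 90) + 50 \<and> ?I (Suc i) st')"
      using f1 by (simp add: st)
  qed (use that in \<open>auto simp: algebra_simps\<close>)
  have "wp Z D (seqs [Assign 14 (Lit 0), Assign 19 (Lit 1)]) (f, \<tau>0) (\<lambda>t st. t \<le> 20 \<and> ?I 0 st)"
    using k(1) Z_pos by (simp add: wp_simps)
  then show ?thesis unfolding offset_com_def seqs.simps(3)[of "seqs _"]
  proof (rule wp_SeqI)
    fix t1 :: nat and st1 assume 1: "t1 \<le> 20 \<and> ?I 0 st1"
    show "wp Z D (seqs [While (Var 19) scan_com]) st1 (\<lambda>t. R (t1 + t))"
      unfolding seqs.simps(2)[of "While _ _"]
    proof (rule wp_mono[OF loop[OF conjunct2[OF 1]]])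
      fix t2 :: nat and st2 assume 2: "t2 \<le> k * (9 * w * (40 * b + 90) + 60) + 10 \<and> ?I k st2"
      have "k * (9 * w * (40 * b + 90) + 60) \<le> (9 * w + 1) * (9 * w * (40 * b + 90) + 60)"
        using k by (intro mult_right_mono) auto
      then have "R (t1 + t2) (fst st2, \<tau>0)"
        using 1 2 k ip[of k] by (intro post[of _ _ "k * p"]) auto
      with 2 show "R (t1 + t2) st2" by (cases st2) auto
    qed
  qed
qed

end

text \<open>The program uses the cells 0 to 46; its literals are \<open>d\<close> and numbers up to
  9; and 60 leaves room for \<open>guard_exp\<close>, the largest expression.\<close>

lemma wf_algorithm: "wf_com 47 (d + 9) 60 (algorithm d)"
  by (simp add: algorithm_def width_com_def sizes_com_def bits_com_def offset_com_def scan_com_def scan_step_def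
      count_com_def main_com_def pass_com_def run_com_def leaf_com_def leaf_init_def leaf_body_def
      leaf_update_def guard_exp_def descend_def digit_com_def descend_left_def descend_right_def add_to_def get_val_def
      read_reg_def read_bit_def write_reg_def write_bit_def)

lemma wp_algorithm:
  assumes d: "0 < d" and p: "2 \<le> p" and weights: "weight_oracle n p \<mu> D"
    and layers: "iu + 2 ^ k \<le> n" and ju: "ju \<le> n" and jv: "jv \<le> n"
    and w: "w = width d n" and b: "b = bits d n p" and space: "9 * w * b \<le> length \<tau>"
    and Z: "2 ^ b \<le> Z" "blocks.cnt n w k \<le> Z" "9 * n + 3 * w + 20 \<le> Z"
    and f: "f 0 = n" "f 1 = p" "f 2 = iu" "f 3 = ju" "f 4 = iu + 2 ^ k" "f 5 = jv"
  shows "wp Z D (algorithm d) (f, \<tau>) (\<lambda>t st. t \<le> 100 * floorlog 2 n + 450 * b +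
     (9 * w + 1) * (9 * w * (40 * b + 90) + 60) + 60 * k +
     4 * (blocks.cnt n w k * (120 * b + 260 * k + 920)) + 2000 \<and>
     fst st 0 = path_sum (Grid n) \<mu> (iu, ju) (iu + 2 ^ k, jv) mod p \<and> snd st = \<tau>)"
    (is "wp Z D _ _ ?R")
proof -
  have w0: "0 < w" by (simp add: w width_def)
  interpret blocks n w \<mu> using w0 by unfold_locales
  interpret tape w b Z \<tau> using space Z by unfold_locales
  have pow: "2 ^ k \<le> Z" using layers Z by linarith
  show ?thesis unfolding algorithm_def seqs.simps wp_simps(5)
  proof (rule wp_width_com[OF d f(1,3,5)])
    show "9 * n + 20 \<le> Z" "iu + 2 ^ k \<le> n" using Z layers by simp_all
    fix t1 f1 assume 1: "t1 \<le> 100 * floorlog 2 n + 200" "\<forall>x<6. f1 x = f x" "f1 6 = width d n"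
      "f1 7 = 3 * width d n" "f1 8 = 9 * width d n" "f1 9 = n div width d n + 1" "f1 10 = iu + 2 ^ k - iu"
    have f1: "f1 1 = p" "f1 8 = 9 * width d n" using 1 f by auto
    show "wp Z D (Seq bits_com (Seq offset_com (Seq count_com main_com))) (f1, \<tau>) (\<lambda>t. ?R (t1 + t))"
      unfolding wp_simps(5)
    proof (rule wp_bits_com[OF f1])
      show "0 < p" "2 ^ bits d n p \<le> Z" using p Z b by auto
      fix t2 f2 assume 2: "t2 \<le> 50 * bits d n p + 100" "\<forall>x<11. f2 x = f1 x" "f2 11 = bits d n p"
        "f2 12 = 2 ^ bits d n p" "f2 13 = p * (2 ^ bits d n p div p)"
      show "wp Z D (Seq offset_com (Seq count_com main_com)) (f2, \<tau>) (\<lambda>t. ?R (t1 + (t2 + t)))"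
        unfolding wp_simps(5)
      proof (rule wp_offset_com[where p = p])
        show "(9 * w + 2) * p \<le> 2 ^ b" unfolding w b by (rule bits_le)
        fix t3 f3 \<alpha> assume 3: "t3 \<le> (9 * w + 1) * (9 * w * (40 * b + 90) + 60) + 50" "\<forall>x<14. f3 x = f2 x"
          "f3 14 = \<alpha>" "\<alpha> \<le> 2 ^ b" "\<forall>r<9 * w. (x0 r + \<alpha>) mod 2 ^ b < p * (2 ^ b div p)"
        \<comment> \<open>The locale can be entered only here: its hypothesis on the offset concerns
          the \<alpha> found at run time.\<close>
        interpret machine w b Z \<tau> p \<alpha> n \<mu> D iu ju jv k
          using 3 w0 p Z layers ju jv weights by unfold_locales auto
        have f3: "f3 0 = n" "f3 1 = p" "f3 2 = iu" "f3 3 = ju" "f3 5 = jv" "f3 6 = w" "f3 7 = 3 * w" "f3 8 = 9 * w"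
          "f3 9 = n div w + 1" "f3 10 = 2 ^ k" "f3 11 = b" "f3 12 = 2 ^ b" "f3 14 = \<alpha>"
          using 1 2 3 f by (simp_all add: w b)
        note f3 = f3[folded B_def]
        show "wp Z D (Seq count_com main_com) (f3, \<tau>) (\<lambda>t. ?R (t1 + (t2 + (t3 + t))))"
          unfolding wp_simps(5)
        proof (rule wp_count_com[OF f3(6,8,9,10) Z(2) pow])
          fix t4 f4 assume 4: "t4 \<le> 60 * k + 50" "\<forall>x<15. f4 x = f3 x" "f4 15 = cnt k"
          have "glob f4" using 4 f3 by (simp add: glob_def)
          then have "wp Z D main_com (f4, tape_of initial_regs) (\<lambda>t. ?R (t1 + (t2 + (t3 + (t4 + t)))))"
          proof (rule wp_main_com)
            fix t5 and f5 :: "nat \<Rightarrow> nat" assume 5: "t5 \<le> 4 * run_time + 400 * b + 1000"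
              "f5 0 = path_sum (Grid n) \<mu> (iu, ju) (iu + 2 ^ k, jv) mod p"
            have "t1 + (t2 + (t3 + (t4 + t5))) \<le> 100 * floorlog 2 n + 450 * b +
              (9 * w + 1) * (9 * w * (40 * b + 90) + 60) + 60 * k + 4 * (cnt k * (120 * b + 260 * k + 920)) + 2000"
              using 1(1) 2(1)[folded b] 3(1) 4(1) 5(1) unfolding run_time_def distrib_left by linarith
            with 5 show "?R (t1 + (t2 + (t3 + (t4 + t5)))) (f5, tape_of initial_regs)"
              by (simp add: tape_of_initial)
          qed
          then show "wp Z D main_com (f4, \<tau>) (\<lambda>t. ?R (t1 + (t2 + (t3 + (t4 + t)))))"
            unfolding tape_of_initial .
        qed
      qed (use 1 2 f p w b in auto)
    qed
  qed
qed

text \<open>A level contributes a factor \<open>B \<le> 2 ^ g\<close> only if its walks are longer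
  than \<open>w\<close>. As \<open>w * 2 ^ g\<close> exceeds \<open>n\<close> and no walk is longer
  than \<open>n\<close>, there are at most \<open>g\<close> such levels.\<close>

lemma (in blocks) cnt_bound:
  assumes g: "w = n div 2 ^ g + 1" and n: "0 < n" and h: "2 ^ h \<le> n"
  shows "cnt h \<le> 9 * w * 4 ^ h * 2 ^ (g * g)"
proof -
  let ?lam = "floorlog 2 n"
  have lam: "2 ^ (?lam - 1) \<le> n" "n < 2 ^ ?lam" "0 < ?lam"
    using floorlog_bounds[of n 2] n by (auto simp: floorlog_eq_zero_iff intro: gr0I)
  have nw: "n < w * 2 ^ g"
    unfolding g using dividend_less_div_times[of "2 ^ g" n] by simp
  have B: "B \<le> 2 ^ g"
    using nw by (simp add: B_def Suc_le_eq less_mult_imp_div_less mult.commute)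
  \<comment> \<open>The truncated difference \<open>h + g + 1 - ?lam\<close> bounds the number of
    long levels up to \<open>h\<close>: every long level raises it by one, and it is 0 for small
    \<open>h\<close>.\<close>
  have "cnt h \<le> 9 * w * 4 ^ h * 2 ^ (g * (h + g + 1 - ?lam))"
  proof (induction h)
    case (Suc h)
    have "Bs (Suc h) * 2 ^ (g * (h + g + 1 - ?lam)) \<le> 2 ^ (g * (Suc h + g + 1 - ?lam))"
    proof (cases "w < 2 ^ Suc h")
      case True
      have "2 ^ (?lam - 1) < (2::nat) ^ (Suc h + g)"
      proof -
        have "w * 2 ^ g < 2 ^ Suc h * 2 ^ g" using True by simp
        with nw lam(1) show ?thesis unfolding power_add by linarith
      qed
      then have "?lam - 1 < Suc h + g" by (rule power_less_imp_less_exp[rotated]) simp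
      then have "Suc h + g + 1 - ?lam = Suc (h + g + 1 - ?lam)" using lam(3) by linarith
      then have "2 ^ (g * (Suc h + g + 1 - ?lam)) = 2 ^ g * (2::nat) ^ (g * (h + g + 1 - ?lam))"
        by (simp add: power_add)
      then show ?thesis using B True by (simp add: Bs_def)
    next
      case False
      have "(2::nat) ^ (g * (h + g + 1 - ?lam)) \<le> 2 ^ (g * (Suc h + g + 1 - ?lam))"
        by (intro power_increasing mult_le_mono) auto
      then show ?thesis using False by (simp add: Bs_def)
    qed
    then have *: "9 * w * 4 ^ Suc h * (Bs (Suc h) * 2 ^ (g * (h + g + 1 - ?lam)))
      \<le> 9 * w * 4 ^ Suc h * 2 ^ (g * (Suc h + g + 1 - ?lam))" by (intro mult_le_mono2)
    have "cnt (Suc h) \<le> Bs (Suc h) * 4 * (9 * w * 4 ^ h * 2 ^ (g * (h + g + 1 - ?lam)))"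
      using Suc unfolding cnt.simps by (intro mult_le_mono2)
    also have "\<dots> = 9 * w * 4 ^ Suc h * (Bs (Suc h) * 2 ^ (g * (h + g + 1 - ?lam)))" by (simp add: mult_ac)
    finally show ?case using * by linarith
  qed simp
  also have "\<dots> \<le> 9 * w * 4 ^ h * 2 ^ (g * g)"
  proof -
    have "(2::nat) ^ h < 2 ^ ?lam" using h lam by linarith
    then have "h < ?lam" by (rule power_less_imp_less_exp[rotated]) simp
    then show ?thesis by (intro mult_le_mono2 power_increasing) auto
  qed
  finally show ?thesis .
qed

lemma bits_mono: "p \<le> P \<Longrightarrow> bits d n p \<le> bits d n P"
proof -
  assume "p \<le> P"
  then have "(9 * width d n + 2) * p \<le> (9 * width d n + 2) * P" by (rule mult_le_mono2)
  also have "\<dots> \<le> 2 ^ bits d n P" by (rule bits_le)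
  finally show ?thesis unfolding bits_def[of d n p] by (rule Least_le)
qed

text \<open>By minimality of the bit length, halving the power falls below the threshold. The
  \<open>+ 1\<close> covers bit length 0, as the bounding polynomial may vanish at
  \<open>n\<close>.\<close>

lemma pow_bits_le: "2 ^ bits d n p \<le> 2 * ((9 * width d n + 2) * (p + 1))"
proof (cases "bits d n p")
  case (Suc b)
  then have "2 ^ b < (9 * width d n + 2) * p" using bits_gt[of b d n p] by simp
  then show ?thesis using Suc by simp
qed simp

section \<open>Asymptotics\<close>

lemma nat_poly_bound: "\<exists>A m. \<forall>n\<ge>1. poly q n \<le> A * n ^ m" for q :: "nat poly"
proof (intro exI allI impI)
  fix n :: nat assume "1 \<le> n"
  have "poly q n = (\<Sum>i\<le>degree q. coeff q i * n ^ i)" by (rule poly_altdef)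
  also have "\<dots> \<le> (\<Sum>i\<le>degree q. coeff q i * n ^ degree q)"
    using \<open>1 \<le> n\<close> by (intro sum_mono mult_le_mono2 power_increasing) auto
  finally show "poly q n \<le> (\<Sum>i\<le>degree q. coeff q i) * n ^ degree q" by (simp add: sum_distrib_right)
qed

lemma bigo_natI:
  fixes f :: "nat \<Rightarrow> nat" and g :: "nat \<Rightarrow> real"
  assumes "\<And>n. N \<le> n \<Longrightarrow> real (f n) \<le> C * g n" "\<And>n. N \<le> n \<Longrightarrow> 0 \<le> g n"
  shows "(\<lambda>n. real (f n)) \<in> O(g)"
proof (rule bigoI)
  show "\<forall>\<^sub>F n in sequentially. norm (real (f n)) \<le> C * norm (g n)"
    using eventually_ge_at_top[of N] by (rule eventually_mono) (use assms in simp)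
qed

lemma log_ge_1: "2 \<le> n \<Longrightarrow> 1 \<le> log 2 (real n)"
  by simp

lemma floorlog_log: "0 < n \<Longrightarrow> log 2 (real n) \<le> real (floorlog 2 n) \<and> real (floorlog 2 n) \<le> log 2 (real n) + 1"
proof -
  assume n: "0 < n"
  have b: "2 ^ (floorlog 2 n - 1) \<le> n" "n < 2 ^ floorlog 2 n" "0 < floorlog 2 n"
    using floorlog_bounds[of n 2] n by (auto simp: floorlog_eq_zero_iff intro: gr0I)
  have "real (floorlog 2 n - 1) \<le> log 2 (real n)" by (rule le_log2_of_power[OF b(1)])
  moreover have "log 2 (real n) < real (floorlog 2 n)" by (rule log2_of_power_less[OF b(2) n])
  ultimately show ?thesis using b(3) by (simp add: of_nat_diff)
qed

lemma width_le: "1 \<le> n \<Longrightarrow> width d n \<le> 2 * n"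
  unfolding width_def using div_le_dividend[of n "2 ^ depth d n"] by linarith

lemma depth_square: "0 < d \<Longrightarrow> d * (depth d n * depth d n) \<le> floorlog 2 n"
  using le_depth_iff[of d "depth d n" n] by simp

definition leaves :: "nat \<Rightarrow> nat \<Rightarrow> nat" where
  "leaves d n = 9 * width d n * n ^ 2 * 2 ^ (depth d n * depth d n)"

lemma cnt_le_leaves:
  assumes "2 ^ k \<le> n"
  shows "blocks.cnt n (width d n) k \<le> leaves d n"
proof -
  interpret blocks n "width d n" "\<lambda>_. 0" by unfold_locales (simp add: width_def)
  have "0 < n" using assms by (auto intro: gr0I)
  have "cnt k \<le> 9 * width d n * 4 ^ k * 2 ^ (depth d n * depth d n)"
    by (rule cnt_bound[OF _ \<open>0 < n\<close> assms]) (simp add: width_def)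
  moreover have "(4::nat) ^ k \<le> n ^ 2"
  proof -
    have "(4::nat) ^ k = (2 ^ k) ^ 2" by (simp add: power2_eq_square flip: power_mult_distrib)
    also have "\<dots> \<le> n ^ 2" using assms by (rule power_mono) simp
    finally show ?thesis .
  qed
  then have "9 * width d n * 4 ^ k * 2 ^ (depth d n * depth d n) \<le> leaves d n"
    unfolding leaves_def by (intro mult_le_mono mult_le_mono2) auto
  ultimately show ?thesis by linarith
qed

text \<open>The constant is \<open>9 * 2 * 2\<close>: the width is at most \<open>2 * n\<close>, and
  \<open>2 ^ (g * g)\<close> is at most \<open>2 * n powr (1 / d)\<close>, because the digit count
  of \<open>n\<close> exceeds its logarithm by at most 1.\<close>

lemma leaves_powr:
  assumes "0 < d" "1 \<le> n"
  shows "real (leaves d n) \<le> 36 * real n powr (3 + 1 / d)"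
proof -
  have g: "real (depth d n * depth d n) \<le> (log 2 (real n) + 1) / d"
  proof -
    have "real (d * (depth d n * depth d n)) \<le> log 2 (real n) + 1"
      using depth_square[OF assms(1), of n] floorlog_log[of n] assms by linarith
    then show ?thesis using assms by (simp add: field_simps)
  qed
  have "2 ^ (depth d n * depth d n) = (2::real) powr real (depth d n * depth d n)"
    by (rule powr_realpow[symmetric]) simp
  also have "\<dots> \<le> 2 powr ((log 2 (real n) + 1) / d)" using g by (intro powr_mono) auto
  also have "\<dots> = (2 powr (log 2 (real n) + 1)) powr (1 / d)" by (simp add: powr_powr)
  also have "2 powr (log 2 (real n) + 1) = 2 * real n" using assms by (simp add: powr_add)
  also have "(2 * real n) powr (1 / d) = 2 powr (1 / d) * real n powr (1 / d)" by (simp add: powr_mult)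
  also have "\<dots> \<le> 2 powr 1 * real n powr (1 / d)" using assms by (intro mult_right_mono powr_mono) auto
  finally have p: "2 ^ (depth d n * depth d n) \<le> 2 * real n powr (1 / d)" by simp
  have "real (leaves d n) = 9 * real (width d n) * real n ^ 2 * 2 ^ (depth d n * depth d n)"
    by (simp add: leaves_def)
  also have "\<dots> \<le> 9 * (2 * real n) * real n ^ 2 * (2 * real n powr (1 / d))"
    using width_le[OF assms(2), of d] p by (intro mult_mono) auto
  also have "\<dots> = 36 * (real n ^ 3 * real n powr (1 / d))" by (simp add: power2_eq_square power3_eq_cube)
  also have "real n ^ 3 = real n powr 3" using assms powr_realpow[of "real n" 3] by simp
  finally show ?thesis by (simp add: powr_add)
qed

lemma leaves_le: "0 < d \<Longrightarrow> 1 \<le> n \<Longrightarrow> leaves d n \<le> 36 * n ^ 4"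
proof -
  assume d: "0 < d" and n: "1 \<le> n"
  have "real (leaves d n) \<le> 36 * real n powr (3 + 1 / d)" by (rule leaves_powr[OF d n])
  also have "\<dots> \<le> 36 * real n powr 4" using d n by (intro mult_left_mono powr_mono) auto
  also have "real n powr 4 = real n ^ 4" using n powr_realpow[of "real n" 4] by simp
  finally have "real (leaves d n) \<le> real (36 * n ^ 4)" by simp
  then show ?thesis by (simp only: of_nat_le_iff)
qed

lemma modulus_bound:
  "\<exists>C m. 1 \<le> C \<and> (\<forall>n\<ge>1. 2 * ((9 * width d n + 2) * (poly q n + 1)) \<le> C * n ^ m)" for q :: "nat poly"
proof -
  obtain A m where A: "\<forall>n\<ge>1. poly q n \<le> A * n ^ m" using nat_poly_bound by blast
  have "2 * ((9 * width d n + 2) * (poly q n + 1)) \<le> 40 * (A + 1) * n ^ (m + 1)" if n: "1 \<le> n" for n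
  proof -
    have "9 * width d n + 2 \<le> 20 * n" using width_le[OF n, of d] n by linarith
    moreover have "poly q n + 1 \<le> (A + 1) * n ^ m"
    proof -
      have "poly q n \<le> A * n ^ m" "1 \<le> n ^ m" using A n by auto
      then show ?thesis by simp
    qed
    ultimately have "(9 * width d n + 2) * (poly q n + 1) \<le> (20 * n) * ((A + 1) * n ^ m)" by (rule mult_le_mono)
    then show ?thesis by (simp add: algebra_simps)
  qed
  then show ?thesis by (intro exI[of _ "40 * (A + 1)"] exI[of _ "m + 1"]) auto
qed

lemma log_poly:
  assumes "1 \<le> C" "2 \<le> n"
  shows "log 2 (real (C * n ^ m)) \<le> (log 2 (real C) + real m) * log 2 (real n)"
proof -
  have L: "1 \<le> log 2 (real n)" using assms by simp
  have "0 \<le> log 2 (real C)" using assms by simp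
  then have "log 2 (real C) * 1 \<le> log 2 (real C) * log 2 (real n)" using L by (intro mult_left_mono)
  moreover have "log 2 (real (C * n ^ m)) = log 2 (real C) + real m * log 2 (real n)"
    using assms by (simp add: log_mult log_nat_power)
  ultimately show ?thesis by (simp add: algebra_simps)
qed

lemma bits_bound: "\<exists>C>0. \<forall>n\<ge>2. real (bits d n (poly q n)) \<le> C * log 2 (real n)" for q :: "nat poly"
proof -
  obtain C m where C: "1 \<le> C" "\<forall>n\<ge>1. 2 * ((9 * width d n + 2) * (poly q n + 1)) \<le> C * n ^ m"
    using modulus_bound by blast
  have "real (bits d n (poly q n)) \<le> (log 2 (real C) + real m + 1) * log 2 (real n)" if n: "2 \<le> n" for n
  proof -
    have "2 ^ bits d n (poly q n) \<le> C * n ^ m"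
      using pow_bits_le[of d n "poly q n"] C(2) n by (meson order_trans one_le_numeral)
    then have "real (bits d n (poly q n)) \<le> log 2 (real (C * n ^ m))" by (rule le_log2_of_power)
    also have "\<dots> \<le> (log 2 (real C) + real m) * log 2 (real n)" using log_poly[OF C(1) n] .
    also have "\<dots> \<le> (log 2 (real C) + real m + 1) * log 2 (real n)"
      using n by (intro mult_right_mono) auto
    finally show ?thesis .
  qed
  then show ?thesis using C(1) by (intro exI[of _ "log 2 (real C) + real m + 1"]) (auto intro: add_nonneg_pos)
qed

definition time_bound :: "nat \<Rightarrow> nat poly \<Rightarrow> nat \<Rightarrow> nat" where
  "time_bound d q n = (let w = width d n; b = bits d n (poly q n); l = floorlog 2 n in
     100 * l + 450 * b + (9 * w + 1) * (9 * w * (40 * b + 90) + 60) + 60 * l +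
     4 * (leaves d n * (120 * b + 260 * l + 920)) + 2000)"

text \<open>A sum that dominates everything a cell may hold: the power \<open>2 ^ b\<close>, the
  leaf count, indices, addresses and literals. It is polynomially bounded in \<open>n\<close>, hence
  a cell takes \<open>O(log n)\<close> bits.\<close>

definition value_bound :: "nat \<Rightarrow> nat poly \<Rightarrow> nat \<Rightarrow> nat" where
  "value_bound d q n = 2 * ((9 * width d n + 2) * (poly q n + 1)) + leaves d n + 9 * n + 3 * width d n + 20 + d"

definition free_bound :: "nat \<Rightarrow> nat poly \<Rightarrow> nat \<Rightarrow> nat" where
  "free_bound d q n = (47 + 60) * floorlog 2 (value_bound d q n ^ 60)"

text \<open>Catalytic space may depend on \<open>n\<close> only, so the register length is that of
  the largest modulus allowed. A smaller \<open>p\<close> leaves part of the tape untouched.\<close>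

definition catalytic_bound :: "nat \<Rightarrow> nat poly \<Rightarrow> nat \<Rightarrow> nat" where
  "catalytic_bound d q n = 9 * width d n * bits d n (poly q n)"

text \<open>One half of \<open>e\<close> pays for the factor \<open>n powr (1 / d)\<close> in the
  number of leaves. The other half is saved for the logarithm and for the divisor in the query
  bound.\<close>

lemma time_bound_bigo:
  assumes d: "0 < d" and e: "0 < e" "1 / d \<le> e / 2"
  shows "(\<lambda>n. real (time_bound d q n)) \<in> O(\<lambda>n. real n powr (3 + e / 2) * log 2 (real n))"
proof -
  obtain C where C: "0 < C" "\<forall>n\<ge>2. real (bits d n (poly q n)) \<le> C * log 2 (real n)"
    using bits_bound by blast
  define C' where "C' = 320 + 450 * C + 19 * (18 * (40 * C + 90) + 60) + 144 * (120 * C + 520 + 920) + 2000"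
  have "real (time_bound d q n) \<le> C' * (real n powr (3 + e / 2) * log 2 (real n))" if n: "2 \<le> n" for n
  proof -
    let ?L = "log 2 (real n)" and ?X = "real n powr (3 + e / 2)"
    let ?w = "real (width d n)" and ?b = "real (bits d n (poly q n))" and ?l = "real (floorlog 2 n)"
    have L: "1 \<le> ?L" using n by simp
    have b: "?b \<le> C * ?L" using C n by blast
    have l: "?l \<le> 2 * ?L" using floorlog_log[of n] n L by linarith
    have w: "?w \<le> 2 * real n" using width_le[of n d] n by simp
    have X2: "real n * real n \<le> ?X"
    proof -
      have "real n * real n = real n powr 2" using n powr_realpow[of "real n" 2] by (simp add: power2_eq_square)
      also have "\<dots> \<le> ?X" using n e by (intro powr_mono) auto
      finally show ?thesis .
    qed
    have X1: "1 \<le> ?X" using n e by (intro ge_one_powr_ge_zero) auto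
    have N: "real (leaves d n) \<le> 36 * ?X"
    proof -
      have "real (leaves d n) \<le> 36 * real n powr (3 + 1 / d)" using leaves_powr[OF d] n by simp
      also have "\<dots> \<le> 36 * ?X" using n e by (intro mult_left_mono powr_mono) auto
      finally show ?thesis .
    qed
    have XL: "1 \<le> ?X * ?L" using mult_mono[OF X1 L] X1 by simp
    have LX: "?L \<le> ?X * ?L" using mult_right_mono[OF X1, of ?L] L by simp
    have t1: "160 * ?l \<le> 320 * (?X * ?L)" using l LX by linarith
    have t2: "450 * ?b \<le> 450 * C * (?X * ?L)"
      using b mult_left_mono[OF LX, of C] C by linarith
    have t3: "(9 * ?w + 1) * (9 * ?w * (40 * ?b + 90) + 60) \<le> 19 * (18 * (40 * C + 90) + 60) * (?X * ?L)"
    proof -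
      have bL: "40 * ?b + 90 \<le> (40 * C + 90) * ?L" using b L by (simp add: algebra_simps)
      have "9 * ?w * (40 * ?b + 90) \<le> 18 * real n * ((40 * C + 90) * ?L)"
      proof (rule mult_mono)
        show "9 * ?w \<le> 18 * real n" using w by linarith
      qed (use bL in auto)
      moreover have "60 \<le> 60 * (real n * ?L)" using mult_mono[of 1 "real n" 1 ?L] n L by simp
      ultimately have "9 * ?w * (40 * ?b + 90) + 60 \<le> (18 * (40 * C + 90) + 60) * (real n * ?L)"
        by (simp add: algebra_simps)
      moreover have "9 * ?w + 1 \<le> 19 * real n" using w n by linarith
      ultimately have "(9 * ?w + 1) * (9 * ?w * (40 * ?b + 90) + 60)
        \<le> 19 * real n * ((18 * (40 * C + 90) + 60) * (real n * ?L))"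
        by (intro mult_mono) auto
      also have "\<dots> = 19 * (18 * (40 * C + 90) + 60) * ((real n * real n) * ?L)" by (simp add: mult_ac)
      also have "\<dots> \<le> 19 * (18 * (40 * C + 90) + 60) * (?X * ?L)"
        using X2 L C by (intro mult_left_mono mult_right_mono) auto
      finally show ?thesis .
    qed
    have t4: "4 * (real (leaves d n) * (120 * ?b + 260 * ?l + 920)) \<le> 144 * (120 * C + 520 + 920) * (?X * ?L)"
    proof -
      have "120 * ?b + 260 * ?l + 920 \<le> (120 * C + 520 + 920) * ?L" using b l L by (simp add: algebra_simps)
      then have "real (leaves d n) * (120 * ?b + 260 * ?l + 920) \<le> 36 * ?X * ((120 * C + 520 + 920) * ?L)"
        using N by (intro mult_mono) auto
      then have "4 * (real (leaves d n) * (120 * ?b + 260 * ?l + 920))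
        \<le> 4 * (36 * ?X * ((120 * C + 520 + 920) * ?L))" by (rule mult_left_mono) simp
      also have "\<dots> = 144 * (120 * C + 520 + 920) * (?X * ?L)" by algebra
      finally show ?thesis .
    qed
    have "real (time_bound d q n) = 160 * ?l + 450 * ?b + (9 * ?w + 1) * (9 * ?w * (40 * ?b + 90) + 60) +
      4 * (real (leaves d n) * (120 * ?b + 260 * ?l + 920)) + 2000"
      by (simp add: time_bound_def Let_def distrib_right)
    also have "\<dots> \<le> 320 * (?X * ?L) + 450 * C * (?X * ?L) + 19 * (18 * (40 * C + 90) + 60) * (?X * ?L) +
      144 * (120 * C + 520 + 920) * (?X * ?L) + 2000 * (?X * ?L)"
      using t1 t2 t3 t4 XL by linarith
    also have "\<dots> = C' * (?X * ?L)" by (simp only: C'_def distrib_right)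
    finally show ?thesis .
  qed
  then show ?thesis by (rule bigo_natI[where N = 2]) (auto dest: log_ge_1 intro!: mult_nonneg_nonneg)
qed

lemma free_bound_bigo:
  assumes d: "0 < d"
  shows "(\<lambda>n. real (free_bound d q n)) \<in> O(\<lambda>n. log 2 (real n))"
proof -
  obtain C m where C: "1 \<le> C" "\<forall>n\<ge>1. 2 * ((9 * width d n + 2) * (poly q n + 1)) \<le> C * n ^ m"
    using modulus_bound by blast
  define C1 where "C1 = C + 36 + 35 + d"
  define C2 where "C2 = log 2 (real C1) + real (m + 4)"
  have "real (free_bound d q n) \<le> 107 * (60 * C2 + 1) * log 2 (real n)" if n: "2 \<le> n" for n
  proof -
    let ?Z = "value_bound d q n" and ?E = "n ^ (m + 4)"
    have E: "n ^ m \<le> ?E" "n ^ 4 \<le> ?E" "n \<le> ?E"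
      using n self_le_power[of n "m + 4"] by (auto intro: power_increasing)
    have "C * n ^ m \<le> C * ?E" using E by (intro mult_le_mono2)
    moreover have "d \<le> d * ?E" using n by simp
    moreover have "2 * ((9 * width d n + 2) * (poly q n + 1)) \<le> C * n ^ m" "leaves d n \<le> 36 * n ^ 4"
      "width d n \<le> 2 * n" using C(2) leaves_le[OF d] width_le n by auto
    moreover have "1 \<le> ?E" using n by simp
    ultimately have "?Z \<le> C * ?E + 36 * ?E + 35 * ?E + d * ?E"
      using E unfolding value_bound_def by linarith
    then have "?Z \<le> C1 * ?E" by (simp add: C1_def algebra_simps)
    moreover have "0 < ?Z" by (simp add: value_bound_def)
    ultimately have "log 2 (real ?Z) \<le> log 2 (real (C1 * ?E))" by (simp only: log_le_cancel_iff of_nat_le_iff of_nat_0_less_iff)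
    also have "\<dots> \<le> C2 * log 2 (real n)" unfolding C2_def by (rule log_poly) (use n in \<open>auto simp: C1_def\<close>)
    finally have Z: "log 2 (real ?Z) \<le> C2 * log 2 (real n)" .
    have "real (floorlog 2 (?Z ^ 60)) \<le> log 2 (real (?Z ^ 60)) + 1"
      using floorlog_log[of "?Z ^ 60"] \<open>0 < ?Z\<close> by simp
    also have "\<dots> = 60 * log 2 (real ?Z) + 1" using \<open>0 < ?Z\<close> by (simp add: log_nat_power)
    also have "\<dots> \<le> 60 * (C2 * log 2 (real n)) + log 2 (real n)"
    proof -
      have "1 \<le> log 2 (real n)" using n by simp
      with Z show ?thesis by linarith
    qed
    finally show ?thesis unfolding free_bound_def by (simp add: algebra_simps)
  qed
  then show ?thesis by (rule bigo_natI[where N = 2]) (auto dest: log_ge_1)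
qed

text \<open>The width is about \<open>n / 2 ^ g\<close>, where \<open>g + 1\<close> is at least the
  square root of \<open>log 2 n / d\<close>; the bit length contributes only a factor
  \<open>O(log n)\<close>.\<close>

lemma catalytic_bound_le:
  assumes d: "0 < d"
  shows "\<exists>c>0. \<forall>\<^sub>F n in sequentially.
    real (catalytic_bound d q n) \<le> real n / 2 powr (c * sqrt (log 2 (real n)))"
proof -
  obtain C where C: "0 < C" "\<forall>n\<ge>2. real (bits d n (poly q n)) \<le> C * log 2 (real n)"
    using bits_bound by blast
  \<comment> \<open>Half of the rate \<open>1 / sqrt d\<close> at which the depth grows; the other
    half absorbs the logarithmic factor. The 36 in the next estimate is 9 times 2 from the width and
    2 from the gap between \<open>g\<close> and \<open>g + 1\<close>.\<close>
  define c where "c = 1 / (2 * sqrt (real d))"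
  have c: "0 < c" using d by (simp add: c_def)
  have "\<forall>\<^sub>F n::nat in sequentially. 36 * C * log 2 (real n) \<le> 2 powr (c * sqrt (log 2 (real n)))"
    using c C(1) by real_asymp
  then have "\<forall>\<^sub>F n in sequentially. real (catalytic_bound d q n) \<le> real n / 2 powr (c * sqrt (log 2 (real n)))"
    using eventually_ge_at_top[of 2]
  proof eventually_elim
    case (elim n)
    let ?L = "log 2 (real n)" and ?g = "depth d n" and ?l = "floorlog 2 n"
    have gl: "?g + 1 \<le> ?l"
    proof (rule ccontr)
      assume "\<not> ?g + 1 \<le> ?l"
      then have "?l * ?l \<le> ?g * ?g" by (intro mult_le_mono) auto
      also have "\<dots> \<le> d * (?g * ?g)" using d by simp
      also have "\<dots> \<le> ?l" by (rule depth_square[OF d])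
      finally have "?l \<le> 1" by (cases ?l) auto
      moreover have "n < 2 ^ ?l" using floorlog_bounds[of n 2] elim by simp
      moreover have "(2::nat) ^ ?l \<le> 2 ^ 1" using \<open>?l \<le> 1\<close> by (intro power_increasing) auto
      ultimately show False using elim by simp
    qed
    have "(2::nat) ^ ?g \<le> 2 ^ (?l - 1)" using gl by (intro power_increasing) auto
    also have "\<dots> \<le> n" using floorlog_bounds[of n 2] elim by simp
    finally have gn: "2 ^ ?g \<le> n" .
    have "real (width d n) \<le> real n / 2 ^ ?g + 1"
      using of_nat_div_le_of_nat[of n "2 ^ ?g", where ?'a = real] by (simp add: width_def)
    also have "1 \<le> real n / 2 ^ ?g" using gn by (simp add: le_divide_eq)
    finally have w: "real (width d n) \<le> 2 * (real n / 2 ^ ?g)" by simp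
    \<comment> \<open>By maximality of the depth, \<open>Suc ?g\<close> violates
      \<open>d * (g * g) \<le> floorlog 2 n\<close>.\<close>
    have g: "2 * c * sqrt ?L \<le> real ?g + 1"
    proof -
      have "\<not> d * (Suc ?g * Suc ?g) \<le> ?l" using le_depth_iff[OF d, of "Suc ?g" n] by simp
      then have "real ?l \<le> real (d * (Suc ?g * Suc ?g))" by (simp only: of_nat_le_iff)
      then have "?L \<le> real d * (real ?g + 1)\<^sup>2"
        using floorlog_log[of n] elim by (simp add: power2_eq_square algebra_simps)
      then have "sqrt ?L \<le> sqrt (real d) * (real ?g + 1)"
        using real_sqrt_le_mono[of ?L "real d * (real ?g + 1)\<^sup>2"] by (simp add: real_sqrt_mult)
      then show ?thesis using d by (simp add: c_def field_simps)
    qed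
    have "2 powr (2 * c * sqrt ?L) \<le> 2 powr (real ?g + 1)" using g by (intro powr_mono) auto
    also have "\<dots> = 2 * 2 ^ ?g" by (simp add: powr_add powr_realpow)
    finally have p: "2 powr (c * sqrt ?L) * 2 powr (c * sqrt ?L) \<le> 2 * 2 ^ ?g" by (simp add: mult.assoc flip: powr_add)
    let ?P = "2 powr (c * sqrt ?L)"
    have "real (catalytic_bound d q n) = 9 * real (width d n) * real (bits d n (poly q n))"
      by (simp add: catalytic_bound_def)
    also have "\<dots> \<le> 9 * (2 * (real n / 2 ^ ?g)) * (C * ?L)"
      using w C elim by (intro mult_mono) auto
    also have "\<dots> = (36 * C * ?L) * (real n / (2 * 2 ^ ?g))" by simp
    also have "\<dots> \<le> ?P * (real n / (?P * ?P))"
    proof (rule mult_mono)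
      show "real n / (2 * 2 ^ ?g) \<le> real n / (?P * ?P)" using p by (rule divide_left_mono) auto
    qed (use elim in auto)
    also have "\<dots> = real n / ?P" by simp
    finally show ?case .
  qed
  with c show ?thesis by blast
qed

lemma algorithm_computes:
  assumes d: "0 < d" and p: "prime p" "p \<le> poly q n" and weights: "weight_oracle n p \<mu> D"
    and uv: "u \<in> verts (Grid n)" "v \<in> verts (Grid n)" "graph_dist (Grid n) u v = ereal (2 ^ k)"
    and \<tau>: "length \<tau> = catalytic_bound d q n"
  shows "catalytic_computes (compile 47 0 (algorithm d)) D [n, p, fst u, snd u, fst v, snd v] \<tau>
    (path_sum (Grid n) \<mu> u v mod p) (time_bound d q n) (free_bound d q n) (time_bound d q n)"
proof -
  obtain iu ju iv jv where u: "u = (iu, ju)" and v: "v = (iv, jv)" by (cases u, cases v) auto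
  have iv: "iv = iu + 2 ^ k" using graph_dist_Grid uv(3) u v by blast
  have le: "iu \<le> n" "ju \<le> n" "iu + 2 ^ k \<le> n" "jv \<le> n" using uv u v iv by (auto simp: Grid_simps)
  let ?w = "width d n" and ?b = "bits d n p" and ?Z = "value_bound d q n" and ?B = "bits d n (poly q n)"
  have b: "?b \<le> ?B" by (rule bits_mono[OF p(2)])
  have p2: "2 \<le> p" using p(1) by (rule prime_ge_2_nat)
  have kn: "2 ^ k \<le> n" using le by linarith
  have N: "blocks.cnt n ?w k \<le> leaves d n" by (rule cnt_le_leaves[OF kn])
  have bZ: "2 ^ ?b \<le> ?Z"
  proof -
    have "(2::nat) ^ ?b \<le> 2 ^ ?B" using b by (intro power_increasing) auto
    with pow_bits_le[of d n "poly q n"] show ?thesis unfolding value_bound_def by linarith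
  qed
  have space: "9 * ?w * ?b \<le> length \<tau>" unfolding \<tau> catalytic_bound_def using b by (rule mult_le_mono2)
  let ?xs = "[n, p, iu, ju, iu + 2 ^ k, jv]"
  let ?f = "free (initial ?xs \<tau>)"
  have f: "?f 0 = n" "?f 1 = p" "?f 2 = iu" "?f 3 = ju" "?f 4 = iu + 2 ^ k" "?f 5 = jv"
    by (simp_all add: initial_def)
  have NZ: "blocks.cnt n ?w k \<le> ?Z" "9 * n + 3 * ?w + 20 \<le> ?Z" using N by (simp_all add: value_bound_def)
  obtain t st where t: "big ?Z D (algorithm d) (?f, \<tau>) t st"
    "t \<le> 100 * floorlog 2 n + 450 * ?b + (9 * ?w + 1) * (9 * ?w * (40 * ?b + 90) + 60) + 60 * k +
     4 * (blocks.cnt n ?w k * (120 * ?b + 260 * k + 920)) + 2000"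
    "fst st 0 = path_sum (Grid n) \<mu> (iu, ju) (iu + 2 ^ k, jv) mod p" "snd st = \<tau>"
    using wp_algorithm[OF d p2 weights le(3,2,4) refl refl space bZ NZ f] unfolding wp_def by blast
  have "t \<le> time_bound d q n"
  proof -
    have "k \<le> floorlog 2 n"
    proof -
      have "n < 2 ^ floorlog 2 n" using floorlog_bounds[of n 2] kn by (cases "n = 0") auto
      with kn have "(2::nat) ^ k < 2 ^ floorlog 2 n" by linarith
      then have "k < floorlog 2 n" by (rule power_less_imp_less_exp[rotated]) simp
      then show ?thesis by simp
    qed
    then have "100 * floorlog 2 n + 450 * ?b + (9 * ?w + 1) * (9 * ?w * (40 * ?b + 90) + 60) + 60 * k +
     4 * (blocks.cnt n ?w k * (120 * ?b + 260 * k + 920)) + 2000 \<le> time_bound d q n"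
      unfolding time_bound_def Let_def using b N
      by (intro add_mono mult_le_mono order_refl)
    with t(2) show ?thesis by linarith
  qed
  moreover have "big ?Z D (algorithm d) (?f, \<tau>) t (fst st, \<tau>)" using t(1,4) by (metis prod.collapse)
  moreover have "p \<le> ?Z" using p(2) unfolding value_bound_def by simp
  ultimately have "catalytic_computes (compile 47 0 (algorithm d)) D ?xs \<tau> (fst st 0)
    (time_bound d q n) ((47 + 60) * floorlog 2 (?Z ^ 60)) (time_bound d q n)"
    using le by (intro compile_correct[OF _ wf_algorithm]) (auto simp: value_bound_def)
  then show ?thesis using t(3) by (simp add: u v iv free_bound_def)
qed

theorem theorem6p7:
  fixes \<epsilon> :: real
  assumes "\<epsilon> > 0"
  shows "\<exists>A :: program. \<forall>q :: nat poly. \<exists>T S K Q :: nat \<Rightarrow> nat.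
    (\<lambda>n. real (T n)) \<in> O(\<lambda>n. real n powr (3 + \<epsilon>)) \<and>
    (\<lambda>n. real (S n)) \<in> O(\<lambda>n. log 2 (real n)) \<and>
    (\<exists>c>0. \<forall>\<^sub>F n in sequentially.
       real (K n) \<le> real n / 2 powr (c * sqrt (log 2 (real n)))) \<and>
    (\<lambda>n. real (Q n)) \<in> O(\<lambda>n. real n powr (3 + \<epsilon>) / 2 powr (3 * sqrt (log 2 (real n)))) \<and>
    (\<forall>(n :: nat) (p :: nat) \<mu> D u v.
       prime p \<longrightarrow> p \<le> poly q n \<longrightarrow> weight_oracle n p \<mu> D \<longrightarrow>
       u \<in> verts (Grid n) \<longrightarrow> v \<in> verts (Grid n) \<longrightarrow>
       (\<exists>k :: nat. graph_dist (Grid n) u v = ereal (2 ^ k)) \<longrightarrow>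
       (\<forall>\<tau> :: bool list. length \<tau> = K n \<longrightarrow>
          catalytic_computes A D [n, p, fst u, snd u, fst v, snd v] \<tau>
            (path_sum (Grid n) \<mu> u v mod p) (T n) (S n) (Q n)))"
proof -
  \<comment> \<open>Only \<open>d\<close> enters the program, and it depends on \<epsilon> alone, as
    the quantifier over \<open>q\<close> comes after the choice of the program.\<close>
  obtain d :: nat where "2 / \<epsilon> < real d" using reals_Archimedean2 by blast
  then have "0 < real d" using assms by (meson divide_pos_pos less_trans zero_less_numeral)
  then have d: "0 < d" "1 / real d \<le> \<epsilon> / 2"
    using assms \<open>2 / \<epsilon> < real d\<close> by (simp_all add: field_simps)
  have Q: "(\<lambda>n. real (time_bound d q n)) \<in> O(\<lambda>n. real n powr (3 + \<epsilon>) / 2 powr (3 * sqrt (log 2 (real n))))" for q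
  proof (rule landau_o.big_trans[OF time_bound_bigo[OF d(1) assms d(2)]])
    show "(\<lambda>n. real n powr (3 + \<epsilon> / 2) * log 2 (real n)) \<in>
      O(\<lambda>n. real n powr (3 + \<epsilon>) / 2 powr (3 * sqrt (log 2 (real n))))"
      using assms by real_asymp
  qed
  \<comment> \<open>The query bound is asymptotically smaller than the time bound, so it is shown
    first and implies the latter.\<close>
  moreover have "(\<lambda>n. real (time_bound d q n)) \<in> O(\<lambda>n. real n powr (3 + \<epsilon>))" for q
    by (rule landau_o.big_trans[OF Q]) real_asymp
  ultimately show ?thesis
    using free_bound_bigo[OF d(1)] catalytic_bound_le[OF d(1)] algorithm_computes[OF d(1)]
    by (intro exI[of _ "compile 47 0 (algorithm d)"] allI exI[of _ "time_bound d _"]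
        exI[of _ "free_bound d _"] exI[of _ "catalytic_bound d _"]) blast
qed

end
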